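(* Let $\sigma$ be a non-zero symmetric measure on $[-\pi,\pi[$ with the $(FS)$ property. Then for every system $(X,\mathcal{A},\mu,T)$ of type $\mathbf{II}_{\infty}$, $\sigma$ is not the spectral measure of any vector $f\in L^2(\mu)$.
   Context: $(X,\mathcal{A},\mu,T)$: $(X,\mathcal{A},\mu)$ is a $\sigma$-finite Lebesgue space and $T$ an automorphism (invertible measure preserving transformation). $T$ is of type $\mathbf{II}_{\infty}$ if it is conservative (no wandering set of positive measure) and there is no $T$-invariant probability measure $\tilde\mu\ll\mu$. The spectral measure of $f\in L^2(\mu)$ is the finite measure $\sigma_f$ on $[-\pi,\pi[$ (identified with the circle) with Fourier coefficients $\hat\sigma_f(k)=\int f\circ T^{k}\,\overline{f}\,d\mu$, $k\in\mathbb{Z}$. A symmetric (finite) measure $\sigma$ on $[-\pi,\pi[$ has the "Foiaş and Strătilă" $(FS)$ property if, for any ergodic probability preserving dynamical system $(Y,\mathcal{C},\nu,S)$, every $f\in L^2_0(\nu,S)$ (real-valued, square integrable, of zero mean) with spectral measure $\sigma$ is a Gaussian random variable. *)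

theory Defs
  imports "HOL-Probability.Probability"
begin

section \<open>Lebesgue spaces and their automorphisms\<close>

definition measure_isomorphism :: "('a \<Rightarrow> 'b) \<Rightarrow> 'a measure \<Rightarrow> 'b measure \<Rightarrow> bool" where
  "measure_isomorphism \<phi> M N \<longleftrightarrow>
     bij_betw \<phi> (space M) (space N) \<and>
     \<phi> \<in> measurable M N \<and>
     inv_into (space M) \<phi> \<in> measurable N M \<and>
     distr M N \<phi> = N"

definition isomorphic_mod_0 :: "'a measure \<Rightarrow> 'b measure \<Rightarrow> bool" where
  "isomorphic_mod_0 M N \<longleftrightarrow>
     (\<exists>Z \<in> null_sets M. \<exists>Z' \<in> null_sets N. \<exists>\<phi>.
        measure_isomorphism \<phi> (restrict_space M (space M - Z)) (restrict_space N (space N - Z')))"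

text \<open>
  A \<open>\<sigma>\<close>-finite Lebesgue space is a complete measure space isomorphic, modulo null sets, to the
  completion of a \<open>\<sigma>\<close>-finite Borel measure on the line (every standard Borel space embeds as a
  Borel subset of the line). Atoms are allowed.
\<close>

definition lebesgue_space :: "'a measure \<Rightarrow> bool" where
  "lebesgue_space M \<longleftrightarrow>
     complete_measure M \<and>
     (\<exists>N :: real measure. sets N = sets borel \<and> sigma_finite_measure N \<and>
        isomorphic_mod_0 M (completion N))"

definition dynamical_system :: "'a measure \<Rightarrow> ('a \<Rightarrow> 'a) \<Rightarrow> bool" where
  "dynamical_system M T \<longleftrightarrow> lebesgue_space M \<and> measure_isomorphism T M M"

definition int_iterate :: "'a measure \<Rightarrow> ('a \<Rightarrow> 'a) \<Rightarrow> int \<Rightarrow> 'a \<Rightarrow> 'a" where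
  "int_iterate M T k =
     (if k \<ge> 0 then T ^^ nat k else inv_into (space M) T ^^ nat (- k))"

definition wandering :: "'a measure \<Rightarrow> ('a \<Rightarrow> 'a) \<Rightarrow> 'a set \<Rightarrow> bool" where
  "wandering M T W \<longleftrightarrow>
     W \<in> sets M \<and> disjoint_family (\<lambda>n :: nat. (T ^^ n) -` W \<inter> space M)"

definition conservative :: "'a measure \<Rightarrow> ('a \<Rightarrow> 'a) \<Rightarrow> bool" where
  "conservative M T \<longleftrightarrow> \<not> (\<exists>W. wandering M T W \<and> emeasure M W > 0)"

definition type_II_infinity :: "'a measure \<Rightarrow> ('a \<Rightarrow> 'a) \<Rightarrow> bool" where
  "type_II_infinity M T \<longleftrightarrow>
     dynamical_system M T \<and> conservative M T \<and>
     \<not> (\<exists>P. prob_space P \<and> sets P = sets M \<and> absolutely_continuous M P \<and> distr P P T = P)"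

definition ergodic_probability_system :: "'a measure \<Rightarrow> ('a \<Rightarrow> 'a) \<Rightarrow> bool" where
  "ergodic_probability_system M T \<longleftrightarrow>
     dynamical_system M T \<and> prob_space M \<and>
     (\<forall>A \<in> sets M. T -` A \<inter> space M = A \<longrightarrow> emeasure M A = 0 \<or> emeasure M A = 1)"

section \<open>Spectral measures\<close>

definition circle_measure :: "real measure \<Rightarrow> bool" where
  "circle_measure \<sigma> \<longleftrightarrow> finite_measure \<sigma> \<and> sets \<sigma> = sets (restrict_space borel {-pi..<pi})"

text \<open>
  Since \<open>[-\<pi>, \<pi>[\<close> stands for the circle, the point \<open>-\<pi>\<close> is its own opposite.
\<close>

definition circle_opposite :: "real \<Rightarrow> real" where
  "circle_opposite t = (if t = -pi then -pi else - t)"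

definition symmetric_measure :: "real measure \<Rightarrow> bool" where
  "symmetric_measure \<sigma> \<longleftrightarrow> distr \<sigma> \<sigma> circle_opposite = \<sigma>"

definition fourier_coefficient :: "real measure \<Rightarrow> int \<Rightarrow> complex" where
  "fourier_coefficient \<sigma> k = (LINT t|\<sigma>. cis (of_int k * t))"

definition L2 :: "'a measure \<Rightarrow> ('a \<Rightarrow> complex) set" where
  "L2 M = {f. f \<in> borel_measurable M \<and> integrable M (\<lambda>x. (norm (f x))\<^sup>2)}"

definition L2_0 :: "'a measure \<Rightarrow> ('a \<Rightarrow> real) set" where
  "L2_0 M = {f. f \<in> borel_measurable M \<and> integrable M (\<lambda>x. (f x)\<^sup>2) \<and> (LINT x|M. f x) = 0}"

definition spectral_measure :: "'a measure \<Rightarrow> ('a \<Rightarrow> 'a) \<Rightarrow> ('a \<Rightarrow> complex) \<Rightarrow> real measure \<Rightarrow> bool" where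
  "spectral_measure M T f \<sigma> \<longleftrightarrow>
     circle_measure \<sigma> \<and>
     (\<forall>k. fourier_coefficient \<sigma> k = (LINT x|M. f (int_iterate M T k x) * cnj (f x)))"

section \<open>The Foias--Stratila property\<close>

text \<open>
  Almost surely constant variables are counted as Gaussian; this only matters for the zero
  spectral measure.
\<close>

definition gaussian_rv :: "'a measure \<Rightarrow> ('a \<Rightarrow> real) \<Rightarrow> bool" where
  "gaussian_rv M f \<longleftrightarrow>
     f \<in> borel_measurable M \<and>
     ((\<exists>m. AE x in M. f x = m) \<or>
      (\<exists>m s. 0 < s \<and> distributed M lborel f (normal_density m s)))"

text \<open>
  The quantifier over all ergodic systems ranges over Lebesgue spaces whose points are reals.
  Up to isomorphism mod 0 these are all the Lebesgue spaces (the underlying set may be any set of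
  reals), so no system is lost, and as a hypothesis the property is not strengthened.
\<close>

definition FS_property :: "real measure \<Rightarrow> bool" where
  "FS_property \<sigma> \<longleftrightarrow>
     circle_measure \<sigma> \<and> symmetric_measure \<sigma> \<and>
     (\<forall>(N :: real measure) S f.
        ergodic_probability_system N S \<longrightarrow> f \<in> L2_0 N \<longrightarrow>
        spectral_measure N S (\<lambda>y. complex_of_real (f y)) \<sigma> \<longrightarrow> gaussian_rv N f)"

end

theory Submission
  imports Defs
begin

text \<open>
  The idea is to suspend the infinite measure system: a Poisson process of points whose intensity is
  the invariant measure carries a probability preserving transformation, and the centred stochastic
  integral of \<open>f\<close> against this process has the same spectral measure as \<open>f\<close>. The suspension is
  ergodic because there is no invariant probability \<open>P \<lless> \<mu>\<close>. So the property of \<open>\<sigma>\<close> would make the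
  stochastic integral Gaussian, whereas an integral against a Poisson process has no Gaussian part.

  The suspension is never built on a space of configurations. By a theorem of Renyi the law of a
  simple point process is determined by its void probabilities, and these are the only information
  kept: a point of the model is a family \<open>z\<close> of truth values, where \<open>z i\<close> says that the set \<open>R i\<close>
  contains no point. The events ``all sets \<open>R i\<close> with \<open>i \<in> F\<close> are void'' form a \<open>\<pi>\<close>-system, on which
  the law takes the value \<open>exp (- \<mu> (\<Union>i\<in>F. R i))\<close>. The transformation permutes the indices, and it
  preserves the law because \<open>T\<close> preserves \<open>\<mu>\<close> (\<open>poisson_void_probabilities\<close>,
  \<open>binary_measure_eqI\<close>). Countably many sets suffice, since only \<open>f\<close> has to be approximated, and
  hence the model can be coded by real numbers (\<open>ergodic_real_model\<close>).

  For a set \<open>A\<close> of small measure, \<open>1 - exp (\<mu> A) 1[A is void]\<close> is close to the centred number of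
  points in \<open>A\<close>. Two such variables have covariance \<open>exp (\<mu> (A \<inter> B)) - 1\<close>, which is
  \<open>\<mu> (A \<inter> B)\<close> up to second order. Therefore, if step functions with values \<open>a\<^sub>i\<close> on small disjoint sets
  converge to \<open>F\<close> in \<open>L\<^sup>2\<close>, then the corresponding linear combinations of void indicators converge to
  a variable \<open>X\<close> whose autocovariances are those of \<open>F\<close> (\<open>stochastic_integral\<close>). Sets can be
  made small while following the transformation after multiplying the space by a line of marks on
  which the transformation acts trivially. The marks also serve to place the real and the imaginary part
  of \<open>f\<close> on two different unit intervals. This produces a real vector \<open>F\<close> with autocovariances
  \<open>Re \<integral> f \<circ> T\<^sup>k \<cdot> cnj f\<close>, and these are the Fourier coefficients of \<open>\<sigma>\<close>, which are real as \<open>\<sigma>\<close> is symmetric.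

  Ergodicity: the minimal norm vector in the closed convex hull of the functions \<open>1\<^sub>B \<circ> T\<^sup>k\<close> is
  invariant, so it vanishes, and suitable convex combinations have arbitrarily small norm
  (\<open>averages_of_translates_vanish\<close>). The covariance of two translates of a void event is at most
  the measure of the intersection of the translated sets, so the same convex combinations of translates of a
  void event have arbitrarily small variance, and an invariant event is independent of every void
  event, thus of itself (\<open>ergodic_shift\<close>).

  Absence of a Gaussian part: independence over disjoint sets gives the lower bound
  \<open>exp (- 2 \<integral> min (t\<^sup>2 F\<^sup>2) 2 d\<mu>)\<close> for the modulus of the characteristic function of \<open>X\<close>, and the
  exponent is \<open>o(t\<^sup>2)\<close>, unlike that of a nondegenerate Gaussian law (\<open>normal_not_bounded_below\<close>). A degenerate
  law is excluded because the variance of \<open>X\<close> is the total mass of \<open>\<sigma>\<close>.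
\<close>

section \<open>Square-integrable functions\<close>

definition square_integrable :: "'a measure \<Rightarrow> ('a \<Rightarrow> real) \<Rightarrow> bool" where
  "square_integrable M f \<longleftrightarrow> f \<in> borel_measurable M \<and> integrable M (\<lambda>x. (f x)\<^sup>2)"

definition norm_L2 :: "'a measure \<Rightarrow> ('a \<Rightarrow> real) \<Rightarrow> real" where
  "norm_L2 M f = sqrt (LINT x|M. (f x)\<^sup>2)"

lemma square_integrable_measurable [measurable_dest]:
  "square_integrable M f \<Longrightarrow> f \<in> borel_measurable M"
  by (simp add: square_integrable_def)

lemma square_integrableD: "square_integrable M f \<Longrightarrow> integrable M (\<lambda>x. (f x)\<^sup>2)"
  by (simp add: square_integrable_def)

lemma integrable_mult_of_squares:
  assumes f: "square_integrable M f" and g: "square_integrable M g"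
  shows "integrable M (\<lambda>x. f x * g x)"
proof (rule Bochner_Integration.integrable_bound)
  show "integrable M (\<lambda>x. (f x)\<^sup>2 + (g x)\<^sup>2)"
    using f g by (simp add: square_integrable_def)
  show "(\<lambda>x. f x * g x) \<in> borel_measurable M"
    using f g by measurable
  have "norm (a * b) \<le> norm (a\<^sup>2 + b\<^sup>2)" for a b :: real
  proof -
    have "0 \<le> \<bar>a\<bar> * \<bar>b\<bar>" by simp
    then have "\<bar>a * b\<bar> \<le> a\<^sup>2 + b\<^sup>2"
      using sum_squares_bound[of "\<bar>a\<bar>" "\<bar>b\<bar>"] unfolding abs_mult power2_abs by linarith
    then show ?thesis by simp
  qed
  then show "AE x in M. norm (f x * g x) \<le> norm ((f x)\<^sup>2 + (g x)\<^sup>2)"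
    by blast
qed

lemma square_integrable_cmult:
  assumes "square_integrable M f" shows "square_integrable M (\<lambda>x. c * f x)"
  using assms by (auto simp: square_integrable_def power_mult_distrib)

lemma square_integrable_add:
  assumes f: "square_integrable M f" and g: "square_integrable M g"
  shows "square_integrable M (\<lambda>x. f x + g x)"
  using f g integrable_mult_of_squares[OF f g]
  by (auto simp: square_integrable_def power2_sum mult.assoc)

lemma square_integrable_diff:
  assumes f: "square_integrable M f" and g: "square_integrable M g"
  shows "square_integrable M (\<lambda>x. f x - g x)"
  using square_integrable_add[OF f square_integrable_cmult[OF g, of "-1"]] by simp

lemma square_integrable_zero: "square_integrable M (\<lambda>x. 0)"
  by (simp add: square_integrable_def)

lemma square_integrable_sum:
  assumes "\<And>i. i \<in> I \<Longrightarrow> square_integrable M (f i)"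
  shows "square_integrable M (\<lambda>x. \<Sum>i\<in>I. f i x)"
  using assms
  by (induction I rule: infinite_finite_induct)
     (auto simp: square_integrable_zero intro!: square_integrable_add)

lemma square_integrable_bounded:
  assumes f: "f \<in> borel_measurable M" and g: "square_integrable M g"
    and le: "\<And>x. x \<in> space M \<Longrightarrow> \<bar>f x\<bar> \<le> \<bar>g x\<bar>"
  shows "square_integrable M f"
  unfolding square_integrable_def
proof
  show "integrable M (\<lambda>x. (f x)\<^sup>2)"
    by (rule Bochner_Integration.integrable_bound[OF square_integrableD[OF g]])
       (use f le in \<open>auto simp: abs_le_square_iff\<close>)
qed (fact f)

lemma square_integrable_bounded_prob:
  assumes "finite_measure M" "f \<in> borel_measurable M" "\<And>x. x \<in> space M \<Longrightarrow> \<bar>f x\<bar> \<le> c"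
  shows "square_integrable M f"
proof (rule square_integrable_bounded[OF assms(2), where g="\<lambda>x. c"])
  interpret finite_measure M by fact
  show "square_integrable M (\<lambda>x. c)" by (simp add: square_integrable_def)
  show "\<And>x. x \<in> space M \<Longrightarrow> \<bar>f x\<bar> \<le> \<bar>c\<bar>" using assms(3) by fastforce
qed

lemma norm_L2_nonneg [simp]: "0 \<le> norm_L2 M f"
  by (simp add: norm_L2_def)

lemma norm_L2_power2: "(norm_L2 M f)\<^sup>2 = (LINT x|M. (f x)\<^sup>2)"
  by (simp add: norm_L2_def)

lemma norm_L2_minus_commute: "norm_L2 M (\<lambda>x. f x - g x) = norm_L2 M (\<lambda>x. g x - f x)"
  by (simp add: norm_L2_def power2_commute)

lemma Cauchy_Schwarz_L2:
  assumes f: "square_integrable M f" and g: "square_integrable M g"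
  shows "\<bar>LINT x|M. f x * g x\<bar> \<le> norm_L2 M f * norm_L2 M g"
proof -
  let ?F = "LINT x|M. (f x)\<^sup>2" and ?G = "LINT x|M. (g x)\<^sup>2" and ?B = "LINT x|M. f x * g x"
  \<comment> \<open>The quadratic polynomial \<open>\<parallel>f - c g\<parallel>\<^sup>2\<close> in \<open>c\<close> is nonnegative.\<close>
  have q: "0 \<le> ?F - 2 * c * ?B + c\<^sup>2 * ?G" for c
  proof -
    have "0 \<le> (LINT x|M. (f x - c * g x)\<^sup>2)"
      by simp
    also have "(\<lambda>x. (f x - c * g x)\<^sup>2) = (\<lambda>x. ((f x)\<^sup>2 - 2 * c * (f x * g x)) + c\<^sup>2 * (g x)\<^sup>2)"
      by (auto simp: power2_eq_square algebra_simps)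
    also have "(LINT x|M. ((f x)\<^sup>2 - 2 * c * (f x * g x)) + c\<^sup>2 * (g x)\<^sup>2) = ?F - 2 * c * ?B + c\<^sup>2 * ?G"
      using integrable_mult_of_squares[OF f g] square_integrableD[OF f] square_integrableD[OF g] by simp
    finally show ?thesis .
  qed
  have "?B\<^sup>2 \<le> ?F * ?G"
  proof (cases "?G = 0")
    case True
    have "?B = 0"
    proof (rule ccontr)
      assume "?B \<noteq> 0"
      then show False using q[of "(?F + 1) / (2 * ?B)"] True by simp
    qed
    then show ?thesis using True by simp
  next
    case False
    then have "?G > 0" by (simp add: order_less_le)
    then show ?thesis using q[of "?B / ?G"]
      by (simp add: field_simps power2_eq_square)
  qed
  then have "sqrt (?B\<^sup>2) \<le> sqrt (?F * ?G)" by (rule real_sqrt_le_mono)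
  then show ?thesis by (simp add: norm_L2_def real_sqrt_mult)
qed

lemma norm_L2_triangle:
  assumes f: "square_integrable M f" and g: "square_integrable M g"
  shows "norm_L2 M (\<lambda>x. f x + g x) \<le> norm_L2 M f + norm_L2 M g"
proof (rule power2_le_imp_le)
  have "(norm_L2 M (\<lambda>x. f x + g x))\<^sup>2 = (LINT x|M. ((f x)\<^sup>2 + (g x)\<^sup>2) + 2 * (f x * g x))"
    by (simp add: norm_L2_power2 power2_sum mult.assoc)
  also have "\<dots> = (norm_L2 M f)\<^sup>2 + (norm_L2 M g)\<^sup>2 + 2 * (LINT x|M. f x * g x)"
    using integrable_mult_of_squares[OF f g] square_integrableD[OF f] square_integrableD[OF g]
    by (simp add: norm_L2_power2)
  also have "\<dots> \<le> (norm_L2 M f + norm_L2 M g)\<^sup>2"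
    using Cauchy_Schwarz_L2[OF f g] by (simp add: power2_sum)
  finally show "(norm_L2 M (\<lambda>x. f x + g x))\<^sup>2 \<le> (norm_L2 M f + norm_L2 M g)\<^sup>2" .
qed simp

lemma norm_L2_triangle_diff:
  assumes f: "square_integrable M f" and g: "square_integrable M g" and h: "square_integrable M h"
  shows "norm_L2 M (\<lambda>x. f x - h x) \<le> norm_L2 M (\<lambda>x. f x - g x) + norm_L2 M (\<lambda>x. g x - h x)"
  using norm_L2_triangle[OF square_integrable_diff[OF f g] square_integrable_diff[OF g h]] by simp

lemma tendsto_L2_inner:
  assumes f: "\<And>n. square_integrable M (f n)" "square_integrable M f'"
      "(\<lambda>n. norm_L2 M (\<lambda>x. f n x - f' x)) \<longlonglongrightarrow> 0"
    and g: "\<And>n. square_integrable M (g n)" "square_integrable M g'"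
      "(\<lambda>n. norm_L2 M (\<lambda>x. g n x - g' x)) \<longlonglongrightarrow> 0"
  shows "(\<lambda>n. LINT x|M. f n x * g n x) \<longlonglongrightarrow> (LINT x|M. f' x * g' x)"
proof -
  let ?d = "\<lambda>n. norm_L2 M (\<lambda>x. f n x - f' x)" and ?e = "\<lambda>n. norm_L2 M (\<lambda>x. g n x - g' x)"
  have "(\<lambda>n. (LINT x|M. f n x * g n x) - (LINT x|M. f' x * g' x)) \<longlonglongrightarrow> 0"
  proof (rule Lim_null_comparison)
    show "(\<lambda>n. ?d n * ?e n + ?d n * norm_L2 M g' + norm_L2 M f' * ?e n) \<longlonglongrightarrow> 0"
      using tendsto_add[OF tendsto_add[OF tendsto_mult[OF f(3) g(3)] tendsto_mult_right[OF f(3), of "norm_L2 M g'"]]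
          tendsto_mult_left[OF g(3), of "norm_L2 M f'"]] by simp
    have "norm ((LINT x|M. f n x * g n x) - (LINT x|M. f' x * g' x))
      \<le> ?d n * ?e n + ?d n * norm_L2 M g' + norm_L2 M f' * ?e n" for n
    proof -
      note df = square_integrable_diff[OF f(1) f(2), of n]
        and dg = square_integrable_diff[OF g(1) g(2), of n]
      note int = integrable_mult_of_squares[OF df dg] integrable_mult_of_squares[OF df g(2)]
        integrable_mult_of_squares[OF f(2) dg]
      have "(LINT x|M. f n x * g n x) - (LINT x|M. f' x * g' x) = (LINT x|M. f n x * g n x - f' x * g' x)"
        using f g by (simp add: integrable_mult_of_squares)
      also have "\<dots> = (LINT x|M. ((f n x - f' x) * (g n x - g' x) + (f n x - f' x) * g' x) + f' x * (g n x - g' x))"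
        by (rule Bochner_Integration.integral_cong) (auto simp: algebra_simps)
      also have "\<dots> = (LINT x|M. (f n x - f' x) * (g n x - g' x)) + (LINT x|M. (f n x - f' x) * g' x)
          + (LINT x|M. f' x * (g n x - g' x))"
        using int by simp
      finally show ?thesis
        using Cauchy_Schwarz_L2[OF df dg] Cauchy_Schwarz_L2[OF df g(2)] Cauchy_Schwarz_L2[OF f(2) dg]
        by simp
    qed
    then show "\<forall>\<^sub>F n in sequentially. norm ((LINT x|M. f n x * g n x) - (LINT x|M. f' x * g' x))
      \<le> ?d n * ?e n + ?d n * norm_L2 M g' + norm_L2 M f' * ?e n" by simp
  qed
  then show ?thesis by (rule LIM_zero_cancel)
qed

text \<open>
  A subsequence with geometrically small increments converges almost everywhere, and
  Fatou's lemma turns this into convergence in norm of the whole sequence.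
\<close>

lemma L2_complete:
  assumes f: "\<And>n. square_integrable M (f n)"
    and cauchy: "\<And>e. 0 < e \<Longrightarrow> \<exists>N. \<forall>m\<ge>N. \<forall>n\<ge>N. norm_L2 M (\<lambda>x. f m x - f n x) < e"
  obtains g where "square_integrable M g" "(\<lambda>n. norm_L2 M (\<lambda>x. f n x - g x)) \<longlonglongrightarrow> 0"
proof -
  have [measurable]: "f n \<in> borel_measurable M" for n using f by (rule square_integrable_measurable)
  obtain R where R: "\<And>e m n. 0 < e \<Longrightarrow> R e \<le> m \<Longrightarrow> R e \<le> n \<Longrightarrow> norm_L2 M (\<lambda>x. f m x - f n x) < e"
    using cauchy by metis
  define r where "r = rec_nat (R 1) (\<lambda>k s. max (Suc s) (R ((1/8)^(Suc k))))"
  have r_Suc: "r (Suc k) = max (Suc (r k)) (R ((1/8)^(Suc k)))" for k by (simp add: r_def)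
  have mono_r: "strict_mono r" by (auto simp: strict_mono_Suc_iff r_Suc less_max_iff_disj)
  have r_ge: "R ((1/8)^k) \<le> r k" for k by (cases k) (simp_all add: r_Suc, simp add: r_def)
  define d where "d k x = f (r (Suc k)) x - f (r k) x" for k x
  have [measurable]: "d k \<in> borel_measurable M" for k unfolding d_def by measurable
  have sd: "square_integrable M (d k)" for k unfolding d_def by (intro square_integrable_diff f)
  have d_small: "(LINT x|M. (d k x)\<^sup>2) \<le> (1/64)^k" for k
  proof -
    have "norm_L2 M (d k) < (1/8)^k"
      unfolding d_def
      using r_ge[of k] strict_mono_less_eq[OF mono_r, of k "Suc k"] by (intro R) auto
    then have "(norm_L2 M (d k))\<^sup>2 \<le> ((1/8)^k)\<^sup>2" by (intro power_mono) auto
    also have "((1/8)^k)\<^sup>2 = (1/64::real)^k"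
      by (simp add: power2_eq_square flip: power_mult_distrib)
    finally show ?thesis by (simp add: norm_L2_power2)
  qed
  \<comment> \<open>Weighting the squared increments by \<open>4^k\<close> keeps the sum integrable, and makes the
    increments themselves summable wherever that sum is finite.\<close>
  have "(\<integral>\<^sup>+x. (\<Sum>k. ennreal (4^k * (d k x)\<^sup>2)) \<partial>M) = (\<Sum>k. \<integral>\<^sup>+x. ennreal (4^k * (d k x)\<^sup>2) \<partial>M)"
    by (rule nn_integral_suminf) measurable
  also have "\<dots> \<le> (\<Sum>k. ennreal ((1/16)^k))"
  proof (rule suminf_le)
    fix k
    have "(\<integral>\<^sup>+x. ennreal (4^k * (d k x)\<^sup>2) \<partial>M) = ennreal (LINT x|M. 4^k * (d k x)\<^sup>2)"
      by (rule nn_integral_eq_integral) (use square_integrableD[OF sd] in auto)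
    also have "\<dots> = ennreal (4^k * (LINT x|M. (d k x)\<^sup>2))" by simp
    also have "\<dots> \<le> ennreal (4^k * (1/64)^k)"
      by (intro ennreal_leI mult_left_mono d_small) auto
    also have "(4::real)^k * (1/64)^k = (1/16)^k" by (simp flip: power_mult_distrib)
    finally show "(\<integral>\<^sup>+x. ennreal (4^k * (d k x)\<^sup>2) \<partial>M) \<le> ennreal ((1/16)^k)" .
  qed auto
  also have "\<dots> = ennreal (\<Sum>k. (1/16)^k)" by (intro suminf_ennreal2) (auto intro: summable_geometric)
  also have "\<dots> < \<infinity>" by simp
  finally have "(\<integral>\<^sup>+x. (\<Sum>k. ennreal (4^k * (d k x)\<^sup>2)) \<partial>M) \<noteq> \<infinity>" by simp
  then have "AE x in M. (\<Sum>k. ennreal (4^k * (d k x)\<^sup>2)) \<noteq> \<infinity>"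
    by (intro nn_integral_PInf_AE) measurable
  then have conv: "AE x in M. convergent (\<lambda>k. f (r k) x)"
  proof (eventually_elim)
    case (elim x)
    then have s: "summable (\<lambda>k. 4^k * (d k x)\<^sup>2)"
      by (intro summable_suminf_not_top) auto
    have "summable (\<lambda>k. 4^k * (d k x)\<^sup>2 + (1/4)^k)"
      by (intro summable_add s summable_geometric) simp
    then have "summable (\<lambda>k. norm (d k x))"
    proof (rule summable_comparison_test'[where N=0])
      fix k :: nat
      have "2 * (2^k * \<bar>d k x\<bar>) * (1/2)^k \<le> (2^k * \<bar>d k x\<bar>)\<^sup>2 + ((1/2)^k)\<^sup>2"
        by (rule sum_squares_bound)
      also have "\<dots> = 4^k * (d k x)\<^sup>2 + (1/4)^k"
      proof -
        have "((2::real)^k)\<^sup>2 = 4^k" "((1/2::real)^k)\<^sup>2 = (1/4)^k"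
          by (simp_all add: power2_eq_square flip: power_mult_distrib)
        then show ?thesis unfolding power_mult_distrib power2_abs by simp
      qed
      also have "2 * (2^k * \<bar>d k x\<bar>) * (1/2)^k = 2 * \<bar>d k x\<bar>" by (simp add: power_divide)
      finally show "norm (norm (d k x)) \<le> 4^k * (d k x)\<^sup>2 + (1/4)^k" by simp
    qed
    then have "summable (\<lambda>k. d k x)" by (rule summable_norm_cancel)
    then show "convergent (\<lambda>k. f (r k) x)"
    proof -
      assume "summable (\<lambda>k. d k x)"
      then have "convergent (\<lambda>n. \<Sum>k<n. d k x)" by (rule summable_iff_convergent[THEN iffD1])
      then have "convergent (\<lambda>n. f (r n) x - f (r 0) x)"
        by (simp add: d_def sum_lessThan_telescope[of "\<lambda>k. f (r k) x"])
      then have "convergent (\<lambda>n. (f (r n) x - f (r 0) x) + f (r 0) x)"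
        by (intro convergent_add convergent_const)
      then show ?thesis by simp
    qed
  qed
  define g where "g x = lim (\<lambda>k. f (r k) x)" for x
  have [measurable]: "g \<in> borel_measurable M" unfolding g_def by measurable
  have lim: "AE x in M. (\<lambda>k. f (r k) x) \<longlonglongrightarrow> g x"
    using conv by eventually_elim (simp add: g_def convergent_LIMSEQ_iff)
  have fatou: "(\<integral>\<^sup>+x. ennreal ((f n x - g x)\<^sup>2) \<partial>M) \<le> ennreal (e\<^sup>2)" if "0 < e" "R e \<le> n" for n e
  proof -
    have "(\<integral>\<^sup>+x. ennreal ((f n x - g x)\<^sup>2) \<partial>M) = (\<integral>\<^sup>+x. liminf (\<lambda>k. ennreal ((f n x - f (r k) x)\<^sup>2)) \<partial>M)"
    proof (rule nn_integral_cong_AE, use lim in eventually_elim)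
      case (elim x)
      then have "(\<lambda>k. ennreal ((f n x - f (r k) x)\<^sup>2)) \<longlonglongrightarrow> ennreal ((f n x - g x)\<^sup>2)"
        by (intro tendsto_intros)
      then show ?case by (rule lim_imp_Liminf[symmetric, rotated]) simp
    qed
    also have "\<dots> \<le> liminf (\<lambda>k. \<integral>\<^sup>+x. ennreal ((f n x - f (r k) x)\<^sup>2) \<partial>M)"
      by (rule nn_integral_liminf) measurable
    also have "\<dots> \<le> ennreal (e\<^sup>2)"
    proof (rule order_trans[OF Liminf_mono[of _ _ "sequentially"]])
      show "\<forall>\<^sub>F k in sequentially. (\<integral>\<^sup>+x. ennreal ((f n x - f (r k) x)\<^sup>2) \<partial>M) \<le> ennreal (e\<^sup>2)"
      proof (rule eventually_sequentiallyI[of "R e"])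
        fix k assume "R e \<le> k"
        then have "R e \<le> r k" using seq_suble[OF mono_r, of k] by simp
        then have "norm_L2 M (\<lambda>x. f n x - f (r k) x) < e" using that by (intro R) auto
        then have "(norm_L2 M (\<lambda>x. f n x - f (r k) x))\<^sup>2 \<le> e\<^sup>2" by (intro power_mono) auto
        then show "(\<integral>\<^sup>+x. ennreal ((f n x - f (r k) x)\<^sup>2) \<partial>M) \<le> ennreal (e\<^sup>2)"
          using square_integrableD[OF square_integrable_diff[OF f f]]
          by (subst nn_integral_eq_integral) (auto simp: norm_L2_power2 intro!: ennreal_leI)
      qed
    qed (simp add: Liminf_const)
    finally show ?thesis .
  qed
  have "square_integrable M (\<lambda>x. f (R 1) x - g x)"
    unfolding square_integrable_def
  proof
    show "integrable M (\<lambda>x. (f (R 1) x - g x)\<^sup>2)"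
      using fatou[of 1 "R 1"] by (intro integrableI_bounded) (auto simp: le_less_trans)
  qed measurable
  from square_integrable_diff[OF f[of "R 1"] this] have g: "square_integrable M g" by simp
  have "(\<lambda>n. norm_L2 M (\<lambda>x. f n x - g x)) \<longlonglongrightarrow> 0"
  proof (rule LIMSEQ_I)
    fix e :: real assume "0 < e"
    have "norm (norm_L2 M (\<lambda>x. f n x - g x) - 0) < e" if "R (e/2) \<le> n" for n
    proof -
      have "ennreal (LINT x|M. (f n x - g x)\<^sup>2) = (\<integral>\<^sup>+x. ennreal ((f n x - g x)\<^sup>2) \<partial>M)"
        by (rule nn_integral_eq_integral[OF square_integrableD[OF square_integrable_diff[OF f g]], symmetric]) simp
      also have "\<dots> \<le> ennreal ((e/2)\<^sup>2)"
        by (rule fatou) (use that \<open>0 < e\<close> in auto)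
      finally have "(norm_L2 M (\<lambda>x. f n x - g x))\<^sup>2 \<le> (e/2)\<^sup>2"
        unfolding norm_L2_power2 by (subst (asm) ennreal_le_iff) auto
      then have "norm_L2 M (\<lambda>x. f n x - g x) \<le> e/2" by (rule power2_le_imp_le) (use \<open>0 < e\<close> in simp)
      then show ?thesis using \<open>0 < e\<close> by simp
    qed
    then show "\<exists>no. \<forall>n\<ge>no. norm (norm_L2 M (\<lambda>x. f n x - g x) - 0) < e" by blast
  qed
  with g show ?thesis by (rule that)
qed

section \<open>Averages of translates without a finite invariant measure\<close>

lemma integral_comp_measure_preserving:
  fixes h :: "'a \<Rightarrow> 'b::{banach, second_countable_topology}"
  assumes "T \<in> measurable M M" "distr M M T = M" "h \<in> borel_measurable M"
  shows "(LINT x|M. h (T x)) = (LINT x|M. h x)"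
  using integral_distr[OF assms(1) assms(3)] assms(2) by simp

lemma integrable_comp_measure_preserving:
  fixes h :: "'a \<Rightarrow> 'b::{banach, second_countable_topology}"
  assumes "T \<in> measurable M M" "distr M M T = M" "integrable M h"
  shows "integrable M (\<lambda>x. h (T x))"
  using integrable_distr[OF assms(1), of h] assms(2,3) by simp

lemma funpow_measure_preserving:
  assumes "T \<in> measurable M M" "distr M M T = M"
  shows "(T ^^ k) \<in> measurable M M" "distr M M (T ^^ k) = M"
proof -
  have "(T ^^ k) \<in> measurable M M \<and> distr M M (T ^^ k) = M"
  proof (induction k)
    case 0
    then show ?case by (simp add: id_def distr_id2)
  next
    case (Suc k)
    then have "distr M M (T \<circ> (T ^^ k)) = distr (distr M M (T ^^ k)) M T"
      using assms by (intro distr_distr[symmetric]) auto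
    then show ?case using Suc assms by (auto intro: measurable_comp simp: comp_def)
  qed
  then show "(T ^^ k) \<in> measurable M M" "distr M M (T ^^ k) = M" by auto
qed

text \<open>
  The weights are extended by zero from \<open>n\<close> on, so that two families of different lengths
  can be averaged after passing to the larger length.
\<close>

definition convex_weights :: "nat \<Rightarrow> (nat \<Rightarrow> real) \<Rightarrow> bool" where
  "convex_weights n w \<longleftrightarrow> (\<forall>k. 0 \<le> w k) \<and> (\<forall>k\<ge>n. w k = 0) \<and> (\<Sum>k<n. w k) = 1"

lemma convex_weights_extend:
  fixes c :: "nat \<Rightarrow> real"
  assumes "convex_weights n w" "n \<le> N"
  shows "(\<Sum>k<n. w k * c k) = (\<Sum>k<N. w k * c k)"
  using assms by (intro sum.mono_neutral_left) (auto simp: convex_weights_def)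

text \<open>
  The double sum is the squared norm of \<open>\<Sum>k<n. w k * (1\<^sub>B \<circ> T\<^sup>k)\<close>. These averages form a
  convex set that is mapped into itself by composition with \<open>T\<close>. If their norms stayed away
  from zero, then a norm-minimizing sequence would converge to a nonzero \<open>h\<close> with
  \<open>h \<circ> T = h\<close>, and \<open>h\<^sup>2\<close> would be, after normalization, the density of an invariant
  probability measure.
\<close>

lemma averages_of_translates_vanish:
  fixes M :: "'a measure" and e :: real
  assumes T: "T \<in> measurable M M" "distr M M T = M"
    and noinv: "\<not> (\<exists>P. prob_space P \<and> sets P = sets M \<and> absolutely_continuous M P \<and> distr P P T = P)"
    and B: "B \<in> sets M" "emeasure M B < \<infinity>" and e: "0 < e"
  obtains n w where "convex_weights n w"
    "(\<Sum>j<n. \<Sum>k<n. w j * w k * measure M {x \<in> space M. (T ^^ j) x \<in> B \<and> (T ^^ k) x \<in> B}) < e"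
proof -
  note [measurable] = T(1) B(1)
  note Tk[measurable] = funpow_measure_preserving(1)[OF T]
  define b :: "nat \<Rightarrow> 'a \<Rightarrow> real" where "b k x = indicator B ((T ^^ k) x)" for k x
  define av where "av n w x = (\<Sum>k<n. w k * b k x)" for n w x
  define H where "H = {av n w |n w. convex_weights n w}"
  have [measurable]: "b k \<in> borel_measurable M" for k unfolding b_def by measurable
  have si_b: "square_integrable M (b k)" for k
    unfolding square_integrable_def
  proof
    have "integrable M (\<lambda>x. (indicator B x)\<^sup>2 :: real)"
    proof -
      have "(indicator B x)\<^sup>2 = (indicator B x :: real)" for x by (simp add: indicator_def)
      then show ?thesis using B by (simp add: integrable_indicator_iff)
    qed
    then show "integrable M (\<lambda>x. (b k x)\<^sup>2)"
      unfolding b_def by (rule integrable_comp_measure_preserving[OF funpow_measure_preserving[OF T]])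
  qed measurable
  have si_H: "square_integrable M g" if "g \<in> H" for g
  proof -
    obtain n w where "g = av n w" using \<open>g \<in> H\<close> by (auto simp: H_def)
    then have "g = (\<lambda>x. \<Sum>k<n. w k * b k x)" by (auto simp: av_def)
    then show ?thesis by (auto intro!: square_integrable_sum square_integrable_cmult si_b)
  qed
  have mid: "(\<lambda>x. (g x + h x) / 2) \<in> H" if "g \<in> H" "h \<in> H" for g h
  proof -
    obtain n w m v where g: "g = av n w" "convex_weights n w" and h: "h = av m v" "convex_weights m v"
      using \<open>g \<in> H\<close> \<open>h \<in> H\<close> by (auto simp: H_def)
    let ?N = "max n m"
    have ext: "(\<Sum>k<n. w k * c k) = (\<Sum>k<?N. w k * c k)" "(\<Sum>k<m. v k * c k) = (\<Sum>k<?N. v k * c k)" for c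
      using convex_weights_extend[OF g(2), of ?N c] convex_weights_extend[OF h(2), of ?N c] by auto
    have "convex_weights ?N (\<lambda>k. (w k + v k) / 2)"
      using g(2) h(2) ext[of "\<lambda>_. 1"]
      by (auto simp: convex_weights_def sum.distrib simp flip: sum_divide_distrib)
    moreover have "(g x + h x) / 2 = av ?N (\<lambda>k. (w k + v k) / 2) x" for x
      unfolding g(1) h(1) av_def ext(1)[of "\<lambda>k. b k x"] ext(2)[of "\<lambda>k. b k x"]
      by (simp add: add_divide_distrib distrib_right sum.distrib sum_divide_distrib)
    ultimately show ?thesis unfolding H_def by blast
  qed
  have shift: "(\<lambda>x. g (T x)) \<in> H" if "g \<in> H" for g
  proof -
    obtain n w where g: "g = av n w" "convex_weights n w" using \<open>g \<in> H\<close> by (auto simp: H_def)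
    let ?v = "\<lambda>k. case k of 0 \<Rightarrow> 0 | Suc k \<Rightarrow> w k"
    have "convex_weights (Suc n) ?v"
      using g(2) by (auto simp: convex_weights_def sum.lessThan_Suc_shift simp del: sum.lessThan_Suc split: nat.split)
    moreover have "(\<lambda>x. g (T x)) = av (Suc n) ?v"
      by (rule ext) (simp add: g(1) av_def b_def sum.lessThan_Suc_shift funpow_swap1 del: sum.lessThan_Suc)
    ultimately show ?thesis unfolding H_def by blast
  qed
  have norm_av: "(LINT x|M. (av n w x)\<^sup>2) =
      (\<Sum>j<n. \<Sum>k<n. w j * w k * measure M {x \<in> space M. (T ^^ j) x \<in> B \<and> (T ^^ k) x \<in> B})" for n w
  proof -
    have inner: "(LINT x|M. b j x * b k x) = measure M {x \<in> space M. (T ^^ j) x \<in> B \<and> (T ^^ k) x \<in> B}" for j k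
    proof -
      have "(LINT x|M. b j x * b k x) = (LINT x|M. indicator {x \<in> space M. (T ^^ j) x \<in> B \<and> (T ^^ k) x \<in> B} x)"
        by (rule Bochner_Integration.integral_cong) (auto simp: b_def indicator_def)
      then show ?thesis by simp
    qed
    have "(LINT x|M. (av n w x)\<^sup>2) = (LINT x|M. (\<Sum>j<n. \<Sum>k<n. w j * w k * (b j x * b k x)))"
      by (simp add: av_def power2_eq_square sum_product algebra_simps)
    also have "\<dots> = (\<Sum>j<n. \<Sum>k<n. w j * w k * (LINT x|M. b j x * b k x))"
      using integrable_mult_of_squares[OF si_b si_b] by (simp add: Bochner_Integration.integral_sum)
    finally show ?thesis by (simp only: inner)
  qed
  have "\<exists>g\<in>H. (LINT x|M. (g x)\<^sup>2) < e"
  proof (rule ccontr)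
    assume "\<not> (\<exists>g\<in>H. (LINT x|M. (g x)\<^sup>2) < e)"
    then have ge_e: "e \<le> (LINT x|M. (g x)\<^sup>2)" if "g \<in> H" for g using that by force
    define d where "d = Inf ((\<lambda>g. LINT x|M. (g x)\<^sup>2) ` H)"
    have "convex_weights 1 (\<lambda>k. if k = 0 then 1 else 0)" by (auto simp: convex_weights_def)
    then have "H \<noteq> {}" by (auto simp: H_def)
    then have "e \<le> d" unfolding d_def by (intro cInf_greatest) (auto intro: ge_e)
    have bdd: "bdd_below ((\<lambda>g. LINT x|M. (g x)\<^sup>2) ` H)" by (rule bdd_belowI[of _ 0]) auto
    have d_le: "d \<le> (LINT x|M. (g x)\<^sup>2)" if "g \<in> H" for g
      unfolding d_def using that bdd by (intro cInf_lower) auto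
    have "\<exists>g\<in>H. (LINT x|M. (g x)\<^sup>2) < d + 1 / (real n + 1)" for n
    proof -
      have "\<exists>y\<in>(\<lambda>g. LINT x|M. (g x)\<^sup>2) ` H. y < d + 1 / (real n + 1)"
        using \<open>H \<noteq> {}\<close> bdd by (subst cInf_less_iff[symmetric]) (auto simp: d_def[symmetric])
      then show ?thesis by auto
    qed
    then obtain g where gH: "\<And>n. g n \<in> H" and g_le: "\<And>n. (LINT x|M. (g n x)\<^sup>2) < d + 1 / (real n + 1)"
      by metis
    note si = si_H[OF gH]
    \<comment> \<open>Parallelogram identity: elements of a convex set of nearly minimal norm are close.\<close>
    have close: "(norm_L2 M (\<lambda>x. p x - q x))\<^sup>2 \<le> 2 * (a + c)"
      if p: "p \<in> H" "(LINT x|M. (p x)\<^sup>2) \<le> d + a" and q: "q \<in> H" "(LINT x|M. (q x)\<^sup>2) \<le> d + c" for p q a c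
    proof -
      note sp = si_H[OF p(1)] and sq = si_H[OF q(1)]
      have "(norm_L2 M (\<lambda>x. p x - q x))\<^sup>2
          = (LINT x|M. (2 * (p x)\<^sup>2 + 2 * (q x)\<^sup>2) - 4 * ((p x + q x) / 2)\<^sup>2)"
        unfolding norm_L2_power2
        by (rule Bochner_Integration.integral_cong) (auto simp: power2_eq_square field_simps)
      also have "\<dots> = 2 * (LINT x|M. (p x)\<^sup>2) + 2 * (LINT x|M. (q x)\<^sup>2) - 4 * (LINT x|M. ((p x + q x) / 2)\<^sup>2)"
        using square_integrableD[OF sp] square_integrableD[OF sq] square_integrableD[OF square_integrable_add[OF sp sq]]
        by (subst Bochner_Integration.integral_diff) (auto simp: power_divide)
      finally show ?thesis using d_le[OF mid[OF p(1) q(1)]] p(2) q(2) by simp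
    qed
    have "\<exists>N. \<forall>m\<ge>N. \<forall>n\<ge>N. norm_L2 M (\<lambda>x. g m x - g n x) < r" if "0 < r" for r
    proof -
      obtain N where N: "4 / r\<^sup>2 < real N" using reals_Archimedean2 by blast
      have "norm_L2 M (\<lambda>x. g m x - g n x) < r" if "N \<le> m" "N \<le> n" for m n
      proof (rule power_less_imp_less_base)
        have small: "1 / (real k + 1) < r\<^sup>2 / 4" if "N \<le> k" for k
        proof -
          have "4 / r\<^sup>2 < real k + 1" using N that by simp
          then show ?thesis using \<open>0 < r\<close> by (simp add: field_simps)
        qed
        have "2 * (1 / (real m + 1) + 1 / (real n + 1)) < r\<^sup>2"
        proof -
          have "2 * (a + b) < c" if "a < c / 4" "b < c / 4" for a b c :: real
            using that by auto
          from this[OF small[OF that(1)] small[OF that(2)]] show ?thesis .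
        qed
        then show "(norm_L2 M (\<lambda>x. g m x - g n x))\<^sup>2 < r\<^sup>2"
          using close[OF gH less_imp_le[OF g_le] gH less_imp_le[OF g_le], of m n] by linarith
      qed (use \<open>0 < r\<close> in simp)
      then show ?thesis by blast
    qed
    from L2_complete[OF si this] obtain h
      where h: "square_integrable M h" and lim: "(\<lambda>n. norm_L2 M (\<lambda>x. g n x - h x)) \<longlonglongrightarrow> 0"
      by blast
    have [measurable]: "h \<in> borel_measurable M" "\<And>n. g n \<in> borel_measurable M"
      using h si by (auto dest: square_integrable_measurable)
    have hT: "square_integrable M (\<lambda>x. h (T x))"
      unfolding square_integrable_def
      using integrable_comp_measure_preserving[OF T square_integrableD[OF h]] by simp
    have norm_h: "(LINT x|M. (h x)\<^sup>2) = d"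
    proof (rule LIMSEQ_unique)
      show "(\<lambda>n. LINT x|M. (g n x)\<^sup>2) \<longlonglongrightarrow> (LINT x|M. (h x)\<^sup>2)"
        using tendsto_L2_inner[OF si h lim si h lim] by (simp add: power2_eq_square)
      show "(\<lambda>n. LINT x|M. (g n x)\<^sup>2) \<longlonglongrightarrow> d"
      proof (rule tendsto_sandwich[of "\<lambda>_. d" _ _ "\<lambda>n. d + 1 / (real n + 1)"])
        have "(\<lambda>n. d + 1 / real (Suc n)) \<longlonglongrightarrow> d + 0"
          by (intro tendsto_intros LIMSEQ_Suc[OF lim_1_over_n])
        then show "(\<lambda>n. d + 1 / (real n + 1)) \<longlonglongrightarrow> d" by (simp add: add.commute)
      qed (use d_le gH less_imp_le[OF g_le] in auto)
    qed
    have "norm_L2 M (\<lambda>x. h (T x) - h x) \<le> 0"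
    proof (rule tendsto_lowerbound)
      let ?u = "\<lambda>n. norm_L2 M (\<lambda>x. g n x - h x) + 2 * sqrt (1 / (real n + 1)) + norm_L2 M (\<lambda>x. g n x - h x)"
      have "(\<lambda>n. sqrt (1 / real (Suc n))) \<longlonglongrightarrow> sqrt 0"
        by (intro tendsto_intros LIMSEQ_Suc[OF lim_1_over_n])
      then have "(\<lambda>n. sqrt (1 / (real n + 1))) \<longlonglongrightarrow> 0" by (simp add: add.commute)
      from tendsto_add[OF tendsto_add[OF lim tendsto_mult_left[OF this, of 2]] lim]
      show "?u \<longlonglongrightarrow> 0" by simp
      have "norm_L2 M (\<lambda>x. h (T x) - h x) \<le> ?u n" for n
      proof -
        note gT = si_H[OF shift[OF gH]]
        have "norm_L2 M (\<lambda>x. h (T x) - g n (T x)) = norm_L2 M (\<lambda>x. g n x - h x)"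
          unfolding norm_L2_def
          by (subst integral_comp_measure_preserving[OF T, of "\<lambda>x. (h x - g n x)\<^sup>2"])
             (auto simp: power2_commute)
        moreover have "norm_L2 M (\<lambda>x. g n (T x) - g n x) \<le> 2 * sqrt (1 / (real n + 1))"
        proof (rule power2_le_imp_le)
          have "(LINT x|M. (g n (T x))\<^sup>2) = (LINT x|M. (g n x)\<^sup>2)"
            by (rule integral_comp_measure_preserving[OF T]) measurable
          then have "(norm_L2 M (\<lambda>x. g n (T x) - g n x))\<^sup>2 \<le> 2 * (1 / (real n + 1) + 1 / (real n + 1))"
            using g_le[of n] by (intro close shift gH) auto
          then show "(norm_L2 M (\<lambda>x. g n (T x) - g n x))\<^sup>2 \<le> (2 * sqrt (1 / (real n + 1)))\<^sup>2"
            by (simp add: power_mult_distrib)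
        qed simp
        ultimately show ?thesis
          using norm_L2_triangle_diff[OF hT gT[of n] h] norm_L2_triangle_diff[OF gT[of n] si[of n] h] by linarith
      qed
      then show "\<forall>\<^sub>F n in sequentially. norm_L2 M (\<lambda>x. h (T x) - h x) \<le> ?u n" by simp
    qed simp
    then have "(LINT x|M. (h (T x) - h x)\<^sup>2) = 0"
      by (auto simp: norm_L2_def intro!: antisym)
    then have inv: "AE x in M. h (T x) = h x"
      using square_integrableD[OF square_integrable_diff[OF hT h]]
      by (subst (asm) integral_nonneg_eq_0_iff_AE) auto
    define P where "P = density M (\<lambda>x. ennreal ((h x)\<^sup>2 / d))"
    have "d > 0" using \<open>e \<le> d\<close> e by simp
    have [simp]: "sets P = sets M" "space P = space M" by (auto simp: P_def)
    have "prob_space P"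
    proof (rule prob_spaceI)
      have "emeasure P (space P) = (\<integral>\<^sup>+x. ennreal ((h x)\<^sup>2 / d) \<partial>M)"
        by (auto simp: P_def emeasure_density intro!: nn_integral_cong)
      also have "\<dots> = ennreal (LINT x|M. (h x)\<^sup>2 / d)"
        using \<open>d > 0\<close> square_integrableD[OF h] by (intro nn_integral_eq_integral) auto
      finally show "emeasure P (space P) = 1" using norm_h \<open>d > 0\<close> by simp
    qed
    moreover have "absolutely_continuous M P"
      unfolding P_def by (rule absolutely_continuousI_density) measurable
    moreover have "distr P P T = P"
    proof (rule measure_eqI)
      fix A assume "A \<in> sets (distr P P T)"
      then have [measurable]: "A \<in> sets M" by simp
      have "emeasure (distr P P T) A = emeasure P (T -` A \<inter> space M)"
        by (subst emeasure_distr) (auto simp: measurable_def[of P] dest: measurable_space[OF T(1)] measurable_sets[OF T(1)])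
      also have "\<dots> = (\<integral>\<^sup>+x. ennreal ((h x)\<^sup>2 / d) * indicator A (T x) \<partial>M)"
        unfolding P_def by (subst emeasure_density) (auto intro!: nn_integral_cong simp: indicator_def)
      also have "\<dots> = (\<integral>\<^sup>+x. ennreal ((h (T x))\<^sup>2 / d) * indicator A (T x) \<partial>M)"
        by (rule nn_integral_cong_AE) (use inv in auto)
      also have "\<dots> = (\<integral>\<^sup>+x. ennreal ((h x)\<^sup>2 / d) * indicator A x \<partial>distr M M T)"
        by (subst nn_integral_distr) auto
      also have "\<dots> = emeasure P A"
        by (simp add: T(2)) (simp add: P_def emeasure_density)
      finally show "emeasure (distr P P T) A = emeasure P A" .
    qed simp
    ultimately show False using noinv by auto
  qed
  then obtain n w where "convex_weights n w" "(LINT x|M. (av n w x)\<^sup>2) < e" by (auto simp: H_def)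
  then show ?thesis using that[of n w] by (simp add: norm_av)
qed

section \<open>Void probabilities of a Poisson process\<close>

text \<open>
  A finite configuration is given by the number of its points and an infinite sequence from
  which that many initial terms are taken.
\<close>

definition void :: "'a set \<Rightarrow> nat \<times> (nat \<Rightarrow> 'a) \<Rightarrow> bool" where
  "void A p \<longleftrightarrow> (\<forall>j. j < fst p \<longrightarrow> snd p j \<notin> A)"

text \<open>
  A number \<open>K\<close> of independent points, Poisson distributed with the total mass \<open>r\<close> as mean,
  avoids \<open>A\<close> with probability \<open>E ((1 - \<rho> A / r)\<^sup>K) = exp (- \<rho> A)\<close>.
\<close>

lemma poisson_points_of_finite_measure:
  fixes \<rho> :: "'a measure"
  assumes "finite_measure \<rho>"
  shows "\<exists>E :: (nat \<times> (nat \<Rightarrow> 'a)) measure. prob_space E \<and>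
    (\<forall>A\<in>sets \<rho>. {p \<in> space E. void A p} \<in> sets E \<and>
       measure E {p \<in> space E. void A p} = exp (- measure \<rho> A))"
proof -
  interpret \<rho>: finite_measure \<rho> by fact
  define r where "r = measure \<rho> (space \<rho>)"
  show ?thesis
  proof (cases "r = 0")
    case True
    \<comment> \<open>The space may be empty here, so the candidate sequence is arbitrary and the number
      of points is 0.\<close>
    let ?E = "return (count_space UNIV) (0, \<lambda>_. undefined) :: (nat \<times> (nat \<Rightarrow> 'a)) measure"
    have "measure \<rho> A = 0" for A
      using True \<rho>.bounded_measure[of A] unfolding r_def by (simp add: antisym)
    moreover have "measure ?E {p \<in> space ?E. void A p} = 1" for A
      by (simp add: measure_return void_def)
    ultimately show ?thesis
      by (intro exI[of _ ?E]) (simp add: prob_space_return)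
  next
    case False
    then have r: "0 < r" unfolding r_def by (simp add: order_less_le)
    define P where "P = uniform_measure \<rho> (space \<rho>)"
    have em: "emeasure \<rho> (space \<rho>) = ennreal r" by (simp add: r_def \<rho>.emeasure_eq_measure)
    interpret P: prob_space P
      unfolding P_def using r by (intro prob_space_uniform_measure) (auto simp: em)
    have [simp]: "sets P = sets \<rho>" "space P = space \<rho>" by (auto simp: P_def)
    have P_A: "emeasure P A = ennreal (measure \<rho> A / r)" if "A \<in> sets \<rho>" for A
    proof -
      have "space \<rho> \<inter> A = A" using sets.sets_into_space[OF that] by auto
      then show ?thesis
        using that r by (simp add: P_def \<rho>.emeasure_eq_measure divide_ennreal r_def[symmetric])
    qed
    define S where "S = PiM UNIV (\<lambda>_::nat. P)"
    interpret S: product_prob_space "\<lambda>_::nat. P" UNIV ..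
    interpret S': prob_space S unfolding S_def by (rule prob_space_PiM) unfold_locales
    let ?K = "measure_pmf (poisson_pmf r)"
    interpret KS: pair_prob_space ?K S ..
    let ?E = "?K \<Otimes>\<^sub>M S"
    have "{p \<in> space ?E. void A p} \<in> sets ?E \<and> measure ?E {p \<in> space ?E. void A p} = exp (- measure \<rho> A)"
      if A[measurable]: "A \<in> sets \<rho>" for A
    proof
      have [measurable]: "(\<lambda>p. snd p j) \<in> measurable ?E P" for j
        unfolding S_def by measurable
      have [measurable]: "Measurable.pred ?E (\<lambda>p. snd p j \<notin> A)" for j
        by (rule measurable_compose[of "\<lambda>p. snd p j" _ P]) (auto simp: pred_def intro!: sets.sets_Collect_neg)
      have [measurable]: "Measurable.pred ?E (\<lambda>p. j < fst p)" for j
        by (rule measurable_compose[of fst _ ?K]) auto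
      have "Measurable.pred ?E (void A)" unfolding void_def by measurable
      then show m: "{p \<in> space ?E. void A p} \<in> sets ?E" by (simp add: pred_def)
      define a where "a = measure \<rho> A / r"
      have a: "0 \<le> a" "a \<le> 1"
        using r \<rho>.bounded_measure[of A] by (auto simp: a_def r_def)
      have "emeasure S (Pair k -` {p \<in> space ?E. void A p}) = ennreal ((1 - a) ^ k)" for k
      proof -
        have "Pair k -` {p \<in> space ?E. void A p} = {x \<in> space S. \<forall>j\<in>{..<k}. x j \<in> space P - A}"
          by (auto simp: space_pair_measure void_def S_def space_PiM)
        also have "emeasure S \<dots> = (\<Prod>j\<in>{..<k}. emeasure P (space P - A))"
          unfolding S_def by (rule S.emeasure_PiM_Collect) auto
        also have "emeasure P (space P - A) = ennreal (1 - a)"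
        proof -
          have "emeasure P A = ennreal a" using P_A[OF A] by (simp only: a_def)
          then have "measure P A = a" using a by (simp add: measure_def)
          then show ?thesis using P.prob_compl[of A] A by (simp only: P.emeasure_eq_measure) simp
        qed
        finally show ?thesis using a by (simp add: ennreal_power)
      qed
      then have "emeasure ?E {p \<in> space ?E. void A p} = (\<integral>\<^sup>+k. ennreal ((1 - a) ^ k) \<partial>?K)"
        using m by (subst S'.emeasure_pair_measure_alt) auto
      also have "\<dots> = (\<Sum>k. ennreal (pmf (poisson_pmf r) k) * ennreal ((1 - a) ^ k))"
        by (simp add: nn_integral_measure_pmf nn_integral_count_space_nat)
      also have "\<dots> = (\<Sum>k. ennreal (exp (- r) * ((r * (1 - a)) ^ k /\<^sub>R fact k)))"
        using r a by (intro suminf_cong) (simp add: ennreal_mult[symmetric] power_mult_distrib divide_inverse mult_ac)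
      also have "\<dots> = ennreal (exp (- r) * exp (r * (1 - a)))"
        using r a by (intro suminf_ennreal_eq sums_mult exp_converges) auto
      also have "exp (- r) * exp (r * (1 - a)) = exp (- measure \<rho> A)"
        using r by (simp add: a_def exp_add[symmetric] field_simps)
      finally show "measure ?E {p \<in> space ?E. void A p} = exp (- measure \<rho> A)"
        by (simp add: measure_def)
    qed
    moreover have "prob_space ?E" by (rule KS.prob_space_axioms)
    ultimately show ?thesis by blast
  qed
qed

text \<open>
  Independent configurations on the pieces of a partition into sets of finite measure are
  superposed. Only the information which of the sets \<open>R i\<close> are void is retained.
\<close>

lemma poisson_void_probabilities:
  fixes M :: "'a measure" and R :: "'i::countable \<Rightarrow> 'a set"
  assumes "sigma_finite_measure M"
    and R: "\<And>i. R i \<in> sets M" "\<And>i. emeasure M (R i) < \<infinity>"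
  obtains Q :: "('i \<Rightarrow> bool) measure" where "prob_space Q"
    "sets Q = sets (PiM UNIV (\<lambda>_. count_space UNIV))"
    "\<And>F. finite F \<Longrightarrow> measure Q {z. \<forall>i\<in>F. z i} = exp (- measure M (\<Union>i\<in>F. R i))"
proof -
  interpret M: sigma_finite_measure M by fact
  obtain X :: "nat \<Rightarrow> 'a set" where X: "range X \<subseteq> sets M" "\<Union> (range X) = space M"
    "\<And>n. emeasure M (X n) \<noteq> \<infinity>" "disjoint_family X"
    by (rule M.sigma_finite_disjoint) blast
  define \<rho> where "\<rho> n = density M (indicator (X n))" for n
  have [simp]: "sets (\<rho> n) = sets M" for n by (simp add: \<rho>_def)
  have \<rho>: "emeasure (\<rho> n) A = emeasure M (X n \<inter> A)" if "A \<in> sets M" for n A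
  proof -
    have "X n \<inter> A \<in> sets M" using X(1) that by auto
    have "emeasure (\<rho> n) A = (\<integral>\<^sup>+x. indicator (X n) x * indicator A x \<partial>M)"
      unfolding \<rho>_def using X(1) that by (intro emeasure_density) auto
    also have "\<dots> = (\<integral>\<^sup>+x. indicator (X n \<inter> A) x \<partial>M)"
      by (simp only: indicator_inter_arith)
    also have "\<dots> = emeasure M (X n \<inter> A)" by (rule nn_integral_indicator) fact
    finally show ?thesis .
  qed
  have fin: "finite_measure (\<rho> n)" for n
  proof
    have "emeasure (\<rho> n) (space (\<rho> n)) = emeasure M (X n \<inter> space M)"
      using \<rho>[of "space M" n] by (simp add: \<rho>_def)
    also have "\<dots> \<le> emeasure M (X n)" using X(1) by (intro emeasure_mono) auto
    finally show "emeasure (\<rho> n) (space (\<rho> n)) \<noteq> \<infinity>" using X(3)[of n] by (auto simp: top_unique)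
  qed
  have "\<exists>E. \<forall>n. prob_space (E n) \<and>
    (\<forall>A\<in>sets M. {p \<in> space (E n). void A p} \<in> sets (E n) \<and>
       measure (E n) {p \<in> space (E n). void A p} = exp (- measure M (X n \<inter> A)))"
  proof (rule choice, rule allI)
    fix n
    show "\<exists>E. prob_space E \<and> (\<forall>A\<in>sets M. {p \<in> space E. void A p} \<in> sets E \<and>
       measure E {p \<in> space E. void A p} = exp (- measure M (X n \<inter> A)))"
      using poisson_points_of_finite_measure[OF fin, of n] \<rho> by (simp add: measure_def)
  qed
  then obtain E :: "nat \<Rightarrow> (nat \<times> (nat \<Rightarrow> 'a)) measure" where E: "\<And>n. prob_space (E n)"
    and void_sets: "\<And>n A. A \<in> sets M \<Longrightarrow> {p \<in> space (E n). void A p} \<in> sets (E n)"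
    and void_prob: "\<And>n A. A \<in> sets M \<Longrightarrow>
       measure (E n) {p \<in> space (E n). void A p} = exp (- measure M (X n \<inter> A))"
    by blast
  define W where "W = PiM UNIV E"
  interpret E: prob_space "E n" for n by (rule E)
  interpret W: product_prob_space E UNIV ..
  interpret W': prob_space W unfolding W_def by (rule prob_space_PiM) (rule E)
  have pred_void[measurable]: "Measurable.pred W (\<lambda>\<omega>. void A (\<omega> n))" if "A \<in> sets M" for A n
    by (rule measurable_compose[of "\<lambda>\<omega>. \<omega> n" W "E n"])
       (use void_sets[OF that] in \<open>auto simp: W_def pred_def\<close>)
  define Z where "Z \<omega> i = (\<forall>n. void (R i) (\<omega> n))" for \<omega> :: "nat \<Rightarrow> nat \<times> (nat \<Rightarrow> 'a)" and i
  have Z[measurable]: "Z \<in> measurable W (PiM UNIV (\<lambda>_. count_space UNIV))"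
    unfolding Z_def using R(1) by (intro measurable_PiM_single') auto
  define Q where "Q = distr W (PiM UNIV (\<lambda>_. count_space UNIV)) Z"
  show thesis
  proof
    show "prob_space Q" unfolding Q_def by (rule W'.prob_space_distr) (rule Z)
    show "sets Q = sets (PiM UNIV (\<lambda>_. count_space UNIV))" by (simp add: Q_def)
    fix F :: "'i set" assume F: "finite F"
    let ?A = "\<Union>i\<in>F. R i"
    have A: "?A \<in> sets M" using R(1) F by auto
    have fA: "emeasure M ?A \<noteq> \<infinity>"
    proof -
      have "?A \<in> fmeasurable M"
        using F R by (intro fmeasurable.finite_UN) (auto intro: fmeasurableI)
      then show ?thesis by (simp add: fmeasurable_def less_top)
    qed
    have "{z. \<forall>i\<in>F. z i} = {z \<in> space (PiM UNIV (\<lambda>_. count_space UNIV)). \<forall>i\<in>F. z i}"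
      by (auto simp: space_PiM)
    also have "\<dots> \<in> sets (PiM UNIV (\<lambda>_. count_space UNIV))"
      using F by (intro sets.sets_Collect_finite_All) auto
    finally have mF: "{z. \<forall>i\<in>F. z i} \<in> sets (PiM UNIV (\<lambda>_::'i. count_space (UNIV::bool set)))" .
    have "measure Q {z. \<forall>i\<in>F. z i} = measure W (Z -` {z. \<forall>i\<in>F. z i} \<inter> space W)"
      unfolding Q_def by (rule measure_distr[OF Z mF])
    also have "Z -` {z. \<forall>i\<in>F. z i} \<inter> space W = (\<Inter>N. {\<omega> \<in> space W. \<forall>n\<in>{..<N}. void ?A (\<omega> n)})"
      by (auto simp: Z_def void_def)
    finally have eq: "measure Q {z. \<forall>i\<in>F. z i} = measure W (\<Inter>N. {\<omega> \<in> space W. \<forall>n\<in>{..<N}. void ?A (\<omega> n)})" .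
    have "(\<lambda>N. measure W {\<omega> \<in> space W. \<forall>n\<in>{..<N}. void ?A (\<omega> n)}) \<longlonglongrightarrow> measure Q {z. \<forall>i\<in>F. z i}"
      unfolding eq using A
      by (intro W'.finite_Lim_measure_decseq) (auto simp: decseq_def)
    moreover have "measure W {\<omega> \<in> space W. \<forall>n\<in>{..<N}. void ?A (\<omega> n)} = exp (- (\<Sum>n<N. measure M (X n \<inter> ?A)))" for N
    proof -
      have "{\<omega> \<in> space W. \<forall>n\<in>{..<N}. void ?A (\<omega> n)}
        = {\<omega> \<in> space (PiM UNIV E). \<forall>n\<in>{..<N}. \<omega> n \<in> {p \<in> space (E n). void ?A p}}"
        by (auto simp: W_def space_PiM)
      then have "measure W {\<omega> \<in> space W. \<forall>n\<in>{..<N}. void ?A (\<omega> n)}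
        = (\<Prod>n<N. measure (E n) {p \<in> space (E n). void ?A p})"
        unfolding W_def using void_sets[OF A]
        by (simp only: measure_def) (subst W.emeasure_PiM_Collect, auto simp: E.emeasure_eq_measure prod_ennreal prod_nonneg)
      then show ?thesis by (simp add: void_prob[OF A] exp_sum sum_negf[symmetric])
    qed
    moreover have "(\<lambda>N. exp (- (\<Sum>n<N. measure M (X n \<inter> ?A)))) \<longlonglongrightarrow> exp (- measure M ?A)"
    proof -
      have "(\<Union>n. X n \<inter> ?A) = ?A" using X(2) sets.sets_into_space[OF A] by auto
      moreover have "(\<lambda>n. measure M (X n \<inter> ?A)) sums measure M (\<Union>n. X n \<inter> ?A)"
      proof (rule measure_UNION)
        show "range (\<lambda>n. X n \<inter> ?A) \<subseteq> sets M" using X(1) A by blast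
        show "disjoint_family (\<lambda>n. X n \<inter> ?A)" using X(4) unfolding disjoint_family_on_def by blast
        show "emeasure M (\<Union>n. X n \<inter> ?A) \<noteq> \<infinity>" using fA calculation by simp
      qed
      ultimately show ?thesis unfolding sums_def by (intro tendsto_intros) simp
    qed
    ultimately show "measure Q {z. \<forall>i\<in>F. z i} = exp (- measure M ?A)"
      by (auto intro: LIMSEQ_unique)
  qed
qed

section \<open>Borel models on the line\<close>

abbreviation binary_space :: "('i \<Rightarrow> bool) measure" where
  "binary_space \<equiv> PiM UNIV (\<lambda>_. count_space UNIV)"

text \<open>
  Base 4 with the digits 0 and 1: the tails of the series are at most \<open>1/3\<close>, so that no
  carry occurs and rounding down recovers the digits.
\<close>

definition encode :: "('i::countable \<Rightarrow> bool) \<Rightarrow> real" where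
  "encode z = (\<Sum>n. of_bool (z (from_nat n)) / 4 ^ Suc n)"

definition decode :: "real \<Rightarrow> 'i::countable \<Rightarrow> bool" where
  "decode x i = odd \<lfloor>4 ^ Suc (to_nat i) * x\<rfloor>"

lemma decode_encode [simp]: "decode (encode z) = z"
proof
  fix i :: "'a"
  let ?c = "\<lambda>n. of_bool (z (from_nat n)) :: real"
  define N where "N = to_nat i"
  have sum_c: "summable (\<lambda>n. ?c n / 4 ^ Suc n)"
  proof (rule summable_comparison_test'[where N=0])
    show "summable (\<lambda>n. (1/4::real) ^ Suc n)" by (subst summable_Suc_iff) (simp add: summable_geometric)
  qed (simp add: power_divide)
  define t where "t = (\<Sum>m. ?c (m + Suc N) / 4 ^ Suc m)"
  have sum_t: "summable (\<lambda>m. ?c (m + Suc N) / 4 ^ Suc m)"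
  proof (rule summable_comparison_test'[where N=0])
    show "summable (\<lambda>n. (1/4::real) ^ Suc n)" by (subst summable_Suc_iff) (simp add: summable_geometric)
  qed (simp add: power_divide)
  note tail = summable_ignore_initial_segment[OF sum_c, of "Suc N"]
  have split: "encode z = (\<Sum>m. ?c (m + Suc N) / 4 ^ Suc (m + Suc N)) + (\<Sum>n<Suc N. ?c n / 4 ^ Suc n)"
    unfolding encode_def by (rule suminf_split_initial_segment[OF sum_c])
  have "4 ^ Suc N * encode z = 4 ^ Suc N * (\<Sum>m. ?c (m + Suc N) / 4 ^ Suc (m + Suc N))
      + 4 ^ Suc N * (\<Sum>n<Suc N. ?c n / 4 ^ Suc n)"
    unfolding split by (rule distrib_left)
  also have "4 ^ Suc N * (\<Sum>m. ?c (m + Suc N) / 4 ^ Suc (m + Suc N))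
      = (\<Sum>m. 4 ^ Suc N * (?c (m + Suc N) / 4 ^ Suc (m + Suc N)))"
    by (rule suminf_mult[OF tail, symmetric])
  also have "(\<Sum>m. 4 ^ Suc N * (?c (m + Suc N) / 4 ^ Suc (m + Suc N))) = t"
    unfolding t_def by (intro suminf_cong) (simp add: power_add)
  also have "4 ^ Suc N * (\<Sum>n<Suc N. ?c n / 4 ^ Suc n) = (\<Sum>n<Suc N. ?c n * 4 ^ (N - n))"
    unfolding sum_distrib_left
    by (intro sum.cong) (auto simp: power_diff field_simps)
  also have "\<dots> = of_int (\<Sum>n<Suc N. of_bool (z (from_nat n)) * 4 ^ (N - n))"
    by (simp only: of_int_sum of_int_mult of_int_power of_int_numeral of_int_of_bool)
  finally have eq: "4 ^ Suc N * encode z = t + of_int (\<Sum>n<Suc N. of_bool (z (from_nat n)) * 4 ^ (N - n))" .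
  have "0 \<le> t" unfolding t_def by (intro suminf_nonneg sum_t) auto
  moreover have "t \<le> (\<Sum>m. (1/4) ^ Suc m)"
    unfolding t_def
  proof (intro suminf_le sum_t)
    show "summable (\<lambda>n. (1/4::real) ^ Suc n)" by (subst summable_Suc_iff) (simp add: summable_geometric)
  qed (simp add: power_divide)
  moreover have "(\<Sum>m. (1/4::real) ^ Suc m) = 1 / 3"
    using sums_mult[OF geometric_sums[of "1/4 :: real"], of "1/4"] by (simp add: sums_iff)
  ultimately have "\<lfloor>4 ^ Suc N * encode z\<rfloor> = (\<Sum>n<Suc N. of_bool (z (from_nat n)) * 4 ^ (N - n))"
    unfolding eq by (intro floor_unique) auto
  also have "\<dots> = of_bool (z i) + (\<Sum>n<N. of_bool (z (from_nat n)) * 4 ^ (N - n))"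
    by (simp add: N_def)
  also have "odd \<dots> = z i"
  proof -
    have "even (\<Sum>n<N. of_bool (z (from_nat n)) * (4::int) ^ (N - n))"
      by (intro dvd_sum) auto
    then show ?thesis by simp
  qed
  finally show "decode (encode z) i = z i" by (simp add: decode_def N_def)
qed

lemma measurable_encode [measurable]: "encode \<in> borel_measurable binary_space"
proof -
  have [measurable]: "Measurable.pred binary_space (\<lambda>z. z (from_nat n))" for n by measurable
  show ?thesis unfolding encode_def[abs_def] by measurable
qed

lemma measurable_decode [measurable]: "decode \<in> measurable borel binary_space"
proof (rule measurable_PiM_single')
  fix i :: 'a
  have "(\<lambda>x::real. odd \<lfloor>4 ^ Suc (to_nat i) * x\<rfloor>) \<in> measurable borel (count_space UNIV)"
    by (rule measurable_compose[of "\<lambda>x::real. \<lfloor>4 ^ Suc (to_nat i) * x\<rfloor>" _ "count_space UNIV"]) auto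
  then show "(\<lambda>x. decode x i) \<in> measurable borel (count_space UNIV)"
    by (simp add: decode_def)
qed simp

text \<open>
  Real numbers that code no sequence are fixed, so a bijection of sequences becomes a
  bijection of the whole line.
\<close>

definition on_reals :: "(('i::countable \<Rightarrow> bool) \<Rightarrow> ('i \<Rightarrow> bool)) \<Rightarrow> real \<Rightarrow> real" where
  "on_reals S x = (if encode (decode x :: 'i \<Rightarrow> bool) = x then encode (S (decode x)) else x)"

lemma on_reals_encode [simp]: "on_reals S (encode z) = encode (S z)"
  by (simp add: on_reals_def)

lemma on_reals_inverse:
  assumes "\<And>z. S (S' z) = z"
  shows "on_reals S (on_reals S' x) = x"
  by (cases "encode (decode x :: 'a \<Rightarrow> bool) = x") (auto simp: on_reals_def assms)

lemma measurable_on_reals: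
  fixes S :: "('i::countable \<Rightarrow> bool) \<Rightarrow> ('i \<Rightarrow> bool)"
  assumes [measurable]: "S \<in> measurable binary_space binary_space"
  shows "on_reals S \<in> borel_measurable borel"
  unfolding on_reals_def[abs_def] by measurable

lemma funpow_on_reals: "(on_reals S ^^ n) (encode z) = encode ((S ^^ n) z)"
  by (induction n) auto

lemma isomorphic_mod_0_refl: "isomorphic_mod_0 M M"
proof -
  have "measure_isomorphism id N N" for N :: "'a measure"
  proof -
    have "inv_into (space N) id \<in> measurable N N \<longleftrightarrow> id \<in> measurable N N"
      by (rule measurable_cong) (metis f_inv_into_f id_apply image_id)
    then show ?thesis
      by (simp add: measure_isomorphism_def id_def distr_id2 bij_betw_id[unfolded id_def])
  qed
  then show ?thesis unfolding isomorphic_mod_0_def by blast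
qed

definition real_model :: "('i::countable \<Rightarrow> bool) measure \<Rightarrow> real measure" where
  "real_model Q = completion (distr Q borel encode)"

context
  fixes Q :: "('i::countable \<Rightarrow> bool) measure" and S S' :: "('i \<Rightarrow> bool) \<Rightarrow> ('i \<Rightarrow> bool)"
  assumes Q: "prob_space Q" "sets Q = sets binary_space"
    and S: "S \<in> measurable Q Q" "S' \<in> measurable Q Q" "\<And>z. S (S' z) = z" "\<And>z. S' (S z) = z"
      "distr Q Q S = Q"
begin

lemma measurable_binary_Q: "measurable Q K = measurable binary_space K"
    "measurable K' Q = measurable K' binary_space"
  by (auto simp: Q(2) cong: measurable_cong_sets)

lemma encode_Q [measurable]: "encode \<in> borel_measurable Q"
  by (simp add: measurable_binary_Q(1) measurable_encode)

lemma space_Q [simp]: "space Q = UNIV"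
  using sets_eq_imp_space_eq[OF Q(2)] by (simp add: space_PiM)

lemma space_real_model [simp]: "space (real_model Q) = UNIV"
  by (simp add: real_model_def)

lemma on_reals_borel [measurable]:
  "on_reals S \<in> borel_measurable borel" "on_reals S' \<in> borel_measurable borel"
  using S(1,2) by (auto simp: measurable_binary_Q intro!: measurable_on_reals)

lemma prob_space_real_model: "prob_space (real_model Q)"
proof -
  interpret Q: prob_space Q by fact
  interpret N: prob_space "distr Q borel encode" by (rule Q.prob_space_distr) measurable
  show ?thesis unfolding real_model_def by (rule N.prob_space_completion)
qed

lemma integral_real_model:
  fixes h :: "real \<Rightarrow> 'b::{banach, second_countable_topology}"
  assumes [measurable]: "h \<in> borel_measurable borel"
  shows "(LINT x|real_model Q. h x) = (LINT z|Q. h (encode z))"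
    and "integrable (real_model Q) h \<longleftrightarrow> integrable Q (\<lambda>z. h (encode z))"
  unfolding real_model_def
  by (simp_all add: integral_completion integral_distr integrable_completion integrable_distr_eq)

lemma measurable_real_model:
  "h \<in> measurable borel K \<Longrightarrow> h \<in> measurable (real_model Q) K"
  unfolding real_model_def by (intro measurable_completion) simp

lemma preserving_real_model:
  assumes U[measurable]: "U \<in> measurable Q Q" and dU: "distr Q Q U = Q"
  shows "on_reals U \<in> measurable (real_model Q) (real_model Q)"
    and "distr (real_model Q) (real_model Q) (on_reals U) = real_model Q"
proof -
  let ?N = "distr Q borel encode"
  have m[measurable]: "on_reals U \<in> borel_measurable borel"
    using U by (auto simp: measurable_binary_Q intro!: measurable_on_reals)
  have "distr ?N borel (on_reals U) = distr Q borel (on_reals U \<circ> encode)"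
    by (rule distr_distr) measurable
  also have "on_reals U \<circ> encode = encode \<circ> U" by auto
  also have "distr Q borel (encode \<circ> U) = distr (distr Q Q U) borel encode"
    by (rule distr_distr[symmetric]) measurable
  finally have d: "distr ?N borel (on_reals U) = ?N" by (simp add: dU)
  have "distr (completion ?N) ?N (on_reals U) = distr ?N ?N (on_reals U)"
    by (rule distr_completion) simp
  also have "\<dots> = distr ?N borel (on_reals U)" by (rule distr_cong) auto
  finally have dc: "distr (completion ?N) ?N (on_reals U) = ?N" using d by simp
  have mc: "on_reals U \<in> measurable (completion ?N) ?N"
    by (intro measurable_completion) simp
  show "on_reals U \<in> measurable (real_model Q) (real_model Q)"
    unfolding real_model_def by (rule completion.measurable_completion2[OF mc]) (simp add: dc)
  show "distr (real_model Q) (real_model Q) (on_reals U) = real_model Q"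
    using completion.completion_distr_eq[OF mc] unfolding real_model_def by (simp add: dc)
qed

lemma inverse_preserving: "distr Q Q S' = Q"
proof -
  have "distr Q Q S' = distr (distr Q Q S) Q S'" by (simp add: S(5))
  also have "\<dots> = distr Q Q (S' \<circ> S)" by (rule distr_distr[OF S(2) S(1)])
  also have "S' \<circ> S = (\<lambda>z. z)" using S(4) by auto
  finally show ?thesis by (simp add: distr_id2)
qed

lemma bij_on_reals: "bij (on_reals S)"
  using on_reals_inverse[of S S', OF S(3)] on_reals_inverse[of S' S, OF S(4)] by (intro o_bij[of "on_reals S'"]) auto

lemma inv_on_reals: "inv (on_reals S) = on_reals S'"
  using on_reals_inverse[of S S', OF S(3)] on_reals_inverse[of S' S, OF S(4)] by (intro inv_unique_comp) auto

lemma dynamical_system_real_model: "dynamical_system (real_model Q) (on_reals S)"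
proof -
  interpret Q: prob_space Q by fact
  let ?N = "distr Q borel encode"
  interpret N: prob_space ?N by (rule Q.prob_space_distr) measurable
  have "lebesgue_space (real_model Q)"
    unfolding lebesgue_space_def
  proof (intro conjI exI[of _ ?N])
    show "complete_measure (real_model Q)" unfolding real_model_def by (rule completion.complete_measure_axioms)
    show "sigma_finite_measure ?N" by unfold_locales
    show "isomorphic_mod_0 (real_model Q) (completion ?N)"
      unfolding real_model_def by (rule isomorphic_mod_0_refl)
  qed simp
  then show ?thesis
    unfolding dynamical_system_def measure_isomorphism_def
    using preserving_real_model[OF S(1,5)] preserving_real_model(1)[OF S(2) inverse_preserving] bij_on_reals
    by (simp add: inv_on_reals)
qed

lemma int_iterate_encode:
  "int_iterate (real_model Q) (on_reals S) k (encode z)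
    = encode ((if k \<ge> 0 then S ^^ nat k else S' ^^ nat (- k)) z)"
  by (simp add: int_iterate_def inv_on_reals funpow_on_reals)

lemma int_iterate_borel [measurable]:
  "int_iterate (real_model Q) (on_reals S) k \<in> borel_measurable borel"
proof -
  have "(U ^^ n) \<in> borel_measurable borel" if "U \<in> borel_measurable borel" for U :: "real \<Rightarrow> real" and n
    using that by (induction n) (auto intro: measurable_comp simp: id_def)
  then show ?thesis by (simp add: int_iterate_def inv_on_reals)
qed

text \<open>
  The condition speaks of strictly invariant sets of the completed sequence space, since
  the inverse image under \<open>encode\<close> of a measurable set of the completed line is of this
  kind.
\<close>

lemma ergodic_real_model:
  assumes "\<And>E. E \<in> sets (completion Q) \<Longrightarrow> S -` E = E \<Longrightarrow>
      emeasure (completion Q) E = 0 \<or> emeasure (completion Q) E = 1"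
  shows "ergodic_probability_system (real_model Q) (on_reals S)"
  unfolding ergodic_probability_system_def
proof (intro conjI ballI impI)
  show "dynamical_system (real_model Q) (on_reals S)" by (rule dynamical_system_real_model)
  show "prob_space (real_model Q)" by (rule prob_space_real_model)
  fix A assume A: "A \<in> sets (real_model Q)" and "on_reals S -` A \<inter> space (real_model Q) = A"
  then have inv: "on_reals S -` A = A" by simp
  let ?N = "distr Q borel encode"
  have mc: "encode \<in> measurable (completion Q) ?N"
    by (intro measurable_completion) simp
  have dc: "distr (completion Q) ?N encode = ?N"
    using distr_completion[of encode Q ?N] by (simp cong: distr_cong)
  have m: "encode \<in> measurable (completion Q) (real_model Q)"
    unfolding real_model_def by (rule completion.measurable_completion2[OF mc]) (simp add: dc)
  have "distr (completion Q) (real_model Q) encode = real_model Q"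
    using completion.completion_distr_eq[OF mc] unfolding real_model_def by (simp add: dc)
  then have "emeasure (real_model Q) A = emeasure (completion Q) (encode -` A)"
    using emeasure_distr[OF m A] by simp
  moreover have "encode -` A \<in> sets (completion Q)" using measurable_sets[OF m A] by simp
  moreover have "S -` (encode -` A) = encode -` A"
    using inv on_reals_encode[of S] by (metis (no_types, lifting) vimage_eq set_eqI)
  ultimately show "emeasure (real_model Q) A = 0 \<or> emeasure (real_model Q) A = 1"
    using assms by auto
qed

end

section \<open>The shift on void indicators\<close>

text \<open>
  A single coordinate is false on the complement of a cylinder. This is why the
  probabilities of the cylinders alone, which are the void probabilities, determine a law
  (\<open>binary_measure_eqI\<close>).
\<close>

lemma sets_binary_space_generator:
  "sets (binary_space :: ('i \<Rightarrow> bool) measure) = sigma_sets UNIV {{z. \<forall>i\<in>F. z i} |F. finite F}"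
    (is "sets ?B = sigma_sets UNIV ?G")
proof
  show "sets ?B \<subseteq> sigma_sets UNIV ?G"
  proof -
    have "{f. f i \<in> A} \<in> sigma_sets UNIV ?G" for i and A :: "bool set"
    proof -
      have T: "{z. z i} \<in> sigma_sets UNIV ?G"
        by (rule sigma_sets.Basic) (auto intro!: exI[of _ "{i}"])
      have F: "{z. \<not> z i} \<in> sigma_sets UNIV ?G"
        using sigma_sets.Compl[OF T] by (simp add: Collect_neg_eq Compl_eq_Diff_UNIV)
      have "UNIV \<in> sigma_sets UNIV ?G" by (rule sigma_sets_top)
      moreover have "A = {} \<or> A = {True} \<or> A = {False} \<or> A = UNIV"
        using Pow_UNIV[where 'a=bool] by (auto simp: UNIV_bool)
      ultimately show ?thesis using T F sigma_sets.Empty[of UNIV ?G] by auto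
    qed
    moreover have "sets ?B = sigma_sets UNIV {{f. f i \<in> A} |i A. True}"
      by (simp add: sets_PiM_single)
    ultimately show ?thesis by (simp only:) (rule sigma_sets_mono, clarify)
  qed
  have "{z. \<forall>i\<in>F. z i} \<in> sets ?B" if "finite F" for F :: "'i set"
  proof -
    have "{z \<in> space ?B. \<forall>i\<in>F. z i} \<in> sets ?B"
      using that by (intro sets.sets_Collect_finite_All) auto
    then show ?thesis by (simp add: space_PiM)
  qed
  then show "sigma_sets UNIV ?G \<subseteq> sets ?B"
    using sets.sigma_sets_subset[of ?G ?B] by (auto simp: space_PiM)
qed

lemma binary_generator_Int_stable: "Int_stable {{z. \<forall>i\<in>F. z i} |F::'i set. finite F}"
proof (rule Int_stableI)
  fix a b :: "('i \<Rightarrow> bool) set"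
  assume "a \<in> {{z. \<forall>i\<in>F. z i} |F. finite F}" "b \<in> {{z. \<forall>i\<in>F. z i} |F. finite F}"
  then obtain F G where "a = {z. \<forall>i\<in>F. z i}" "b = {z. \<forall>i\<in>G. z i}" "finite F" "finite G" by auto
  then have "a \<inter> b = {z. \<forall>i\<in>F \<union> G. z i}" "finite (F \<union> G)" by auto
  then show "a \<inter> b \<in> {{z. \<forall>i\<in>F. z i} |F. finite F}" by blast
qed

lemma binary_measure_eqI:
  fixes P Q :: "('i \<Rightarrow> bool) measure"
  assumes "prob_space P" "prob_space Q" "sets P = sets binary_space" "sets Q = sets binary_space"
    and eq: "\<And>F. finite F \<Longrightarrow> measure P {z. \<forall>i\<in>F. z i} = measure Q {z. \<forall>i\<in>F. z i}"
  shows "P = Q"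
proof (rule measure_eqI_generator_eq)
  interpret P: prob_space P by fact
  interpret Q: prob_space Q by fact
  show "Int_stable {{z. \<forall>i\<in>F. z i} |F::'i set. finite F}" by (rule binary_generator_Int_stable)
  show "sets P = sigma_sets UNIV {{z. \<forall>i\<in>F. z i} |F. finite F}"
    "sets Q = sigma_sets UNIV {{z. \<forall>i\<in>F. z i} |F. finite F}"
    using assms by (simp_all add: sets_binary_space_generator)
  show "emeasure P X = emeasure Q X" if "X \<in> {{z. \<forall>i\<in>F. z i} |F. finite F}" for X
    using that eq by (auto simp: P.emeasure_eq_measure Q.emeasure_eq_measure)
  show "range (\<lambda>_::nat. UNIV) \<subseteq> {{z. \<forall>i\<in>F. z i} |F::'i set. finite F}"
    by (auto intro!: exI[of _ "{}"])
  show "emeasure P UNIV \<noteq> \<infinity>" by simp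
qed auto

definition shift :: "int \<Rightarrow> (int \<times> 'b \<Rightarrow> bool) \<Rightarrow> (int \<times> 'b \<Rightarrow> bool)" where
  "shift k z = (\<lambda>i. z (fst i + k, snd i))"

lemma shift_shift [simp]: "shift k (shift l z) = shift (k + l) z"
  by (simp add: shift_def add_ac)

lemma shift_0 [simp]: "shift 0 z = z"
  by (simp add: shift_def)

lemma funpow_shift: "shift k ^^ n = shift (int n * k)"
  by (induction n) (auto simp: algebra_simps)

lemma measurable_shift: "shift k \<in> measurable binary_space binary_space"
  unfolding shift_def[abs_def] by (intro measurable_PiM_single') auto

text \<open>
  The index \<open>(k, b)\<close> stands for the translate of a basic set with label \<open>b\<close> by the \<open>k\<close>-th
  power of the transformation, and \<open>z (k, b)\<close> says that this translate contains no point.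
  The transformation enters through the invariance of the measures of unions.
\<close>

locale poisson_shift = prob_space Q
  for Q :: "(int \<times> 'b::countable \<Rightarrow> bool) measure" +
  fixes \<mu> :: "'x measure" and R :: "int \<times> 'b \<Rightarrow> 'x set"
  assumes sets_Q: "sets Q = sets binary_space"
    and R_fmeasurable: "\<And>i. R i \<in> fmeasurable \<mu>"
    and void_prob: "\<And>F. finite F \<Longrightarrow> prob {z. \<forall>i\<in>F. z i} = exp (- measure \<mu> (\<Union>i\<in>F. R i))"
    and shift_invariant: "\<And>F k. finite F \<Longrightarrow>
      measure \<mu> (\<Union>i\<in>F. R (fst i + k, snd i)) = measure \<mu> (\<Union>i\<in>F. R i)"
begin

lemma space_Q [simp]: "space Q = UNIV"
  using sets_eq_imp_space_eq[OF sets_Q] by (simp add: space_PiM)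

lemma prob_UNIV [simp]: "prob UNIV = 1"
  using prob_space by simp

lemma shift_Q [measurable]: "shift k \<in> measurable Q Q"
  using measurable_shift by (simp cong: measurable_cong_sets add: sets_Q)

lemma cylinder_sets: "finite F \<Longrightarrow> {z. \<forall>i\<in>F. z i} \<in> sets Q"
  unfolding sets_Q sets_binary_space_generator by (rule sigma_sets.Basic) auto

lemma coordinate_measurable [measurable]: "Measurable.pred Q (\<lambda>z. z i)"
  using cylinder_sets[of "{i}"] by (simp add: pred_def)

lemma shift_preimage: "shift k -` {z. \<forall>i\<in>F. z i} = {z. \<forall>i\<in>(\<lambda>i. (fst i + k, snd i)) ` F. z i}"
  by (auto simp: shift_def)

lemma shift_preserves: "distr Q Q (shift k) = Q"
proof (rule binary_measure_eqI)
  show "prob_space (distr Q Q (shift k))" by (rule prob_space_distr) measurable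
  show "prob_space Q" by (rule prob_space_axioms)
  fix F :: "(int \<times> 'b) set" assume F: "finite F"
  have "measure (distr Q Q (shift k)) {z. \<forall>i\<in>F. z i} = prob {z. \<forall>i\<in>(\<lambda>i. (fst i + k, snd i)) ` F. z i}"
  proof -
    have "measure (distr Q Q (shift k)) {z. \<forall>i\<in>F. z i} = prob (shift k -` {z. \<forall>i\<in>F. z i} \<inter> space Q)"
      using F by (intro measure_distr shift_Q cylinder_sets)
    then show ?thesis by (simp only: shift_preimage space_Q Int_UNIV_right)
  qed
  also have "\<dots> = prob {z. \<forall>i\<in>F. z i}"
  proof -
    have "prob {z. \<forall>i\<in>(\<lambda>i. (fst i + k, snd i)) ` F. z i}
        = exp (- measure \<mu> (\<Union>i\<in>(\<lambda>i. (fst i + k, snd i)) ` F. R i))"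
      by (rule void_prob) (simp add: F)
    also have "(\<Union>i\<in>(\<lambda>i. (fst i + k, snd i)) ` F. R i) = (\<Union>i\<in>F. R (fst i + k, snd i))"
      by (rule UN_simps(10))
    finally show ?thesis by (simp only: void_prob[OF F] shift_invariant[OF F])
  qed
  finally show "measure (distr Q Q (shift k)) {z. \<forall>i\<in>F. z i} = prob {z. \<forall>i\<in>F. z i}" .
qed (auto simp: sets_Q)

lemma expectation_void:
  assumes "finite F"
  shows "expectation (\<lambda>z. of_bool (\<forall>i\<in>F. z i)) = exp (- measure \<mu> (\<Union>i\<in>F. R i))"
proof -
  have "expectation (\<lambda>z. of_bool (\<forall>i\<in>F. z i)) = expectation (indicator {z. \<forall>i\<in>F. z i})"
    by (rule Bochner_Integration.integral_cong) (auto simp: indicator_def)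
  also have "\<dots> = prob {z. \<forall>i\<in>F. z i}" by simp
  finally show ?thesis by (simp only: void_prob[OF assms])
qed

text \<open>
  The factor \<open>exp (\<mu> (R i))\<close> is the inverse of the void probability and makes the mean
  vanish.
\<close>

definition deviation :: "int \<times> 'b \<Rightarrow> (int \<times> 'b \<Rightarrow> bool) \<Rightarrow> real" where
  "deviation i z = 1 - exp (measure \<mu> (R i)) * of_bool (z i)"

lemma deviation_measurable [measurable]: "deviation i \<in> borel_measurable Q"
  unfolding deviation_def[abs_def] by measurable

lemma measure_R_shift: "measure \<mu> (R (fst i + k, snd i)) = measure \<mu> (R i)"
  using shift_invariant[of "{i}" k] by simp

lemma deviation_shift: "deviation i (shift k z) = deviation (fst i + k, snd i) z"
  by (simp add: deviation_def shift_def measure_R_shift)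

lemma square_integrable_deviation: "square_integrable Q (deviation i)"
  by (rule square_integrable_bounded_prob[where c="1 + exp (measure \<mu> (R i))"])
     (auto simp: deviation_def intro: finite_measure_axioms deviation_measurable)

lemma integrable_void: "finite F \<Longrightarrow> integrable Q (\<lambda>z. of_bool (\<forall>i\<in>F. z i) :: real)"
  by (rule integrable_const_bound[where B=1]) auto

lemma expectation_deviation: "expectation (deviation i) = 0"
proof -
  have "integrable Q (\<lambda>z. of_bool (z i) :: real)" "expectation (\<lambda>z. of_bool (z i)) = exp (- measure \<mu> (R i))"
    using integrable_void[of "{i}"] expectation_void[of "{i}"] by auto
  then show ?thesis by (simp add: deviation_def[abs_def] prob_space exp_minus)
qed

text \<open>
  The constant terms cancel because \<open>\<mu> (R i) + \<mu> (R j) - \<mu> (R i \<union> R j)\<close> is the measure of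
  the intersection.
\<close>

lemma expectation_deviation_product: "expectation (\<lambda>z. deviation i z * deviation j z) = exp (measure \<mu> (R i \<inter> R j)) - 1"
proof -
  let ?m = "\<lambda>i. measure \<mu> (R i)"
  have 1: "integrable Q (\<lambda>z. of_bool (z i) :: real)" "expectation (\<lambda>z. of_bool (z i)) = exp (- ?m i)" for i
    using integrable_void[of "{i}"] expectation_void[of "{i}"] by auto
  have 2: "integrable Q (\<lambda>z. of_bool (z i \<and> z j) :: real)"
      "expectation (\<lambda>z. of_bool (z i \<and> z j)) = exp (- measure \<mu> (R i \<union> R j))"
    using integrable_void[of "{i,j}"] expectation_void[of "{i,j}"] by auto
  have "expectation (\<lambda>z. deviation i z * deviation j z) = expectation (\<lambda>z. ((1 - exp (?m i) * of_bool (z i))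
     - exp (?m j) * of_bool (z j)) + (exp (?m i) * exp (?m j)) * of_bool (z i \<and> z j))"
    by (rule Bochner_Integration.integral_cong) (auto simp: deviation_def algebra_simps)
  also have "\<dots> = 1 - exp (?m i) * exp (- ?m i) - exp (?m j) * exp (- ?m j)
      + (exp (?m i) * exp (?m j)) * exp (- measure \<mu> (R i \<union> R j))"
    using 1 2 by (simp add: prob_space)
  also have "\<dots> = exp (?m i + ?m j - measure \<mu> (R i \<union> R j)) - 1"
    by (simp add: exp_minus exp_add exp_diff field_simps)
  also have "?m i + ?m j - measure \<mu> (R i \<union> R j) = measure \<mu> (R i \<inter> R j)"
    using measure_Un3[OF R_fmeasurable R_fmeasurable, of i j] by simp
  finally show ?thesis .
qed

lemma expectation_deviation_product_approx:
  assumes le: "measure \<mu> (R i) \<le> d" and d: "d \<le> 1"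
  shows "\<bar>expectation (\<lambda>z. deviation i z * deviation j z) - measure \<mu> (R i \<inter> R j)\<bar> \<le> d * measure \<mu> (R i \<inter> R j)"
proof -
  let ?x = "measure \<mu> (R i \<inter> R j)"
  have x: "0 \<le> ?x" "?x \<le> d"
    using le measure_mono_fmeasurable[of "R i \<inter> R j" "R i" \<mu>] R_fmeasurable[of i] R_fmeasurable[of j]
    by (auto simp: fmeasurable_def intro: order_trans)
  have "exp ?x \<le> 1 + ?x + ?x\<^sup>2" using x d by (intro exp_bound) auto
  moreover have "1 + ?x \<le> exp ?x" by (rule exp_ge_add_one_self)
  moreover have "?x\<^sup>2 \<le> d * ?x" using x by (auto simp: power2_eq_square intro: mult_right_mono)
  moreover have "0 \<le> ?x\<^sup>2" by simp
  ultimately show ?thesis unfolding expectation_deviation_product abs_le_iff by linarith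
qed

lemma integral_R_R: "(LINT x|\<mu>. indicator (R i) x * indicator (R j) x) = measure \<mu> (R i \<inter> R j)"
  "integrable \<mu> (\<lambda>x. indicator (R i) x * indicator (R j) x :: real)"
proof -
  have "R i \<inter> R j \<in> fmeasurable \<mu>" using R_fmeasurable by (intro fmeasurable.Int)
  then have "integrable \<mu> (indicator (R i \<inter> R j) :: 'x \<Rightarrow> real)"
    by (auto simp: fmeasurable_def)
  moreover have "(\<lambda>x. indicator (R i) x * indicator (R j) x :: real) = indicator (R i \<inter> R j)"
    by (auto simp: indicator_def)
  moreover have "R i \<inter> R j \<inter> space \<mu> = R i \<inter> R j"
    using sets.sets_into_space[OF fmeasurableD[OF R_fmeasurable]] by blast
  ultimately show "(LINT x|\<mu>. indicator (R i) x * indicator (R j) x) = measure \<mu> (R i \<inter> R j)"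
    "integrable \<mu> (\<lambda>x. indicator (R i) x * indicator (R j) x :: real)" by auto
qed

definition step :: "(int \<times> 'b \<Rightarrow> real) \<Rightarrow> (int \<times> 'b) set \<Rightarrow> 'x \<Rightarrow> real" where
  "step a A x = (\<Sum>i\<in>A. a i * indicator (R i) x)"

definition void_sum :: "(int \<times> 'b \<Rightarrow> real) \<Rightarrow> (int \<times> 'b) set \<Rightarrow> (int \<times> 'b \<Rightarrow> bool) \<Rightarrow> real" where
  "void_sum a A z = (\<Sum>i\<in>A. a i * deviation i z)"

lemma square_integrable_void_sum: "square_integrable Q (void_sum a A)"
  unfolding void_sum_def[abs_def] by (intro square_integrable_sum square_integrable_cmult square_integrable_deviation)

lemma square_integrable_step: "square_integrable \<mu> (step a A)"
proof -
  have "square_integrable \<mu> (indicator (R i))" for i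
    using integral_R_R(2)[of i i] R_fmeasurable[of i]
    by (auto simp: square_integrable_def power2_eq_square fmeasurable_def)
  then show ?thesis unfolding step_def[abs_def] by (intro square_integrable_sum square_integrable_cmult)
qed

lemma expectation_void_sum: "expectation (void_sum a A) = 0"
proof -
  have "integrable Q (deviation i)" for i
    using square_integrable_deviation integrable_mult_of_squares[of Q "deviation i" "\<lambda>_. 1"] by (simp add: square_integrable_def)
  then show ?thesis by (simp add: void_sum_def[abs_def] expectation_deviation)
qed

lemma expectation_sum_product_approx:
  assumes le: "\<And>i. i \<in> A \<Longrightarrow> measure \<mu> (R i) \<le> d" and d: "d \<le> 1"
  shows "\<bar>expectation (\<lambda>z. void_sum a A z * void_sum b B z) - (LINT x|\<mu>. step a A x * step b B x)\<bar>
    \<le> d * (LINT x|\<mu>. step (\<lambda>i. \<bar>a i\<bar>) A x * step (\<lambda>i. \<bar>b i\<bar>) B x)"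
proof -
  have int_prod: "integrable Q (\<lambda>z. deviation i z * deviation j z)" for i j
    by (intro integrable_mult_of_squares square_integrable_deviation)
  have 1: "expectation (\<lambda>z. void_sum a A z * void_sum b B z) = (\<Sum>i\<in>A. \<Sum>j\<in>B. a i * b j * expectation (\<lambda>z. deviation i z * deviation j z))"
  proof -
    have "(\<lambda>z. void_sum a A z * void_sum b B z) = (\<lambda>z. \<Sum>i\<in>A. \<Sum>j\<in>B. a i * b j * (deviation i z * deviation j z))"
      by (auto simp: void_sum_def sum_product algebra_simps)
    then show ?thesis using int_prod by simp
  qed
  have 2: "(LINT x|\<mu>. step a A x * step b B x) = (\<Sum>i\<in>A. \<Sum>j\<in>B. a i * b j * measure \<mu> (R i \<inter> R j))" for a b
  proof -
    have "(\<lambda>x. step a A x * step b B x) = (\<lambda>x. \<Sum>i\<in>A. \<Sum>j\<in>B. a i * b j * (indicator (R i) x * indicator (R j) x))"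
      by (rule ext) (simp only: step_def sum_product mult_ac)
    then show ?thesis using integral_R_R by simp
  qed
  have "\<bar>expectation (\<lambda>z. void_sum a A z * void_sum b B z) - (LINT x|\<mu>. step a A x * step b B x)\<bar>
    = \<bar>\<Sum>i\<in>A. \<Sum>j\<in>B. a i * b j * (expectation (\<lambda>z. deviation i z * deviation j z) - measure \<mu> (R i \<inter> R j))\<bar>"
    unfolding 1 2 by (simp add: sum_subtractf right_diff_distrib)
  also have "\<dots> \<le> (\<Sum>i\<in>A. \<Sum>j\<in>B. \<bar>a i * b j * (expectation (\<lambda>z. deviation i z * deviation j z) - measure \<mu> (R i \<inter> R j))\<bar>)"
    by (rule order_trans[OF sum_abs]) (intro sum_mono sum_abs)
  also have "\<dots> \<le> (\<Sum>i\<in>A. \<Sum>j\<in>B. \<bar>a i\<bar> * \<bar>b j\<bar> * (d * measure \<mu> (R i \<inter> R j)))"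
    unfolding abs_mult by (intro sum_mono mult_left_mono expectation_deviation_product_approx le d) auto
  also have "\<dots> = d * (LINT x|\<mu>. step (\<lambda>i. \<bar>a i\<bar>) A x * step (\<lambda>i. \<bar>b i\<bar>) B x)"
    unfolding 2 by (simp add: sum_distrib_left algebra_simps)
  finally show ?thesis .
qed

lemma step_comp:
  assumes "disjoint_family_on R A" "finite A" "g 0 = 0"
  shows "step (\<lambda>i. g (a i)) A x = g (step a A x)"
proof (cases "\<exists>i\<in>A. x \<in> R i")
  case True
  then obtain i where i: "i \<in> A" "x \<in> R i" by blast
  have uniq: "x \<notin> R j" if "j \<in> A" "j \<noteq> i" for j
    using assms(1) i that by (auto simp: disjoint_family_on_def)
  have "step c A x = c i" for c
  proof -
    have "step c A x = (\<Sum>j\<in>A. if j = i then c i else 0)"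
      unfolding step_def by (rule sum.cong) (use uniq i in \<open>auto simp: indicator_def\<close>)
    also have "\<dots> = c i" using i(1) assms(2) by simp
    finally show ?thesis .
  qed
  then show ?thesis by (simp only:)
next
  case False
  then have "step c A x = 0" for c by (auto simp: step_def indicator_def intro!: sum.neutral)
  then show ?thesis using assms(3) by simp
qed

text \<open>
  On disjoint families the absolute values of the coefficients change a step function only
  by its sign, so the error term is controlled by the norms of the step functions
  themselves.
\<close>

lemma expectation_disjoint_approx:
  assumes "disjoint_family_on R A" "disjoint_family_on R B" "finite A" "finite B"
    and le: "\<And>i. i \<in> A \<Longrightarrow> measure \<mu> (R i) \<le> d" and d: "0 \<le> d" "d \<le> 1"
  shows "\<bar>expectation (\<lambda>z. void_sum a A z * void_sum b B z) - (LINT x|\<mu>. step a A x * step b B x)\<bar>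
    \<le> d * (norm_L2 \<mu> (step a A) * norm_L2 \<mu> (step b B))"
proof -
  have n: "norm_L2 \<mu> (step (\<lambda>i. \<bar>a i\<bar>) A) = norm_L2 \<mu> (step a A)"
      "norm_L2 \<mu> (step (\<lambda>i. \<bar>b i\<bar>) B) = norm_L2 \<mu> (step b B)"
    using assms(1-4) by (simp_all add: norm_L2_def step_comp[where g=abs])
  have "(LINT x|\<mu>. step (\<lambda>i. \<bar>a i\<bar>) A x * step (\<lambda>i. \<bar>b i\<bar>) B x) \<le> norm_L2 \<mu> (step a A) * norm_L2 \<mu> (step b B)"
    using Cauchy_Schwarz_L2[OF square_integrable_step square_integrable_step, of "\<lambda>i. \<bar>a i\<bar>" A "\<lambda>i. \<bar>b i\<bar>" B]
    unfolding n by simp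
  from order_trans[OF expectation_sum_product_approx[OF le d(2)] mult_left_mono[OF this d(1)]]
  show ?thesis .
qed

end

section \<open>The Poisson stochastic integral\<close>

lemma norm_cis_diff_le: "cmod (cis a - cis b) \<le> \<bar>a - b\<bar>"
proof -
  have "cis a - cis b = cis b * (cis (a - b) - 1)" by (simp add: right_diff_distrib cis_mult)
  then have "cmod (cis a - cis b) = cmod (iexp (a - b) - 1)" by (simp add: norm_mult cis_conv_exp)
  also have "\<dots> \<le> \<bar>a - b\<bar>" using iexp_approx1[of "a - b" 0] by simp
  finally show ?thesis .
qed

text \<open>
  With \<open>p = exp (- m)\<close> and \<open>w = \<theta> exp m\<close>, the squared modulus is
  \<open>1 - 2 p (1 - p) (1 - cos w)\<close>, where \<open>1 - p \<le> m\<close> and \<open>1 - cos w\<close> is bounded both by \<open>2\<close>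
  and by \<open>\<theta>\<^sup>2\<close>.
\<close>

lemma norm_mixture_cis_ge:
  fixes m \<theta> :: real
  assumes m: "0 \<le> m" "m \<le> 1/8"
  shows "exp (- 2 * (m * min (\<theta>\<^sup>2) 2)) \<le> cmod ((1 - exp (- m)) * cis \<theta> + exp (- m) * cis (\<theta> * (1 - exp m)))"
proof -
  define p where "p = exp (- m)"
  define w where "w = \<theta> * exp m"
  have p: "0 \<le> p" "p \<le> 1" "1 - p \<le> m" using m exp_ge_add_one_self[of "- m"] by (auto simp: p_def)
  have c: "0 \<le> 1 - cos w" "1 - cos w \<le> 2" using cos_ge_minus_one[of w] cos_le_one[of w] by linarith+
  have c2: "1 - cos w \<le> \<theta>\<^sup>2"
  proof -
    have "1 - cos w = 2 * (sin (w/2))\<^sup>2" using cos_double_sin[of "w/2"] by simp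
    also have "\<dots> \<le> 2 * (w/2)\<^sup>2"
    proof (rule mult_left_mono)
      have "\<bar>sin (w/2)\<bar> \<le> \<bar>w/2\<bar>" by (rule abs_sin_x_le_abs_x)
      then show "(sin (w/2))\<^sup>2 \<le> (w/2)\<^sup>2" by (simp only: abs_le_square_iff)
    qed simp
    also have "\<dots> = \<theta>\<^sup>2 * (exp (2 * m) / 2)"
      by (simp add: w_def exp_double power_mult_distrib power_divide)
    also have "\<dots> \<le> \<theta>\<^sup>2 * 1"
    proof (rule mult_left_mono)
      have "exp (2 * m) \<le> 1 + 2 * m + (2 * m)\<^sup>2" using m by (intro exp_bound) auto
      also have "(2 * m)\<^sup>2 \<le> (1/4)\<^sup>2" using m by (intro power_mono) auto
      also have "1 + 2 * m + (1/4)\<^sup>2 \<le> 2" using m by (simp add: power2_eq_square)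
      finally show "exp (2 * m) / 2 \<le> 1" by simp
    qed simp
    finally show ?thesis by simp
  qed
  define v where "v = 2 * p * (1 - p) * (1 - cos w)"
  have v: "0 \<le> v" "v \<le> 2 * (m * min (\<theta>\<^sup>2) 2)"
  proof -
    show "0 \<le> v" unfolding v_def using p c by (intro mult_nonneg_nonneg) auto
    have "p * (1 - p) \<le> m" using p mult_mono[of p 1 "1 - p" m] by simp
    then have "p * (1 - p) * (1 - cos w) \<le> m * min (\<theta>\<^sup>2) 2"
      using c c2 m(1) by (intro mult_mono) auto
    then show "v \<le> 2 * (m * min (\<theta>\<^sup>2) 2)" by (simp add: v_def)
  qed
  have "m * min (\<theta>\<^sup>2) 2 \<le> (1/8) * 2" using m by (intro mult_mono) auto
  then have v2: "v \<le> 1/2" using v(2) by simp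
  have "(cmod ((1 - p) * cis \<theta> + p * cis (\<theta> * (1 - exp m))))\<^sup>2
      = ((1 - p) * cos \<theta> + p * cos (\<theta> - w))\<^sup>2 + ((1 - p) * sin \<theta> + p * sin (\<theta> - w))\<^sup>2"
    by (simp add: cmod_power2 w_def right_diff_distrib)
  also have "\<dots> = (1 - p)\<^sup>2 * ((cos \<theta>)\<^sup>2 + (sin \<theta>)\<^sup>2) + p\<^sup>2 * ((cos (\<theta> - w))\<^sup>2 + (sin (\<theta> - w))\<^sup>2)
      + 2 * p * (1 - p) * (cos \<theta> * cos (\<theta> - w) + sin \<theta> * sin (\<theta> - w))"
  proof -
    have "((1 - p) * a + p * b)\<^sup>2 + ((1 - p) * c + p * d)\<^sup>2
      = (1 - p)\<^sup>2 * (a\<^sup>2 + c\<^sup>2) + p\<^sup>2 * (b\<^sup>2 + d\<^sup>2) + 2 * p * (1 - p) * (a * b + c * d)" for a b c d :: real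
      by (simp add: power2_eq_square algebra_simps)
    then show ?thesis .
  qed
  also have "cos \<theta> * cos (\<theta> - w) + sin \<theta> * sin (\<theta> - w) = cos w"
    using cos_diff[of \<theta> "\<theta> - w"] by simp
  also have "(1 - p)\<^sup>2 * ((cos \<theta>)\<^sup>2 + (sin \<theta>)\<^sup>2) + p\<^sup>2 * ((cos (\<theta> - w))\<^sup>2 + (sin (\<theta> - w))\<^sup>2)
      + 2 * p * (1 - p) * cos w = 1 - v"
  proof -
    have t: "(cos \<theta>)\<^sup>2 + (sin \<theta>)\<^sup>2 = 1" "(cos (\<theta> - w))\<^sup>2 + (sin (\<theta> - w))\<^sup>2 = 1"
      by simp_all
    show ?thesis unfolding t by (simp add: v_def power2_eq_square algebra_simps)
  qed
  finally have n: "(cmod ((1 - p) * cis \<theta> + p * cis (\<theta> * (1 - exp m))))\<^sup>2 = 1 - v" .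
  have "- 2 * v \<le> ln (1 - v)"
  proof -
    have "v\<^sup>2 \<le> v * (1/2)" unfolding power2_eq_square using v(1) v2 by (intro mult_left_mono) auto
    then show ?thesis using ln_one_minus_pos_lower_bound[OF v(1) v2] by simp
  qed
  then have "exp (- 2 * v) \<le> 1 - v" using v2 by (subst (asm) ln_ge_iff) auto
  moreover have "(exp (- 2 * (m * min (\<theta>\<^sup>2) 2)))\<^sup>2 = exp (2 * (- 2 * (m * min (\<theta>\<^sup>2) 2)))"
    by (rule exp_double[symmetric])
  moreover have "exp (2 * (- 2 * (m * min (\<theta>\<^sup>2) 2))) \<le> exp (- 2 * v)"
    using v(2) by simp
  ultimately have "(exp (- 2 * (m * min (\<theta>\<^sup>2) 2)))\<^sup>2 \<le> (cmod ((1 - p) * cis \<theta> + p * cis (\<theta> * (1 - exp m))))\<^sup>2"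
    unfolding n by linarith
  then show ?thesis unfolding p_def by (rule power2_le_imp_le) simp
qed

context poisson_shift
begin

text \<open>
  Disjoint sets have independent void indicators. After expanding the product over subsets
  of \<open>A\<close>, this reduces to the additivity of \<open>\<mu>\<close> in the exponents of the void probabilities.
\<close>

lemma expectation_prod_void:
  fixes \<alpha> \<beta> :: "int \<times> 'b \<Rightarrow> complex"
  assumes A: "finite A" "disjoint_family_on R A"
  shows "integral\<^sup>L Q (\<lambda>z. \<Prod>i\<in>A. \<beta> i * of_bool (z i) + \<alpha> i)
    = (\<Prod>i\<in>A. \<beta> i * exp (- measure \<mu> (R i)) + \<alpha> i)"
proof -
  have void: "integrable Q (\<lambda>z. of_bool (\<forall>i\<in>B. z i) :: complex)"
      "integral\<^sup>L Q (\<lambda>z. of_bool (\<forall>i\<in>B. z i) :: complex) = (\<Prod>i\<in>B. complex_of_real (exp (- measure \<mu> (R i))))"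
    if "B \<subseteq> A" for B
  proof -
    have fB: "finite B" using that A(1) finite_subset by blast
    have eq: "(\<lambda>z. of_bool (\<forall>i\<in>B. z i) :: complex) = (\<lambda>z. complex_of_real (of_bool (\<forall>i\<in>B. z i)))"
      by (auto simp: of_bool_def)
    show "integrable Q (\<lambda>z. of_bool (\<forall>i\<in>B. z i) :: complex)"
      unfolding eq using integrable_void[OF fB] by (rule integrable_of_real)
    have "measure \<mu> (\<Union>i\<in>B. R i) = (\<Sum>i\<in>B. measure \<mu> (R i))"
      using R_fmeasurable fB disjoint_family_on_mono[OF that A(2)]
      by (intro measure_finite_Union) (auto simp: fmeasurable_def less_top)
    then show "integral\<^sup>L Q (\<lambda>z. of_bool (\<forall>i\<in>B. z i) :: complex) = (\<Prod>i\<in>B. complex_of_real (exp (- measure \<mu> (R i))))"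
      unfolding eq by (simp only: integral_complex_of_real expectation_void[OF fB] sum_negf[symmetric] exp_sum[OF fB] of_real_prod)
  qed
  have "(\<lambda>z. \<Prod>i\<in>A. \<beta> i * of_bool (z i) + \<alpha> i)
      = (\<lambda>z. \<Sum>B\<in>Pow A. (prod \<beta> B * prod \<alpha> (A - B)) * of_bool (\<forall>i\<in>B. z i))"
  proof
    fix z :: "int \<times> 'b \<Rightarrow> bool"
    have "(\<Prod>i\<in>B. of_bool (z i)) = (of_bool (\<forall>i\<in>B. z i) :: complex)" if "B \<in> Pow A" for B
    proof -
      have "finite B" using that A(1) finite_subset by auto
      then show ?thesis by (induction B) auto
    qed
    then show "(\<Prod>i\<in>A. \<beta> i * of_bool (z i) + \<alpha> i) = (\<Sum>B\<in>Pow A. (prod \<beta> B * prod \<alpha> (A - B)) * of_bool (\<forall>i\<in>B. z i))"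
      unfolding prod_add[OF A(1)] by (intro sum.cong refl) (simp add: prod.distrib)
  qed
  then have "integral\<^sup>L Q (\<lambda>z. \<Prod>i\<in>A. \<beta> i * of_bool (z i) + \<alpha> i)
      = (\<Sum>B\<in>Pow A. (prod \<beta> B * prod \<alpha> (A - B)) * (\<Prod>i\<in>B. complex_of_real (exp (- measure \<mu> (R i)))))"
    using void by simp
  also have "\<dots> = (\<Prod>i\<in>A. \<beta> i * exp (- measure \<mu> (R i)) + \<alpha> i)"
    unfolding prod_add[OF A(1)] by (intro sum.cong refl) (simp add: prod.distrib)
  finally show ?thesis .
qed

text \<open>
  The characteristic function of each deviation is a mixture of two points of the unit
  circle, to which \<open>norm_mixture_cis_ge\<close> applies; by independence the bounds multiply.
\<close>

lemma char_void_sum_ge: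
  assumes A: "finite A" "disjoint_family_on R A"
    and small: "\<And>i. i \<in> A \<Longrightarrow> measure \<mu> (R i) \<le> 1/8"
  shows "exp (- 2 * (LINT x|\<mu>. min (t\<^sup>2 * (step a A x)\<^sup>2) 2)) \<le> cmod (integral\<^sup>L Q (\<lambda>z. cis (t * void_sum a A z)))"
proof -
  let ?m = "\<lambda>i. measure \<mu> (R i)"
  have "(\<lambda>z. cis (t * void_sum a A z)) =
    (\<lambda>z. \<Prod>i\<in>A. (cis (t * a i * (1 - exp (?m i))) - cis (t * a i)) * of_bool (z i) + cis (t * a i))"
  proof
    fix z
    have "cis (\<Sum>i\<in>A. h i) = (\<Prod>i\<in>A. cis (h i))" for h
      using A(1) by (induction A rule: finite_induct) (simp_all flip: cis_mult)
    then have "cis (t * void_sum a A z) = (\<Prod>i\<in>A. cis (t * a i * deviation i z))"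
      by (simp add: void_sum_def sum_distrib_left mult.assoc)
    also have "\<dots> = (\<Prod>i\<in>A. (cis (t * a i * (1 - exp (?m i))) - cis (t * a i)) * of_bool (z i) + cis (t * a i))"
      by (intro prod.cong refl) (simp add: deviation_def)
    finally show "cis (t * void_sum a A z) = \<dots>" .
  qed
  then have char: "integral\<^sup>L Q (\<lambda>z. cis (t * void_sum a A z))
      = (\<Prod>i\<in>A. (cis (t * a i * (1 - exp (?m i))) - cis (t * a i)) * exp (- ?m i) + cis (t * a i))"
    by (simp only: expectation_prod_void[OF A])
  have "(LINT x|\<mu>. min (t\<^sup>2 * (step a A x)\<^sup>2) 2) = (LINT x|\<mu>. step (\<lambda>i. min ((t * a i)\<^sup>2) 2) A x)"
  proof -
    have "step (\<lambda>i. min ((t * a i)\<^sup>2) 2) A x = min ((t * step a A x)\<^sup>2) 2" for x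
      by (rule step_comp[OF A(2,1)]) simp
    then show ?thesis by (simp only:) (simp only: power_mult_distrib)
  qed
  also have "\<dots> = (\<Sum>i\<in>A. min ((t * a i)\<^sup>2) 2 * ?m i)"
  proof -
    have "integrable \<mu> (indicator (R i) :: 'x \<Rightarrow> real)" "(LINT x|\<mu>. indicator (R i) x) = ?m i" for i
      using integral_R_R[of i i] by (simp_all add: indicator_inter_arith[symmetric])
    then show ?thesis unfolding step_def by simp
  qed
  finally have "exp (- 2 * (LINT x|\<mu>. min (t\<^sup>2 * (step a A x)\<^sup>2) 2))
      = (\<Prod>i\<in>A. exp (- 2 * (min ((t * a i)\<^sup>2) 2 * ?m i)))"
    by (simp only: sum_distrib_left exp_sum[OF A(1)])
  also have "\<dots> \<le> (\<Prod>i\<in>A. cmod ((cis (t * a i * (1 - exp (?m i))) - cis (t * a i)) * exp (- ?m i) + cis (t * a i)))"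
  proof (rule prod_mono, rule conjI)
    fix i assume i: "i \<in> A"
    have "(cis (t * a i * (1 - exp (?m i))) - cis (t * a i)) * exp (- ?m i) + cis (t * a i)
      = (1 - exp (- ?m i)) * cis (t * a i) + exp (- ?m i) * cis (t * a i * (1 - exp (?m i)))"
      by (simp add: algebra_simps)
    then show "exp (- 2 * (min ((t * a i)\<^sup>2) 2 * ?m i))
      \<le> cmod ((cis (t * a i * (1 - exp (?m i))) - cis (t * a i)) * exp (- ?m i) + cis (t * a i))"
      using norm_mixture_cis_ge[OF measure_nonneg small[OF i], of "t * a i"] by (simp only: mult.commute[of "min _ _"])
  qed simp
  also have "\<dots> = cmod (integral\<^sup>L Q (\<lambda>z. cis (t * void_sum a A z)))"
    unfolding char by (rule prod_norm)
  finally show ?thesis .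
qed

end

text \<open>
  \<open>F k\<close> is the composition of \<open>F 0\<close> with the \<open>k\<close>-th power of the transformation. For each
  \<open>n\<close>, the labels in \<open>P n\<close> belong to disjoint sets of measure at most \<open>\<delta> n\<close>, and the step
  functions with the values \<open>a\<close> on their translates approximate \<open>F k\<close> from below in absolute
  value.
\<close>

locale poisson_integral = poisson_shift Q \<mu> R
  for Q :: "(int \<times> 'b::countable \<Rightarrow> bool) measure" and \<mu> :: "'x measure" and R :: "int \<times> 'b \<Rightarrow> 'x set" +
  fixes F :: "int \<Rightarrow> 'x \<Rightarrow> real" and P :: "nat \<Rightarrow> 'b set" and a :: "'b \<Rightarrow> real" and \<delta> :: "nat \<Rightarrow> real"
  assumes sqF: "\<And>k. square_integrable \<mu> (F k)"
    and finite_P: "\<And>n. finite (P n)"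
    and disj: "\<And>k n. disjoint_family_on R (Pair k ` P n)"
    and small: "\<And>n b. b \<in> P n \<Longrightarrow> measure \<mu> (R (0, b)) \<le> \<delta> n"
    and \<delta>_nonneg: "\<And>n. 0 \<le> \<delta> n" and \<delta>: "\<delta> \<longlonglongrightarrow> 0"
    and dom: "\<And>k n x. x \<in> space \<mu> \<Longrightarrow> \<bar>step (\<lambda>i. a (snd i)) (Pair k ` P n) x\<bar> \<le> \<bar>F k x\<bar>"
    and conv: "\<And>k x. x \<in> space \<mu> \<Longrightarrow> (\<lambda>n. step (\<lambda>i. a (snd i)) (Pair k ` P n) x) \<longlonglongrightarrow> F k x"
begin

definition approx_step :: "int \<Rightarrow> nat \<Rightarrow> 'x \<Rightarrow> real" where "approx_step k n = step (\<lambda>i. a (snd i)) (Pair k ` P n)"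
definition approx_integral :: "int \<Rightarrow> nat \<Rightarrow> (int \<times> 'b \<Rightarrow> bool) \<Rightarrow> real" where "approx_integral k n = void_sum (\<lambda>i. a (snd i)) (Pair k ` P n)"

lemma sq_approx_step: "square_integrable \<mu> (approx_step k n)" unfolding approx_step_def by (rule square_integrable_step)
lemma sq_approx_integral: "square_integrable Q (approx_integral k n)" unfolding approx_integral_def by (rule square_integrable_void_sum)

lemma F_measurable [measurable]: "F k \<in> borel_measurable \<mu>" by (rule square_integrable_measurable[OF sqF])
lemma approx_step_measurable [measurable]: "approx_step k n \<in> borel_measurable \<mu>" by (rule square_integrable_measurable[OF sq_approx_step])
lemma approx_integral_measurable [measurable]: "approx_integral k n \<in> borel_measurable Q" by (rule square_integrable_measurable[OF sq_approx_integral])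

lemma approx_step_tendsto: "(\<lambda>n. norm_L2 \<mu> (\<lambda>x. approx_step k n x - F k x)) \<longlonglongrightarrow> 0"
proof -
  have "(\<lambda>n. LINT x|\<mu>. (approx_step k n x - F k x)\<^sup>2) \<longlonglongrightarrow> (LINT x|\<mu>. 0)"
  proof (rule integral_dominated_convergence[where w="\<lambda>x. 4 * (F k x)\<^sup>2"])
    show "integrable \<mu> (\<lambda>x. 4 * (F k x)\<^sup>2)" using square_integrableD[OF sqF] by simp
    show "AE x in \<mu>. (\<lambda>n. (approx_step k n x - F k x)\<^sup>2) \<longlonglongrightarrow> 0"
    proof (rule AE_I2)
      fix x assume "x \<in> space \<mu>"
      from tendsto_power[OF tendsto_diff[OF conv[OF this, of k] tendsto_const[of "F k x"]], of 2]
      show "(\<lambda>n. (approx_step k n x - F k x)\<^sup>2) \<longlonglongrightarrow> 0" by (simp add: approx_step_def)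
    qed
    show "AE x in \<mu>. norm ((approx_step k n x - F k x)\<^sup>2) \<le> 4 * (F k x)\<^sup>2" for n
    proof (rule AE_I2)
      fix x assume "x \<in> space \<mu>"
      then have "\<bar>approx_step k n x - F k x\<bar> \<le> \<bar>2 * F k x\<bar>" using dom[of x k n] by (simp add: approx_step_def)
      then have "(approx_step k n x - F k x)\<^sup>2 \<le> (2 * F k x)\<^sup>2" by (simp only: abs_le_square_iff)
      then show "norm ((approx_step k n x - F k x)\<^sup>2) \<le> 4 * (F k x)\<^sup>2" by (simp add: power_mult_distrib)
    qed
  qed measurable
  then have "(\<lambda>n. sqrt (LINT x|\<mu>. (approx_step k n x - F k x)\<^sup>2)) \<longlonglongrightarrow> sqrt 0"
    by (intro tendsto_real_sqrt) simp
  then show ?thesis by (simp add: norm_L2_def)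
qed

lemma norm_approx_step_le: "norm_L2 \<mu> (approx_step k n) \<le> norm_L2 \<mu> (F k)"
  unfolding norm_L2_def
proof (intro real_sqrt_le_mono integral_mono square_integrableD[OF sq_approx_step] square_integrableD[OF sqF])
  fix x assume "x \<in> space \<mu>"
  then show "(approx_step k n x)\<^sup>2 \<le> (F k x)\<^sup>2" using dom[of x k n] by (simp only: approx_step_def abs_le_square_iff)
qed

lemma measure_small: "b \<in> P n \<Longrightarrow> measure \<mu> (R (k, b)) \<le> \<delta> n"
  using small[of b n] measure_R_shift[of "(0, b)" k] by simp

lemma approx_integral_inner_approx:
  assumes "\<delta> m \<le> 1"
  shows "\<bar>expectation (\<lambda>z. approx_integral k m z * approx_integral l n z) - (LINT x|\<mu>. approx_step k m x * approx_step l n x)\<bar> \<le> \<delta> m * (norm_L2 \<mu> (F k) * norm_L2 \<mu> (F l))"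
proof -
  have "\<bar>expectation (\<lambda>z. approx_integral k m z * approx_integral l n z) - (LINT x|\<mu>. approx_step k m x * approx_step l n x)\<bar> \<le> \<delta> m * (norm_L2 \<mu> (approx_step k m) * norm_L2 \<mu> (approx_step l n))"
    unfolding approx_integral_def approx_step_def using finite_P measure_small
    by (intro expectation_disjoint_approx disj \<delta>_nonneg assms) auto
  also have "\<dots> \<le> \<delta> m * (norm_L2 \<mu> (F k) * norm_L2 \<mu> (F l))"
    by (intro mult_left_mono mult_mono norm_approx_step_le \<delta>_nonneg) auto
  finally show ?thesis .
qed

lemma approx_integral_shift: "approx_integral 0 n (shift k z) = approx_integral k n z"
proof -
  have inj: "inj_on (Pair k) (P n)" for k :: int by (auto simp: inj_on_def)
  show ?thesis by (simp add: approx_integral_def void_sum_def sum.reindex[OF inj] deviation_shift)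
qed

text \<open>
  Covariances of the approximants agree with inner products of the step functions up to
  \<open>\<delta>\<close>, and the step functions form a Cauchy sequence.
\<close>

lemma approx_integral_Cauchy:
  assumes "0 < e"
  shows "\<exists>N. \<forall>m\<ge>N. \<forall>n\<ge>N. norm_L2 Q (\<lambda>z. approx_integral 0 m z - approx_integral 0 n z) < e"
proof -
  let ?N = "norm_L2 \<mu> (F 0)"
  define u where "u n = norm_L2 \<mu> (\<lambda>x. approx_step 0 n x - F 0 x)" for n
  \<comment> \<open>Four covariance errors of at most \<open>c * ?N\<^sup>2\<close> each must not exceed \<open>e\<^sup>2 / 2\<close>, and
    the covariance estimate needs \<open>c \<le> 1\<close>.\<close>
  define c where "c = min 1 (e\<^sup>2 / (8 * (?N\<^sup>2 + 1)))"
  have "0 < ?N\<^sup>2 + 1" by (simp add: add_nonneg_pos)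
  then have "0 < c" using assms by (simp add: c_def)
  obtain N1 where N1: "\<And>n. N1 \<le> n \<Longrightarrow> \<delta> n < c"
    using order_tendstoD(2)[OF \<delta> \<open>0 < c\<close>] by (auto simp: eventually_sequentially)
  have "0 < e / 4" using assms by simp
  then obtain N2 where N2: "\<And>n. N2 \<le> n \<Longrightarrow> u n < e / 4"
    using order_tendstoD(2)[OF approx_step_tendsto[of 0] \<open>0 < e / 4\<close>]
    unfolding u_def eventually_sequentially by blast
  have "norm_L2 Q (\<lambda>z. approx_integral 0 m z - approx_integral 0 n z) < e" if "max N1 N2 \<le> m" "max N1 N2 \<le> n" for m n
  proof (rule power_less_imp_less_base)
    have d: "\<delta> m < c" "\<delta> n < c" "\<delta> m \<le> 1" "\<delta> n \<le> 1" using that N1[of m] N1[of n] by (auto simp: c_def)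
    have expand: "(norm_L2 K (\<lambda>z. g z - h z))\<^sup>2 = (LINT z|K. g z * g z) - 2 * (LINT z|K. g z * h z) + (LINT z|K. h z * h z)"
      if "square_integrable K g" "square_integrable K h" for K :: "'k measure" and g h
    proof -
      have "(norm_L2 K (\<lambda>z. g z - h z))\<^sup>2 = (LINT z|K. (g z * g z - 2 * (g z * h z)) + h z * h z)"
        unfolding norm_L2_power2 by (rule Bochner_Integration.integral_cong) (auto simp: power2_eq_square algebra_simps)
      then show ?thesis using that by (simp add: integrable_mult_of_squares)
    qed
    have "(norm_L2 Q (\<lambda>z. approx_integral 0 m z - approx_integral 0 n z))\<^sup>2 - (norm_L2 \<mu> (\<lambda>x. approx_step 0 m x - approx_step 0 n x))\<^sup>2
        \<le> \<delta> m * ?N\<^sup>2 + 2 * (\<delta> m * ?N\<^sup>2) + \<delta> n * ?N\<^sup>2"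
      unfolding expand[OF sq_approx_integral sq_approx_integral] expand[OF sq_approx_step sq_approx_step]
      using approx_integral_inner_approx[OF d(3), of 0 0 m] approx_integral_inner_approx[OF d(3), of 0 0 n] approx_integral_inner_approx[OF d(4), of 0 0 n]
      unfolding power2_eq_square abs_le_iff by linarith
    also have "\<dots> \<le> c * ?N\<^sup>2 + 2 * (c * ?N\<^sup>2) + c * ?N\<^sup>2"
      using d by (intro add_mono mult_left_mono mult_right_mono) auto
    also have "\<dots> = 4 * c * ?N\<^sup>2" by simp
    also have "\<dots> \<le> 4 * c * (?N\<^sup>2 + 1)" using \<open>0 < c\<close> by simp
    also have "\<dots> \<le> e\<^sup>2 / 2"
    proof -
      have "c \<le> e\<^sup>2 / (8 * (?N\<^sup>2 + 1))" by (simp add: c_def)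
      then show ?thesis using \<open>0 < ?N\<^sup>2 + 1\<close> by (simp add: pos_le_divide_eq algebra_simps)
    qed
    finally have 1: "(norm_L2 Q (\<lambda>z. approx_integral 0 m z - approx_integral 0 n z))\<^sup>2 \<le> (norm_L2 \<mu> (\<lambda>x. approx_step 0 m x - approx_step 0 n x))\<^sup>2 + e\<^sup>2 / 2" by simp
    have "norm_L2 \<mu> (\<lambda>x. approx_step 0 m x - approx_step 0 n x) \<le> u m + u n"
      using norm_L2_triangle_diff[OF sq_approx_step[of 0 m] sqF[of 0] sq_approx_step[of 0 n]]
      unfolding u_def norm_L2_minus_commute[of \<mu> "F 0" "approx_step 0 n"] .
    also have "\<dots> \<le> e / 2" using N2[of m] N2[of n] that by simp
    finally have "(norm_L2 \<mu> (\<lambda>x. approx_step 0 m x - approx_step 0 n x))\<^sup>2 \<le> (e/2)\<^sup>2" by (intro power_mono) auto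
    also have "\<dots> < e\<^sup>2 / 2" using assms by (simp add: power2_eq_square)
    finally show "(norm_L2 Q (\<lambda>z. approx_integral 0 m z - approx_integral 0 n z))\<^sup>2 < e\<^sup>2" using 1 by simp
  qed (use assms in simp)
  then show ?thesis by blast
qed

text \<open>
  \<open>X\<close> is the centred integral of \<open>F 0\<close> against the Poisson process. The last property says
  that its law has no Gaussian part, see \<open>normal_not_bounded_below\<close>.
\<close>

lemma stochastic_integral:
  obtains X where "square_integrable Q X" "expectation X = 0"
    "\<And>k. expectation (\<lambda>z. X (shift k z) * X z) = (LINT x|\<mu>. F k x * F 0 x)"
    "\<And>t. exp (- 2 * (LINT x|\<mu>. min (t\<^sup>2 * (F 0 x)\<^sup>2) 2)) \<le> cmod (integral\<^sup>L Q (\<lambda>z. cis (t * X z)))"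
proof -
  obtain X where X: "square_integrable Q X" and lim: "(\<lambda>n. norm_L2 Q (\<lambda>z. approx_integral 0 n z - X z)) \<longlonglongrightarrow> 0"
    using L2_complete[of Q "approx_integral 0", OF sq_approx_integral approx_integral_Cauchy] by blast
  have [measurable]: "X \<in> borel_measurable Q" by (rule square_integrable_measurable[OF X])
  note sh = shift_Q shift_preserves
  have Xk: "square_integrable Q (\<lambda>z. X (shift k z))" for k
    unfolding square_integrable_def
    using integrable_comp_measure_preserving[OF sh square_integrableD[OF X]] by simp
  have limk: "(\<lambda>n. norm_L2 Q (\<lambda>z. approx_integral k n z - X (shift k z))) \<longlonglongrightarrow> 0" for k
  proof -
    have "norm_L2 Q (\<lambda>z. approx_integral k n z - X (shift k z)) = norm_L2 Q (\<lambda>z. approx_integral 0 n z - X z)" for n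
      using integral_comp_measure_preserving[OF sh, of "\<lambda>z. (approx_integral 0 n z - X z)\<^sup>2" k]
      by (simp add: norm_L2_def approx_integral_shift)
    then show ?thesis using lim by simp
  qed
  have one: "square_integrable Q (\<lambda>_. 1)" by (simp add: square_integrable_def)
  have mean: "expectation X = 0"
  proof -
    have "(\<lambda>n. expectation (\<lambda>z. approx_integral 0 n z * 1)) \<longlonglongrightarrow> expectation (\<lambda>z. X z * 1)"
      by (rule tendsto_L2_inner[OF sq_approx_integral X lim one one]) (simp add: norm_L2_def)
    then show ?thesis by (simp add: approx_integral_def expectation_void_sum LIMSEQ_const_iff)
  qed
  have cov: "expectation (\<lambda>z. X (shift k z) * X z) = (LINT x|\<mu>. F k x * F 0 x)" for k
  proof (rule LIMSEQ_unique)
    show "(\<lambda>n. expectation (\<lambda>z. approx_integral k n z * approx_integral 0 n z)) \<longlonglongrightarrow> expectation (\<lambda>z. X (shift k z) * X z)"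
      by (rule tendsto_L2_inner[OF sq_approx_integral Xk limk sq_approx_integral X lim])
    have s: "(\<lambda>n. LINT x|\<mu>. approx_step k n x * approx_step 0 n x) \<longlonglongrightarrow> (LINT x|\<mu>. F k x * F 0 x)"
      by (rule tendsto_L2_inner[OF sq_approx_step sqF approx_step_tendsto sq_approx_step sqF approx_step_tendsto])
    have "(\<lambda>n. expectation (\<lambda>z. approx_integral k n z * approx_integral 0 n z) - (LINT x|\<mu>. approx_step k n x * approx_step 0 n x)) \<longlonglongrightarrow> 0"
    proof (rule Lim_null_comparison)
      have "\<forall>\<^sub>F n in sequentially. \<delta> n < 1" using order_tendstoD(2)[OF \<delta>] by simp
      then show "\<forall>\<^sub>F n in sequentially. norm (expectation (\<lambda>z. approx_integral k n z * approx_integral 0 n z) - (LINT x|\<mu>. approx_step k n x * approx_step 0 n x))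
          \<le> \<delta> n * (norm_L2 \<mu> (F k) * norm_L2 \<mu> (F 0))"
        by eventually_elim (use approx_integral_inner_approx in simp)
      show "(\<lambda>n. \<delta> n * (norm_L2 \<mu> (F k) * norm_L2 \<mu> (F 0))) \<longlonglongrightarrow> 0"
        using tendsto_mult_right[OF \<delta>, of "norm_L2 \<mu> (F k) * norm_L2 \<mu> (F 0)"] by simp
    qed
    from tendsto_add[OF this s] show "(\<lambda>n. expectation (\<lambda>z. approx_integral k n z * approx_integral 0 n z)) \<longlonglongrightarrow> (LINT x|\<mu>. F k x * F 0 x)"
      by simp
  qed
  have char: "exp (- 2 * (LINT x|\<mu>. min (t\<^sup>2 * (F 0 x)\<^sup>2) 2)) \<le> cmod (integral\<^sup>L Q (\<lambda>z. cis (t * X z)))" for t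
  proof (rule tendsto_lowerbound)
    have "(\<lambda>n. integral\<^sup>L Q (\<lambda>z. cis (t * approx_integral 0 n z)) - integral\<^sup>L Q (\<lambda>z. cis (t * X z))) \<longlonglongrightarrow> 0"
    proof (rule Lim_null_comparison)
      show "(\<lambda>n. \<bar>t\<bar> * norm_L2 Q (\<lambda>z. approx_integral 0 n z - X z)) \<longlonglongrightarrow> 0"
        using tendsto_mult_left[OF lim, of "\<bar>t\<bar>"] by simp
      have "norm (integral\<^sup>L Q (\<lambda>z. cis (t * approx_integral 0 n z)) - integral\<^sup>L Q (\<lambda>z. cis (t * X z)))
          \<le> \<bar>t\<bar> * norm_L2 Q (\<lambda>z. approx_integral 0 n z - X z)" for n
      proof -
        have cis_m: "(\<lambda>z. cis (t * h z)) \<in> borel_measurable Q" if [measurable]: "h \<in> borel_measurable Q" for h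
          by (simp add: cis_conv_exp)
        have int: "integrable Q (\<lambda>z. cis (t * h z))" if "h \<in> borel_measurable Q" for h
          by (rule integrable_const_bound[where B=1]) (use that cis_m in auto)
        have sqd: "square_integrable Q (\<lambda>z. \<bar>approx_integral 0 n z - X z\<bar>)"
          using square_integrable_diff[OF sq_approx_integral[of 0 n] X] by (auto simp: square_integrable_def)
        have "norm (integral\<^sup>L Q (\<lambda>z. cis (t * approx_integral 0 n z)) - integral\<^sup>L Q (\<lambda>z. cis (t * X z)))
          = norm (integral\<^sup>L Q (\<lambda>z. cis (t * approx_integral 0 n z) - cis (t * X z)))"
          by (subst Bochner_Integration.integral_diff) (auto intro!: int)
        also have "\<dots> \<le> (LINT z|Q. norm (cis (t * approx_integral 0 n z) - cis (t * X z)))"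
          by (rule integral_norm_bound)
        also have "\<dots> \<le> (LINT z|Q. \<bar>t\<bar> * (\<bar>approx_integral 0 n z - X z\<bar> * 1))"
        proof (rule integral_mono)
          show "integrable Q (\<lambda>z. norm (cis (t * approx_integral 0 n z) - cis (t * X z)))"
            by (intro integrable_norm Bochner_Integration.integrable_diff int) measurable
          show "integrable Q (\<lambda>z. \<bar>t\<bar> * (\<bar>approx_integral 0 n z - X z\<bar> * 1))"
            by (intro integrable_mult_right integrable_mult_of_squares sqd one)
          show "norm (cis (t * approx_integral 0 n z) - cis (t * X z)) \<le> \<bar>t\<bar> * (\<bar>approx_integral 0 n z - X z\<bar> * 1)" for z
            using norm_cis_diff_le[of "t * approx_integral 0 n z" "t * X z"] by (simp add: abs_mult flip: right_diff_distrib)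
        qed
        also have "\<dots> = \<bar>t\<bar> * (LINT z|Q. \<bar>approx_integral 0 n z - X z\<bar> * 1)" by simp
        also have "\<dots> \<le> \<bar>t\<bar> * (norm_L2 Q (\<lambda>z. \<bar>approx_integral 0 n z - X z\<bar>) * norm_L2 Q (\<lambda>_. 1))"
          using Cauchy_Schwarz_L2[OF sqd one] by (intro mult_left_mono) auto
        also have "\<dots> = \<bar>t\<bar> * norm_L2 Q (\<lambda>z. approx_integral 0 n z - X z)"
          by (simp add: norm_L2_def)
        finally show ?thesis .
      qed
      then show "\<forall>\<^sub>F n in sequentially. norm (integral\<^sup>L Q (\<lambda>z. cis (t * approx_integral 0 n z)) - integral\<^sup>L Q (\<lambda>z. cis (t * X z)))
          \<le> \<bar>t\<bar> * norm_L2 Q (\<lambda>z. approx_integral 0 n z - X z)" by simp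
    qed
    then show "(\<lambda>n. cmod (integral\<^sup>L Q (\<lambda>z. cis (t * approx_integral 0 n z)))) \<longlonglongrightarrow> cmod (integral\<^sup>L Q (\<lambda>z. cis (t * X z)))"
      by (rule tendsto_norm[OF LIM_zero_cancel])
    have "\<forall>\<^sub>F n in sequentially. \<delta> n < 1/8" by (rule order_tendstoD(2)[OF \<delta>]) simp
    then show "\<forall>\<^sub>F n in sequentially. exp (- 2 * (LINT x|\<mu>. min (t\<^sup>2 * (F 0 x)\<^sup>2) 2)) \<le> cmod (integral\<^sup>L Q (\<lambda>z. cis (t * approx_integral 0 n z)))"
    proof eventually_elim
      case (elim n)
      have int: "integrable \<mu> (\<lambda>x. min (t\<^sup>2 * (h x)\<^sup>2) 2)" if "square_integrable \<mu> h" for h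
      proof (rule Bochner_Integration.integrable_bound)
        show "integrable \<mu> (\<lambda>x. t\<^sup>2 * (h x)\<^sup>2)" using square_integrableD[OF that] by simp
        show "(\<lambda>x. min (t\<^sup>2 * (h x)\<^sup>2) 2) \<in> borel_measurable \<mu>"
          using square_integrable_measurable[OF that] by measurable
      qed auto
      have "(LINT x|\<mu>. min (t\<^sup>2 * (approx_step 0 n x)\<^sup>2) 2) \<le> (LINT x|\<mu>. min (t\<^sup>2 * (F 0 x)\<^sup>2) 2)"
      proof (intro integral_mono int sq_approx_step sqF)
        fix x assume "x \<in> space \<mu>"
        then have "(approx_step 0 n x)\<^sup>2 \<le> (F 0 x)\<^sup>2" using dom[of x 0 n] by (simp only: approx_step_def abs_le_square_iff)
        then show "min (t\<^sup>2 * (approx_step 0 n x)\<^sup>2) 2 \<le> min (t\<^sup>2 * (F 0 x)\<^sup>2) 2"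
          by (intro min.mono mult_left_mono) auto
      qed
      then have "exp (- 2 * (LINT x|\<mu>. min (t\<^sup>2 * (F 0 x)\<^sup>2) 2)) \<le> exp (- 2 * (LINT x|\<mu>. min (t\<^sup>2 * (approx_step 0 n x)\<^sup>2) 2))"
        by simp
      also have "\<dots> \<le> cmod (integral\<^sup>L Q (\<lambda>z. cis (t * approx_integral 0 n z)))"
        unfolding approx_step_def approx_integral_def
      proof (rule char_void_sum_ge[OF _ disj])
        fix i :: "int \<times> 'b" assume "i \<in> Pair 0 ` P n"
        then show "measure \<mu> (R i) \<le> 1/8" using measure_small[of "snd i" n 0] elim by auto
      qed (simp add: finite_P)
      finally show ?case .
    qed
  qed simp
  show thesis by (rule that[OF X mean cov char])
qed

end

section \<open>Ergodicity of the shift\<close>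

context poisson_shift
begin

lemma covariance_void_le:
  fixes F :: "(int \<times> 'b) set" and j k :: int
  assumes F: "finite F"
  defines "A \<equiv> \<lambda>k. \<Union>i\<in>F. R (fst i + k, snd i)"
  shows "prob {z. (\<forall>i\<in>F. shift j z i) \<and> (\<forall>i\<in>F. shift k z i)} - (prob {z. \<forall>i\<in>F. z i})\<^sup>2 \<le> measure \<mu> (A j \<inter> A k)"
proof -
  have fA: "A k \<in> fmeasurable \<mu>" for k
    unfolding A_def using F R_fmeasurable by (intro fmeasurable.finite_UN) auto
  have mA: "measure \<mu> (A k) = measure \<mu> (A 0)" for k
    using shift_invariant[OF F, of k] by (simp add: A_def)
  let ?G = "(\<lambda>i. (fst i + j, snd i)) ` F \<union> (\<lambda>i. (fst i + k, snd i)) ` F"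
  let ?x = "measure \<mu> (A j \<inter> A k)" and ?a = "measure \<mu> (A 0)"
  have "{z. (\<forall>i\<in>F. shift j z i) \<and> (\<forall>i\<in>F. shift k z i)} = {z. \<forall>i\<in>?G. z i}"
    by (auto simp: shift_def)
  also have "prob \<dots> = exp (- measure \<mu> (\<Union>i\<in>?G. R i))"
    by (rule void_prob) (simp add: F)
  also have "(\<Union>i\<in>?G. R i) = A j \<union> A k" by (auto simp: A_def)
  also have "measure \<mu> (A j \<union> A k) = 2 * ?a - ?x"
    using measure_Un3[OF fA fA, of j k] mA[of j] mA[of k] by simp
  finally have 1: "prob {z. (\<forall>i\<in>F. shift j z i) \<and> (\<forall>i\<in>F. shift k z i)} = exp (?x - 2 * ?a)" by simp
  have "prob {z. \<forall>i\<in>F. z i} = exp (- ?a)" using void_prob[OF F] by (simp add: A_def)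
  then have 2: "(prob {z. \<forall>i\<in>F. z i})\<^sup>2 = exp (- (2 * ?a))"
    by (simp add: power2_eq_square flip: exp_add)
  \<comment> \<open>The covariance is \<open>exp (- 2 a) (exp x - 1)\<close>, at most \<open>x exp (x - 2 a)\<close> by convexity, and \<open>x \<le> a\<close>.\<close>
  have "1 - ?x \<le> exp (- ?x)" using exp_ge_add_one_self[of "- ?x"] by simp
  then have "exp (?x - 2 * ?a) * (1 - ?x) \<le> exp (?x - 2 * ?a) * exp (- ?x)"
    by (intro mult_left_mono) auto
  then have "exp (?x - 2 * ?a) - exp (- (2 * ?a)) \<le> ?x * exp (?x - 2 * ?a)"
    by (simp add: algebra_simps flip: exp_add)
  also have "\<dots> \<le> ?x * 1"
  proof (rule mult_left_mono)
    have "?x \<le> ?a"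
      using measure_mono_fmeasurable[of "A j \<inter> A k" "A j" \<mu>] fA[of j] fA[of k] mA[of j] by (auto dest: fmeasurableD)
    then have "?x \<le> 2 * ?a" using measure_nonneg[of \<mu> "A 0"] by linarith
    then show "exp (?x - 2 * ?a) \<le> 1" by simp
  qed simp
  finally show ?thesis unfolding 1 2 by simp
qed

text \<open>
  The left-hand side is the variance of a convex combination of the indicators of the
  translates of one void event.
\<close>

lemma average_of_shifts_concentrates:
  assumes F: "finite F" and w: "convex_weights n w"
  shows "(norm_L2 Q (\<lambda>z. (\<Sum>k<n. w k * of_bool (\<forall>i\<in>F. shift (int k) z i)) - prob {z. \<forall>i\<in>F. z i}))\<^sup>2
    \<le> (\<Sum>j<n. \<Sum>k<n. w j * w k *
        measure \<mu> ((\<Union>i\<in>F. R (fst i + int j, snd i)) \<inter> (\<Union>i\<in>F. R (fst i + int k, snd i))))"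
proof -
  define u where "u k z = (of_bool (\<forall>i\<in>F. shift (int k) z i) :: real)" for k z
  define p where "p = prob {z. \<forall>i\<in>F. z i}"
  have w1: "(\<Sum>k<n. w k) = 1" and w0: "\<And>k. 0 \<le> w k" using w by (auto simp: convex_weights_def)
  have [measurable]: "Measurable.pred Q (\<lambda>z. shift k z i)" for k i
    unfolding shift_def by measurable
  have [measurable]: "u k \<in> borel_measurable Q" for k
    unfolding u_def[abs_def] using F by measurable
  have int: "integrable Q (\<lambda>z. u j z * u k z)" "integrable Q (u k)" for j k
    by (rule integrable_const_bound[where B=1]; simp add: u_def)+
  have Eu: "expectation (u k) = p" for k
  proof -
    have "expectation (u k) = expectation (\<lambda>z. of_bool (\<forall>i\<in>F. z i))"
      using integral_comp_measure_preserving[OF shift_Q shift_preserves, of "\<lambda>z. of_bool (\<forall>i\<in>F. z i) :: real" "int k"] F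
      by (simp add: u_def[abs_def])
    then show ?thesis by (simp add: expectation_void[OF F] p_def void_prob[OF F])
  qed
  have Euu: "expectation (\<lambda>z. u j z * u k z) = prob {z. (\<forall>i\<in>F. shift (int j) z i) \<and> (\<forall>i\<in>F. shift (int k) z i)}" for j k
  proof -
    have "expectation (\<lambda>z. u j z * u k z)
      = expectation (indicator {z. (\<forall>i\<in>F. shift (int j) z i) \<and> (\<forall>i\<in>F. shift (int k) z i)})"
      by (rule Bochner_Integration.integral_cong) (auto simp: u_def indicator_def)
    then show ?thesis by simp
  qed
  have "(norm_L2 Q (\<lambda>z. (\<Sum>k<n. w k * u k z) - p))\<^sup>2 = expectation (\<lambda>z. \<Sum>j<n. \<Sum>k<n. w j * w k * ((u j z - p) * (u k z - p)))"
  proof -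
    have "(\<Sum>k<n. w k * u k z) - p = (\<Sum>k<n. w k * (u k z - p))" for z
      using w1 by (simp add: right_diff_distrib sum_subtractf flip: sum_distrib_right)
    then show ?thesis
      unfolding norm_L2_power2
      by (intro Bochner_Integration.integral_cong refl) (simp add: power2_eq_square sum_product mult_ac)
  qed
  also have "\<dots> = (\<Sum>j<n. \<Sum>k<n. w j * w k * (expectation (\<lambda>z. u j z * u k z) - p\<^sup>2))"
  proof -
    have cov: "integrable Q (\<lambda>z. (u j z - p) * (u k z - p))"
      "expectation (\<lambda>z. (u j z - p) * (u k z - p)) = expectation (\<lambda>z. u j z * u k z) - p\<^sup>2" for j k
    proof -
      have eq: "(\<lambda>z. (u j z - p) * (u k z - p)) = (\<lambda>z. u j z * u k z - p * u j z - p * u k z + p\<^sup>2)"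
        by (auto simp: algebra_simps power2_eq_square)
      show "integrable Q (\<lambda>z. (u j z - p) * (u k z - p))" unfolding eq using int by simp
      show "expectation (\<lambda>z. (u j z - p) * (u k z - p)) = expectation (\<lambda>z. u j z * u k z) - p\<^sup>2"
        unfolding eq using int Eu by (simp add: power2_eq_square)
    qed
    then show ?thesis by simp
  qed
  also have "\<dots> \<le> (\<Sum>j<n. \<Sum>k<n. w j * w k *
        measure \<mu> ((\<Union>i\<in>F. R (fst i + int j, snd i)) \<inter> (\<Union>i\<in>F. R (fst i + int k, snd i))))"
    unfolding Euu p_def using covariance_void_le[OF F] w0
    by (intro sum_mono mult_left_mono) auto
  finally show ?thesis unfolding u_def p_def .
qed

text \<open>
  For an invariant event \<open>E\<close>, all products of its indicator with the indicator of a
  translate of a void event \<open>B\<close> have the same integral. Replacing the translates by a convex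
  combination that is close to the constant \<open>P(B)\<close> shows that \<open>E\<close> and \<open>B\<close> are independent.
\<close>

lemma ergodic_shift:
  assumes vanish: "\<And>F e. finite F \<Longrightarrow> 0 < e \<Longrightarrow> \<exists>n w. convex_weights n w \<and>
      (\<Sum>j<n. \<Sum>k<n. w j * w k *
        measure \<mu> ((\<Union>i\<in>F. R (fst i + int j, snd i)) \<inter> (\<Union>i\<in>F. R (fst i + int k, snd i)))) < e"
    and E: "E \<in> sets (completion Q)" and inv: "shift 1 -` E = E"
  shows "emeasure (completion Q) E = 0 \<or> emeasure (completion Q) E = 1"
proof -
  let ?C = "completion Q"
  interpret C: prob_space ?C by (rule prob_space_completion)
  have inv_k: "shift (int k) -` E = E" for k
  proof (induction k)
    case 0
    then show ?case by (simp add: shift_def)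
  next
    case (Suc k)
    have "shift (int (Suc k)) -` E = shift (int k) -` (shift 1 -` E)"
      by (intro set_eqI) simp
    then show ?case by (simp only: inv Suc)
  qed
  have m_shift: "shift k \<in> measurable ?C ?C" and d_shift: "distr ?C ?C (shift k) = ?C" for k
  proof -
    have mc: "shift k \<in> measurable ?C Q" by (intro measurable_completion shift_Q)
    have d: "distr ?C Q (shift k) = Q"
      using distr_completion[OF shift_Q, of k] by (simp add: shift_preserves)
    show "shift k \<in> measurable ?C ?C" by (rule completion.measurable_completion2[OF mc]) (simp add: d)
    show "distr ?C ?C (shift k) = ?C" using completion.completion_distr_eq[OF mc] by (simp add: d)
  qed
  have indep: "C.prob (E \<inter> {z. \<forall>i\<in>F. z i}) = C.prob E * C.prob {z. \<forall>i\<in>F. z i}" if F: "finite F" for F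
  proof -
    define B where "B = {z. \<forall>i\<in>F. z i}"
    define p where "p = prob B"
    have B: "B \<in> sets Q" unfolding B_def by (rule cylinder_sets[OF F])
    have pB: "C.prob B = p" unfolding p_def using B by (simp add: measure_completion)
    define q where "q = C.prob (E \<inter> B)"
    have mB: "B \<in> sets ?C" using B by auto
    have "\<bar>q - C.prob E * p\<bar> \<le> sqrt e" if "0 < e" for e
    proof -
      obtain n w where w: "convex_weights n w" and small: "(\<Sum>j<n. \<Sum>k<n. w j * w k *
        measure \<mu> ((\<Union>i\<in>F. R (fst i + int j, snd i)) \<inter> (\<Union>i\<in>F. R (fst i + int k, snd i)))) < e"
        using vanish[OF F \<open>0 < e\<close>] by blast
      have w1: "(\<Sum>k<n. w k) = 1" using w by (auto simp: convex_weights_def)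
      define g where "g z = (\<Sum>k<n. w k * of_bool (\<forall>i\<in>F. shift (int k) z i)) - p" for z
      have [measurable]: "Measurable.pred Q (\<lambda>z. shift k z i)" for k i
        unfolding shift_def by measurable
      have g_m[measurable]: "g \<in> borel_measurable Q" unfolding g_def[abs_def] using F by measurable
      have g_b: "\<bar>g z\<bar> \<le> (\<Sum>k<n. \<bar>w k\<bar>) + \<bar>p\<bar>" for z
      proof -
        have "\<bar>\<Sum>k<n. w k * of_bool (\<forall>i\<in>F. shift (int k) z i)\<bar> \<le> (\<Sum>k<n. \<bar>w k\<bar>)"
          by (rule order_trans[OF sum_abs], rule sum_mono) (simp add: of_bool_def)
        then show ?thesis unfolding g_def by linarith
      qed
      have norm_g: "norm_L2 ?C g \<le> sqrt e"
      proof -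
        have "(norm_L2 ?C g)\<^sup>2 = (norm_L2 Q g)\<^sup>2"
          unfolding norm_L2_power2 by (rule integral_completion) measurable
        also have "\<dots> \<le> e"
          using average_of_shifts_concentrates[OF F w] small
          unfolding g_def[abs_def] p_def B_def by linarith
        finally show ?thesis by (rule real_le_rsqrt)
      qed
      have sg: "square_integrable ?C g"
        by (rule square_integrable_bounded_prob[OF C.finite_measure_axioms _ g_b]) (intro measurable_completion g_m)
      have sE: "square_integrable ?C (indicator E)"
        by (rule square_integrable_bounded_prob[OF C.finite_measure_axioms, where c=1]) (use E in \<open>auto simp: indicator_def\<close>)
      have "(LINT z|?C. indicator E z * g z) = q - C.prob E * p"
      proof -
        have Ek: "C.prob (E \<inter> shift (int k) -` B) = q" for k
        proof -
          have "q = measure (distr ?C ?C (shift (int k))) (E \<inter> B)" by (simp add: d_shift q_def)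
          also have "\<dots> = C.prob (shift (int k) -` (E \<inter> B) \<inter> space ?C)"
            using E mB by (intro measure_distr m_shift) auto
          also have "shift (int k) -` (E \<inter> B) \<inter> space ?C = E \<inter> shift (int k) -` B"
            using inv_k[of k] by auto
          finally show ?thesis by simp
        qed
        have mk: "shift (int k) -` B \<in> sets ?C" for k
          using measurable_sets[OF m_shift mB, of "int k"] by simp
        have "(LINT z|?C. indicator E z * g z)
          = (LINT z|?C. (\<Sum>k<n. w k * indicator (E \<inter> shift (int k) -` B) z) - p * indicator E z)"
          by (rule Bochner_Integration.integral_cong)
             (auto simp: g_def B_def indicator_def sum_distrib_left right_diff_distrib intro!: sum.cong)
        also have "\<dots> = (\<Sum>k<n. w k * C.prob (E \<inter> shift (int k) -` B)) - p * C.prob E"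
        proof -
          have linear: "(LINT z|?C. (\<Sum>k<n. w k * h k z) - p * e z) = (\<Sum>k<n. w k * (LINT z|?C. h k z)) - p * (LINT z|?C. e z)"
            if "\<And>k. integrable ?C (h k)" "integrable ?C e" for h :: "nat \<Rightarrow> _ \<Rightarrow> real" and e
            using that by simp
          have "(LINT z|?C. (\<Sum>k<n. w k * indicator (E \<inter> shift (int k) -` B) z) - p * indicator E z)
            = (\<Sum>k<n. w k * (LINT z|?C. indicator (E \<inter> shift (int k) -` B) z)) - p * (LINT z|?C. indicator E z)"
            using E mk by (intro linear integrable_real_indicator) (auto simp: C.emeasure_eq_measure)
          then show ?thesis
            by (simp only: Bochner_Integration.integral_indicator space_completion space_Q Int_UNIV_right)
        qed
        also have "\<dots> = q - C.prob E * p" using w1 by (simp add: Ek flip: sum_distrib_right)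
        finally show ?thesis .
      qed
      then have "\<bar>q - C.prob E * p\<bar> \<le> norm_L2 ?C (indicator E) * norm_L2 ?C g"
        using Cauchy_Schwarz_L2[OF sE sg] by simp
      also have "\<dots> \<le> 1 * sqrt e"
      proof (intro mult_mono norm_g)
        have "(LINT z|?C. (indicator E z)\<^sup>2) = C.prob E"
          using E by (subst Bochner_Integration.integral_cong[OF refl, of _ _ "indicator E"]) (auto simp: indicator_def)
        then show "norm_L2 ?C (indicator E) \<le> 1" by (simp add: norm_L2_def)
      qed auto
      finally show ?thesis by simp
    qed
    then have "\<bar>q - C.prob E * p\<bar> \<le> e" if "0 < e" for e
      using that by (metis real_sqrt_abs zero_less_power abs_of_pos)
    then have "\<bar>q - C.prob E * p\<bar> \<le> 0" by (rule field_le_epsilon[of _ 0, simplified]) auto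
    then show ?thesis using pB by (simp add: q_def B_def)
  qed
  \<comment> \<open>The cylinders form a generating \<open>\<pi>\<close>-system, so \<open>E\<close> is independent of every event, hence of itself.\<close>
  have indep_all: "C.prob (E \<inter> B) = C.prob E * C.prob B" if "B \<in> sets Q" for B
  proof -
    have G: "B \<in> sigma_sets UNIV {{z. \<forall>i\<in>F. z i} |F. finite F}"
      using that by (simp add: sets_Q sets_binary_space_generator)
    have Pow: "{{z. \<forall>i\<in>F. z i} |F::(int \<times> 'b) set. finite F} \<subseteq> Pow UNIV" by simp
    from binary_generator_Int_stable Pow G show ?thesis
    proof (induction rule: sigma_sets_induct_disjoint)
      case (basic A)
      then show ?case using indep by auto
    next
      case empty
      then show ?case by simp
    next
      case (compl A)
      then have A: "A \<in> sets ?C"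
        using sets.sigma_sets_subset[of "{{z. \<forall>i\<in>F. z i} |F. finite F}" Q] cylinder_sets by auto
      have "C.prob (E \<inter> (UNIV - A)) = C.prob E - C.prob (E \<inter> A)"
        using A E by (subst C.finite_measure_Diff'[symmetric]) (auto simp: Diff_eq Int_commute)
      also have "\<dots> = C.prob E * (1 - C.prob A)" using compl by (simp add: algebra_simps)
      also have "1 - C.prob A = C.prob (UNIV - A)" using C.prob_compl[OF A] by simp
      finally show ?case .
    next
      case (union A)
      have A: "range A \<subseteq> sets ?C"
        using union sets.sigma_sets_subset[of "{{z. \<forall>i\<in>F. z i} |F. finite F}" Q] cylinder_sets by auto
      have "(\<lambda>i. C.prob (E \<inter> A i)) sums C.prob (\<Union>i. E \<inter> A i)"
        using A E union(1) by (intro C.finite_measure_UNION) (auto simp: disjoint_family_on_def)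
      moreover have "(\<lambda>i. C.prob E * C.prob (A i)) sums (C.prob E * C.prob (\<Union>i. A i))"
        using A union(1) by (intro sums_mult C.finite_measure_UNION)
      ultimately show ?case using union(3) by (simp add: sums_unique2)
    qed
  qed
  have "C.prob (main_part Q E) = C.prob E"
    using E by (simp add: measure_def)
  moreover have "C.prob (E \<inter> main_part Q E) = C.prob (main_part Q E)"
    using main_part_null_part_Un[OF E] by (intro arg_cong[where f="C.prob"]) auto
  ultimately have "C.prob E = C.prob E * C.prob E"
    using indep_all[of "main_part Q E"] E by simp
  then have "C.prob E = 0 \<or> C.prob E = 1" by simp
  then show ?thesis by (auto simp: C.emeasure_eq_measure)
qed

end

section \<open>Decay of Gaussian characteristic functions\<close>

text \<open>
  For a normal law the modulus of the characteristic function is \<open>exp (- s\<^sup>2 t\<^sup>2 / 2)\<close>.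
  Compared with the lower bound this gives \<open>s\<^sup>2 \<le> 4 \<integral> min (F\<^sup>2) (2 / t\<^sup>2) d\<mu>\<close>, and the
  right-hand side tends to zero by dominated convergence.
\<close>

lemma normal_not_bounded_below:
  assumes "prob_space N" and s: "0 < s" and X: "distributed N lborel X (normal_density m s)"
    and F: "square_integrable \<mu> F"
    and char: "\<And>t. exp (- 2 * (LINT x|\<mu>. min (t\<^sup>2 * (F x)\<^sup>2) 2)) \<le> cmod (LINT y|N. cis (t * X y))"
  shows False
proof -
  interpret prob_space N by fact
  have [measurable]: "X \<in> borel_measurable N" using distributed_measurable[OF X] by simp
  have FM[measurable]: "F \<in> borel_measurable \<mu>" by (rule square_integrable_measurable[OF F])
  have std: "distributed N lborel (\<lambda>x. (X x - m) / s) std_normal_density"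
    using normal_standard_normal_convert[OF s, of X m] X by simp
  have cmod_char: "cmod (LINT y|N. cis (t * X y)) = exp (- (t * s)\<^sup>2 / 2)" for t
  proof -
    have D: "distr N borel (\<lambda>x. (X x - m) / s) = std_normal_distribution"
    proof -
      have "distr N borel (\<lambda>x. (X x - m) / s) = distr N lborel (\<lambda>x. (X x - m) / s)"
        by (rule distr_cong) auto
      then show ?thesis using std unfolding distributed_def by (simp only:)
    qed
    have split: "cis (t * x) = cis (t * m) * iexp (t * s * ((x - m) / s))" for x
    proof -
      have "t * x = t * m + t * s * ((x - m) / s)" using s by (simp add: field_simps)
      then show ?thesis by (simp only: cis_conv_exp[symmetric] cis_mult)
    qed
    have "(LINT y|N. cis (t * X y)) = (LINT y|N. cis (t * m) * iexp (t * s * ((X y - m) / s)))"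
      by (rule Bochner_Integration.integral_cong[OF refl split])
    also have "\<dots> = cis (t * m) * (LINT y|N. iexp (t * s * ((X y - m) / s)))"
      by (rule integral_mult_right_zero)
    also have "(LINT y|N. iexp (t * s * ((X y - m) / s))) = char (distr N borel (\<lambda>x. (X x - m) / s)) (t * s)"
      unfolding char_def by (subst integral_distr) auto
    also have "\<dots> = exp (- (t * s)\<^sup>2 / 2)" unfolding D by (simp add: char_std_normal_distribution)
    finally show ?thesis by (simp add: norm_mult)
  qed
  have int: "integrable \<mu> (\<lambda>x. min ((F x)\<^sup>2) (2 / t\<^sup>2))" for t
    by (rule Bochner_Integration.integrable_bound[OF square_integrableD[OF F]]) auto
  have bound: "s\<^sup>2 \<le> 4 * (LINT x|\<mu>. min ((F x)\<^sup>2) (2 / (real (Suc n))\<^sup>2))" for n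
  proof -
    define t where "t = real (Suc n)"
    have t: "0 < t" by (simp add: t_def)
    have "(LINT x|\<mu>. min (t\<^sup>2 * (F x)\<^sup>2) 2) = (LINT x|\<mu>. t\<^sup>2 * min ((F x)\<^sup>2) (2 / t\<^sup>2))"
      using t by (intro Bochner_Integration.integral_cong refl) (simp add: min_mult_distrib_left)
    also have "\<dots> = t\<^sup>2 * (LINT x|\<mu>. min ((F x)\<^sup>2) (2 / t\<^sup>2))" by simp
    finally have "exp (- 2 * (t\<^sup>2 * (LINT x|\<mu>. min ((F x)\<^sup>2) (2 / t\<^sup>2)))) \<le> exp (- (t * s)\<^sup>2 / 2)"
      using char[of t] cmod_char[of t] by simp
    then have "(t * s)\<^sup>2 \<le> 4 * (t\<^sup>2 * (LINT x|\<mu>. min ((F x)\<^sup>2) (2 / t\<^sup>2)))" by simp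
    then have "t\<^sup>2 * s\<^sup>2 \<le> t\<^sup>2 * (4 * (LINT x|\<mu>. min ((F x)\<^sup>2) (2 / t\<^sup>2)))"
      by (simp only: power_mult_distrib mult.left_commute)
    then show ?thesis using t unfolding t_def[symmetric] by (simp only: mult_le_cancel_left_pos zero_less_power)
  qed
  have lim: "(\<lambda>n. 4 * (LINT x|\<mu>. min ((F x)\<^sup>2) (2 / (real (Suc n))\<^sup>2))) \<longlonglongrightarrow> 4 * (LINT x|\<mu>. 0)"
  proof (intro tendsto_mult tendsto_const integral_dominated_convergence[where w="\<lambda>x. (F x)\<^sup>2"])
    show "AE x in \<mu>. (\<lambda>n. min ((F x)\<^sup>2) (2 / (real (Suc n))\<^sup>2)) \<longlonglongrightarrow> 0"
    proof (rule AE_I2)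
      fix x
      have "(\<lambda>n. 2 * (1 / real (Suc n))\<^sup>2) \<longlonglongrightarrow> 2 * 0\<^sup>2"
        by (intro tendsto_intros LIMSEQ_Suc[OF lim_1_over_n])
      then have "(\<lambda>n. 2 / (real (Suc n))\<^sup>2) \<longlonglongrightarrow> 0" by (simp add: power_divide)
      from tendsto_min[OF tendsto_const this, of "(F x)\<^sup>2"] show "(\<lambda>n. min ((F x)\<^sup>2) (2 / (real (Suc n))\<^sup>2)) \<longlonglongrightarrow> 0"
        by (simp only: min_absorb2 zero_le_power2)
    qed
  qed (use square_integrableD[OF F] in auto)
  have "s\<^sup>2 \<le> 4 * (LINT x|\<mu>. 0)"
    by (rule LIMSEQ_le_const[OF lim]) (use bound in blast)
  then show False using s by simp
qed

section \<open>Iterates, Lebesgue spaces and symmetric measures\<close>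

lemma int_iterate_0 [simp]: "int_iterate M T 0 x = x"
  by (simp add: int_iterate_def)

lemma int_iterate_add:
  assumes bij: "bij_betw T (space M) (space M)" and x: "x \<in> space M"
  shows "int_iterate M T (j + k) x = int_iterate M T j (int_iterate M T k x)"
proof -
  let ?S = "inv_into (space M) T"
  have inv: "?S (T x) = x" "T (?S x) = x" "T x \<in> space M" "?S x \<in> space M" if "x \<in> space M" for x
    using that bij bij_betw_inv_into_left[OF bij] bij_betw_inv_into_right[OF bij]
      bij_betw_apply[OF bij] bij_betw_apply[OF bij_betw_inv_into[OF bij]] by auto
  have fwd: "int_iterate M T (j + 1) x = int_iterate M T j (T x)" if "x \<in> space M" for j x
  proof (cases "j \<ge> 0")
    case True
    then have "nat (j + 1) = Suc (nat j)" by simp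
    then show ?thesis using True by (simp add: int_iterate_def funpow_swap1)
  next
    case False
    then have n: "nat (- j) = Suc (nat (- (j + 1)))" by simp
    have "int_iterate M T j (T x) = (?S ^^ nat (- (j + 1))) (?S (T x))"
      using False by (simp only: int_iterate_def n funpow_Suc_right comp_apply if_False)
    also have "\<dots> = (?S ^^ nat (- (j + 1))) x" using inv that by simp
    also have "\<dots> = int_iterate M T (j + 1) x"
      using False by (cases "j = -1") (auto simp: int_iterate_def)
    finally show ?thesis by simp
  qed
  have bwd: "int_iterate M T (j - 1) x = int_iterate M T j (?S x)" if "x \<in> space M" for j x
    using fwd[of "?S x" "j - 1"] inv[OF that] by simp
  show ?thesis using x
  proof (induction k arbitrary: x rule: int_induct[where k=0])
    case base
    then show ?case by simp
  next
    case (step1 k)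
    have "int_iterate M T (j + (k + 1)) x = int_iterate M T (j + k) (T x)"
      using fwd[OF step1(3), of "j + k"] by (simp add: add.assoc)
    also have "\<dots> = int_iterate M T j (int_iterate M T k (T x))"
      using step1(2)[of "T x"] inv(3)[OF step1(3)] by simp
    also have "int_iterate M T k (T x) = int_iterate M T (k + 1) x"
      using fwd[OF step1(3), of k] by simp
    finally show ?case .
  next
    case (step2 k)
    have "int_iterate M T (j + (k - 1)) x = int_iterate M T (j + k) (?S x)"
      using bwd[OF step2(3), of "j + k"] by (simp add: algebra_simps)
    also have "\<dots> = int_iterate M T j (int_iterate M T k (?S x))"
      using step2(2)[of "?S x"] inv(4)[OF step2(3)] by simp
    also have "int_iterate M T k (?S x) = int_iterate M T (k - 1) x"
      using bwd[OF step2(3), of k] by simp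
    finally show ?case .
  qed
qed

lemma int_iterate_preserving:
  assumes T: "measure_isomorphism T M M"
  shows "int_iterate M T k \<in> measurable M M" "distr M M (int_iterate M T k) = M"
proof -
  let ?S = "inv_into (space M) T"
  have T': "T \<in> measurable M M" "distr M M T = M" "?S \<in> measurable M M" "bij_betw T (space M) (space M)"
    using T by (auto simp: measure_isomorphism_def)
  have "distr M M ?S = distr (distr M M T) M ?S" by (simp add: T')
  also have "\<dots> = distr M M (?S \<circ> T)" by (rule distr_distr) (use T' in auto)
  also have "\<dots> = distr M M (\<lambda>x. x)"
    by (rule distr_cong) (use bij_betw_inv_into_left[OF T'(4)] in auto)
  finally have S: "distr M M ?S = M" by (simp add: distr_id2)
  show "int_iterate M T k \<in> measurable M M" "distr M M (int_iterate M T k) = M"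
    using funpow_measure_preserving[OF T'(1,2)] funpow_measure_preserving[OF T'(3) S]
    by (auto simp: int_iterate_def)
qed

text \<open>
  A cover of the line by sets of finite measure is pulled back along the isomorphism and
  completed by the null set on which the isomorphism is not defined.
\<close>

lemma sigma_finite_lebesgue_space:
  assumes "lebesgue_space M" shows "sigma_finite_measure M"
proof -
  obtain N :: "real measure" and Z Z' \<phi> where N: "sigma_finite_measure N"
    and Z: "Z \<in> null_sets M" "Z' \<in> null_sets (completion N)"
    and iso: "measure_isomorphism \<phi> (restrict_space M (space M - Z)) (restrict_space (completion N) (space (completion N) - Z'))"
    using assms unfolding lebesgue_space_def isomorphic_mod_0_def by auto
  let ?M = "restrict_space M (space M - Z)" and ?N = "restrict_space (completion N) (space (completion N) - Z')"
  interpret N: sigma_finite_measure N by fact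
  have \<phi>: "\<phi> \<in> measurable ?M ?N" "distr ?M ?N \<phi> = ?N"
    using iso by (auto simp: measure_isomorphism_def)
  have sM: "space M - Z \<in> sets M" and sN: "space (completion N) - Z' \<in> sets (completion N)"
    using Z by (auto intro: sets.compl_sets)
  obtain A :: "nat \<Rightarrow> real set" where A: "range A \<subseteq> sets N" "(\<Union>i. A i) = space N" "\<And>i. emeasure N (A i) \<noteq> \<infinity>"
    by (rule N.sigma_finite) blast
  define B where "B i = \<phi> -` (A i \<inter> space ?N) \<inter> space ?M" for i
  have AN: "A i \<inter> space ?N \<in> sets ?N" for i
  proof -
    have "A i \<in> sets (completion N)" using A(1) by auto
    then show ?thesis using sN by (auto simp: sets_restrict_space space_restrict_space)
  qed
  have B: "B i \<in> sets ?M" for i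
    unfolding B_def by (rule measurable_sets[OF \<phi>(1) AN])
  then have BM: "B i \<in> sets M" for i
    using sM by (simp add: sets_restrict_space_iff)
  have B_fin: "emeasure M (B i) \<noteq> \<infinity>" for i
  proof -
    have "emeasure M (B i) = emeasure ?M (B i)"
      using sM B[of i] sets.sets_into_space[OF B, of i] by (subst emeasure_restrict_space) (auto simp: space_restrict_space)
    also have "\<dots> = emeasure (distr ?M ?N \<phi>) (A i \<inter> space ?N)"
      unfolding B_def by (rule emeasure_distr[OF \<phi>(1) AN, symmetric])
    also have "\<dots> = emeasure ?N (A i \<inter> space ?N)" by (simp only: \<phi>(2))
    also have "\<dots> = emeasure (completion N) (A i \<inter> space ?N)"
      using sN by (intro emeasure_restrict_space) (auto simp: space_restrict_space)
    also have "\<dots> \<le> emeasure (completion N) (A i)"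
      using A(1) by (intro emeasure_mono) auto
    also have "\<dots> = emeasure N (A i)" using A(1) by (intro emeasure_completion[THEN trans]) auto
    finally show ?thesis using A(3)[of i] by (auto simp: top_unique)
  qed
  have cover: "(\<Union>i. B i) = space M - Z"
  proof -
    have "x \<in> (\<Union>i. B i)" if x: "x \<in> space M - Z" for x
    proof -
      have x': "x \<in> space ?M" using x by (auto simp: space_restrict_space)
      then have "\<phi> x \<in> space ?N" by (rule measurable_space[OF \<phi>(1)])
      then have "\<phi> x \<in> space N" by (auto simp: space_restrict_space)
      then obtain i where "\<phi> x \<in> A i" using A(2) by blast
      then show ?thesis using x' \<open>\<phi> x \<in> space ?N\<close> by (auto simp: B_def)
    qed
    then show ?thesis by (auto simp: B_def space_restrict_space)
  qed
  show ?thesis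
  proof
    show "\<exists>A. countable A \<and> A \<subseteq> sets M \<and> \<Union> A = space M \<and> (\<forall>a\<in>A. emeasure M a \<noteq> \<infinity>)"
    proof (intro exI[of _ "insert Z (range B)"] conjI)
      show "\<Union> (insert Z (range B)) = space M"
        using cover Z(1) sets.sets_into_space[of Z M] by auto
      show "\<forall>a\<in>insert Z (range B). emeasure M a \<noteq> \<infinity>" using B_fin Z(1) by auto
    qed (use BM Z(1) in auto)
  qed
qed

text \<open>
  Reflection turns \<open>cis (k t)\<close> into its conjugate. At the point \<open>- pi\<close>, which is its own
  reflection, the value \<open>cis (- k pi)\<close> is real.
\<close>

lemma fourier_coefficient_real:
  assumes "circle_measure \<sigma>" "symmetric_measure \<sigma>"
  shows "cnj (fourier_coefficient \<sigma> k) = fourier_coefficient \<sigma> k"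
proof -
  have sets: "sets \<sigma> = sets (restrict_space borel {-pi..<pi})" using assms(1) by (simp add: circle_measure_def)
  then have sp: "space \<sigma> = {-pi..<pi}"
    using sets_eq_imp_space_eq[OF sets] by (simp add: space_restrict_space)
  have meas: "measurable \<sigma> borel = measurable (restrict_space borel {-pi..<pi}) borel"
    using sets by (rule measurable_cong_sets) simp
  have co: "circle_opposite \<in> measurable \<sigma> \<sigma>"
  proof -
    have "circle_opposite \<in> measurable (restrict_space borel {-pi..<pi}) (restrict_space borel {-pi..<pi})"
    proof (rule measurable_restrict_space3)
      show "circle_opposite \<in> borel_measurable borel" unfolding circle_opposite_def[abs_def] by measurable
      show "circle_opposite \<in> {-pi..<pi} \<rightarrow> {-pi..<pi}" by (auto simp: circle_opposite_def)
    qed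
    then show ?thesis using measurable_cong_sets[OF sets sets] by simp
  qed
  have e: "(\<lambda>t. cis (of_int k * t)) \<in> borel_measurable \<sigma>"
    unfolding meas by (rule measurable_restrict_space1) (simp add: cis_conv_exp)
  have "fourier_coefficient \<sigma> k = (LINT t|distr \<sigma> \<sigma> circle_opposite. cis (of_int k * t))"
    using assms(2) by (simp add: fourier_coefficient_def symmetric_measure_def)
  also have "\<dots> = (LINT t|\<sigma>. cis (of_int k * circle_opposite t))"
    by (rule integral_distr[OF co e])
  also have "\<dots> = (LINT t|\<sigma>. cnj (cis (of_int k * t)))"
  proof (rule Bochner_Integration.integral_cong)
    fix t
    show "cis (of_int k * circle_opposite t) = cnj (cis (of_int k * t))"
    proof (cases "t = -pi")
      case True
      have "sin (of_int k * pi) = 0" by (metis mult.commute sin_npi_int)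
      then show ?thesis using True by (simp add: circle_opposite_def complex_eq_iff)
    qed (simp add: circle_opposite_def cis_cnj)
  qed simp
  also have "\<dots> = cnj (fourier_coefficient \<sigma> k)" by (simp add: fourier_coefficient_def)
  finally show ?thesis by simp
qed

section \<open>The marked system and its cells\<close>

text \<open>
  Rounding \<open>2\<^sup>n v\<close> towards zero keeps \<open>quant n v / 2\<^sup>n\<close> below \<open>v\<close> in absolute value, as
  domination requires, and gives the value zero outside a set of finite measure.
\<close>

definition quant :: "nat \<Rightarrow> real \<Rightarrow> int" where
  "quant n v = (if 0 \<le> v then \<lfloor>2 ^ n * v\<rfloor> else \<lceil>2 ^ n * v\<rceil>)"

lemma quant_bound: "\<bar>real_of_int (quant n v)\<bar> \<le> 2 ^ n * \<bar>v\<bar>"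
proof (cases "0 \<le> v")
  case True
  then have "0 \<le> \<lfloor>2 ^ n * v\<rfloor>" by simp
  then show ?thesis using True of_int_floor_le[of "2 ^ n * v"] by (simp add: quant_def)
next
  case False
  then have "2 ^ n * v \<le> 0" by (simp add: mult_nonneg_nonpos)
  then have "\<lceil>2 ^ n * v\<rceil> \<le> 0" by simp
  then show ?thesis using False le_of_int_ceiling[of "2 ^ n * v"] by (simp add: quant_def)
qed

lemma quant_error: "\<bar>real_of_int (quant n v) / 2 ^ n - v\<bar> \<le> 1 / 2 ^ n"
proof -
  have "\<bar>real_of_int (quant n v) - 2 ^ n * v\<bar> \<le> 1"
    unfolding quant_def by (auto simp: abs_le_iff) linarith+
  then have "\<bar>(real_of_int (quant n v) - 2 ^ n * v) / 2 ^ n\<bar> \<le> 1 / 2 ^ n"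
    by (simp add: divide_right_mono)
  then show ?thesis by (simp add: diff_divide_distrib)
qed

lemma quant_nonzero: "quant n v \<noteq> 0 \<Longrightarrow> 1 / 2 ^ n \<le> \<bar>v\<bar>"
proof -
  assume "quant n v \<noteq> 0"
  then have "1 \<le> \<bar>real_of_int (quant n v)\<bar>" by linarith
  then have "1 \<le> 2 ^ n * \<bar>v\<bar>" using quant_bound[of n v] by linarith
  then show ?thesis by (simp add: field_simps)
qed

lemma quant_measurable [measurable]: "quant n \<in> measurable borel (count_space UNIV)"
  unfolding quant_def[abs_def] by measurable

lemma quant_tendsto: "(\<lambda>n. if \<bar>quant n v\<bar> \<le> 4 ^ n then real_of_int (quant n v) / 2 ^ n else 0) \<longlonglongrightarrow> v"
proof -
  have "(\<lambda>n. (1/2::real) ^ n) \<longlonglongrightarrow> 0" by (intro LIMSEQ_power_zero) simp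
  then have z: "(\<lambda>n. 1 / 2 ^ n :: real) \<longlonglongrightarrow> 0" by (simp add: power_divide)
  have "(\<lambda>n. real_of_int (quant n v) / 2 ^ n - v) \<longlonglongrightarrow> 0"
    by (rule Lim_null_comparison[OF _ z]) (use quant_error in simp)
  then have "(\<lambda>n. real_of_int (quant n v) / 2 ^ n) \<longlonglongrightarrow> v" by (rule LIM_zero_cancel)
  then show ?thesis
  proof (rule Lim_transform_eventually)
    obtain N where N: "\<bar>v\<bar> < real N" using reals_Archimedean2 by blast
    show "\<forall>\<^sub>F n in sequentially. real_of_int (quant n v) / 2 ^ n =
        (if \<bar>quant n v\<bar> \<le> 4 ^ n then real_of_int (quant n v) / 2 ^ n else 0)"
    proof (rule eventually_sequentiallyI[of N])
      fix n assume "N \<le> n"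
      then have "\<bar>v\<bar> \<le> real n" using N by simp
      also have "real n \<le> 2 ^ n" using of_nat_less_two_power[of n, where 'a=real] by simp
      finally have "2 ^ n * \<bar>v\<bar> \<le> 2 ^ n * 2 ^ n" by simp
      then have "\<bar>real_of_int (quant n v)\<bar> \<le> 4 ^ n"
        using quant_bound[of n v] by (simp flip: power_mult_distrib)
      then have "real_of_int \<bar>quant n v\<bar> \<le> real_of_int (4 ^ n)" by simp
      then have "\<bar>quant n v\<bar> \<le> 4 ^ n" by (simp only: of_int_le_iff)
      then show "real_of_int (quant n v) / 2 ^ n =
        (if \<bar>quant n v\<bar> \<le> 4 ^ n then real_of_int (quant n v) / 2 ^ n else 0)" by simp
    qed
  qed
qed

lemma (in sigma_finite_measure) integral_times_mark:
  fixes g :: "'a \<Rightarrow> real" and J :: "real set"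
  assumes g: "integrable M g" and J: "J \<in> sets borel" "emeasure lborel J < \<infinity>"
  shows "integrable (M \<Otimes>\<^sub>M lborel) (\<lambda>p. g (fst p) * indicator J (snd p))"
    and "(LINT p|(M \<Otimes>\<^sub>M lborel). g (fst p) * indicator J (snd p)) = (LINT x|M. g x) * measure lborel J"
proof -
  interpret pair_sigma_finite M lborel
    by (intro pair_sigma_finite.intro sigma_finite_measure_axioms lborel.sigma_finite_measure_axioms)
  have [measurable]: "g \<in> borel_measurable M" using g by simp
  note [measurable] = J(1)
  have iJ: "integrable lborel (indicator J :: real \<Rightarrow> real)" using J by simp
  show int: "integrable (M \<Otimes>\<^sub>M lborel) (\<lambda>p. g (fst p) * indicator J (snd p))"
  proof (rule Fubini_integrable)
    have "(\<lambda>x. LINT y|lborel. norm (g (fst (x, y)) * indicator J (snd (x, y)))) = (\<lambda>x. \<bar>g x\<bar> * measure lborel J)"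
      by (simp add: abs_mult)
    then show "integrable M (\<lambda>x. LINT y|lborel. norm (g (fst (x, y)) * indicator J (snd (x, y))))"
      using g by simp
    show "AE x in M. integrable lborel (\<lambda>y. g (fst (x, y)) * indicator J (snd (x, y)))"
      using iJ by simp
  qed measurable
  show "(LINT p|(M \<Otimes>\<^sub>M lborel). g (fst p) * indicator J (snd p)) = (LINT x|M. g x) * measure lborel J"
    by (subst integral_fst'[OF int, symmetric]) simp
qed

text \<open>
  \<open>U\<close> is the family of the integer powers of a transformation. The last assumption is the
  form in which the absence of an invariant probability measure is used.
\<close>

locale L2_flow = sigma_finite_measure M for M :: "'a measure" +
  fixes U :: "int \<Rightarrow> 'a \<Rightarrow> 'a" and f :: "'a \<Rightarrow> complex"
  assumes U_measurable [measurable]: "\<And>k. U k \<in> measurable M M"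
    and U_preserves: "\<And>k. distr M M (U k) = M"
    and U_add: "\<And>j k x. x \<in> space M \<Longrightarrow> U (j + k) x = U j (U k x)"
    and U_0: "\<And>x. U 0 x = x"
    and f_L2: "f \<in> L2 M"
    and vanishing: "\<And>B e. B \<in> sets M \<Longrightarrow> emeasure M B < \<infinity> \<Longrightarrow> 0 < e \<Longrightarrow> \<exists>n w. convex_weights n w \<and>
      (\<Sum>j<n. \<Sum>k<n. w j * w k * measure M {x \<in> space M. U (int j) x \<in> B \<and> U (int k) x \<in> B}) < e"
begin

definition marked :: "('a \<times> real) measure" where "marked = M \<Otimes>\<^sub>M lborel"
definition marked_flow :: "int \<Rightarrow> 'a \<times> real \<Rightarrow> 'a \<times> real" where "marked_flow k p = (U k (fst p), snd p)"

text \<open>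
  The real and the imaginary part of \<open>f\<close> are placed over disjoint unit intervals of marks.
  Their inner products then add up to the real part of the complex inner product.
\<close>

definition signal :: "int \<Rightarrow> 'a \<times> real \<Rightarrow> real" where
  "signal k p = Re (f (U k (fst p))) * indicator {0..<1} (snd p) + Im (f (U k (fst p))) * indicator {1..<2} (snd p)"

text \<open>
  Over the marks in an interval of length \<open>1 / 8\<^sup>n\<close>, a cell collects the points where the
  \<open>n\<close>-th approximation of the \<open>k\<close>-th translate of \<open>signal\<close> takes a given nonzero value
  \<open>m / 2\<^sup>n\<close>. That approximation is nonzero only where the translate of \<open>f\<close> has modulus at
  least \<open>1 / 2\<^sup>n\<close>, a set of measure at most \<open>4\<^sup>n \<parallel>f\<parallel>\<^sup>2\<close>. The intervals are taken shorter
  than \<open>1 / 4\<^sup>n\<close> in order that the cells become small.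
\<close>

definition cell :: "int \<times> (nat \<times> int \<times> int) \<Rightarrow> ('a \<times> real) set" where
  "cell = (\<lambda>(k, n, m, i). {p \<in> space marked. m \<noteq> 0 \<and> quant n (signal k p) = m \<and> \<lfloor>8 ^ n * snd p\<rfloor> = i})"
definition labels :: "nat \<Rightarrow> (nat \<times> int \<times> int) set" where
  "labels n = {n} \<times> ({- (4 ^ n)..4 ^ n} - {0}) \<times> {0..<2 * 8 ^ n}"
definition cell_value :: "nat \<times> int \<times> int \<Rightarrow> real" where
  "cell_value = (\<lambda>(n, m, i). real_of_int m / 2 ^ n)"
definition sq_norm :: real where "sq_norm = (LINT x|M. (norm (f x))\<^sup>2)"
definition level_set :: "nat \<Rightarrow> 'a set" where "level_set n = {x \<in> space M. 1 / 2 ^ n \<le> norm (f x)}"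

lemma f_measurable [measurable]: "f \<in> borel_measurable M"
  and f_integrable: "integrable M (\<lambda>x. (norm (f x))\<^sup>2)"
  using f_L2 by (auto simp: L2_def)

lemma space_marked: "p \<in> space marked \<longleftrightarrow> fst p \<in> space M"
  by (cases p) (simp add: marked_def space_pair_measure)

lemma marked_flow_measurable [measurable]: "marked_flow k \<in> measurable marked marked"
  unfolding marked_flow_def[abs_def] marked_def by measurable

lemma marked_flow_preserves: "distr marked marked (marked_flow k) = marked"
proof -
  have "distr marked marked (marked_flow k) = distr (M \<Otimes>\<^sub>M lborel) (M \<Otimes>\<^sub>M lborel) (\<lambda>(x, u). (U k x, u))"
    unfolding marked_def by (rule distr_cong) (auto simp: marked_flow_def)
  also have "\<dots> = distr M M (U k) \<Otimes>\<^sub>M distr lborel lborel (\<lambda>u. u)"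
    by (rule pair_measure_distr[symmetric]) (auto simp: distr_id2 lborel.sigma_finite_measure_axioms)
  also have "\<dots> = marked" by (simp add: marked_def U_preserves distr_id2)
  finally show ?thesis .
qed

lemma signal_measurable [measurable]: "signal k \<in> borel_measurable marked"
  unfolding signal_def[abs_def] marked_def by measurable

lemma F_V: "p \<in> space marked \<Longrightarrow> signal l (marked_flow k p) = signal (l + k) p"
  by (simp add: signal_def marked_flow_def U_add space_marked)

lemma signal_nonzero: assumes "signal k p \<noteq> 0" shows "0 \<le> snd p" "snd p < 2" "\<bar>signal k p\<bar> \<le> norm (f (U k (fst p)))"
  using assms abs_Re_le_cmod[of "f (U k (fst p))"] abs_Im_le_cmod[of "f (U k (fst p))"]
  by (auto simp: signal_def indicator_def of_bool_def split: if_splits)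

lemma cell_sets [measurable]: "cell i \<in> sets marked"
proof -
  obtain k n m j where i: "i = (k, n, m, j)" by (cases i)
  have [measurable]: "snd \<in> borel_measurable marked" unfolding marked_def by measurable
  have [measurable]: "Measurable.pred marked (\<lambda>p. quant n (signal k p) = m)"
    by (rule measurable_compose[of "\<lambda>p. quant n (signal k p)" _ "count_space UNIV"]) auto
  have [measurable]: "Measurable.pred marked (\<lambda>p. \<lfloor>8 ^ n * snd p\<rfloor> = j)"
    by (rule measurable_compose[of "\<lambda>p. \<lfloor>8 ^ n * snd p\<rfloor>" _ "count_space UNIV"]) auto
  show ?thesis unfolding i cell_def by simp
qed

lemma cell_shift: "cell (l + k, b) = marked_flow k -` cell (l, b) \<inter> space marked"
  using F_V measurable_space[OF marked_flow_measurable, of _ k]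
  by (cases b) (auto simp: cell_def, auto simp: marked_flow_def)

lemma level_set_sets [measurable]: "level_set n \<in> sets M"
  unfolding level_set_def by measurable

lemma emeasure_level_set: "emeasure M (level_set n) \<le> ennreal (4 ^ n * sq_norm)"
proof -
  have "emeasure M (level_set n) = (\<integral>\<^sup>+x. indicator (level_set n) x \<partial>M)" by simp
  also have "\<dots> \<le> (\<integral>\<^sup>+x. ennreal (4 ^ n * (norm (f x))\<^sup>2) \<partial>M)"
  proof (rule nn_integral_mono)
    fix x
    have "1 \<le> 4 ^ n * (norm (f x))\<^sup>2" if "x \<in> level_set n"
    proof -
      have "1 \<le> 2 ^ n * norm (f x)" using that by (simp add: level_set_def field_simps)
      then have "1\<^sup>2 \<le> (2 ^ n * norm (f x))\<^sup>2" by (intro power_mono) auto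
      also have "\<dots> = (2 ^ n)\<^sup>2 * (norm (f x))\<^sup>2" by (rule power_mult_distrib)
      also have "((2::real) ^ n)\<^sup>2 = 4 ^ n" by (simp add: power2_eq_square flip: power_mult_distrib)
      finally show ?thesis by simp
    qed
    then show "indicator (level_set n) x \<le> ennreal (4 ^ n * (norm (f x))\<^sup>2)"
      by (auto simp: indicator_def)
  qed
  also have "\<dots> = ennreal (LINT x|M. 4 ^ n * (norm (f x))\<^sup>2)"
    by (rule nn_integral_eq_integral) (use f_integrable in auto)
  finally show ?thesis by (simp add: sq_norm_def)
qed

lemma sq_norm_nonneg: "0 \<le> sq_norm" by (simp add: sq_norm_def)

lemma cell_memD:
  assumes "p \<in> cell (k, n, m, i)"
  shows "fst p \<in> space M" "U k (fst p) \<in> level_set n" "0 \<le> snd p" "snd p < 2" "\<lfloor>8 ^ n * snd p\<rfloor> = i"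
proof -
  have p: "p \<in> space marked" "quant n (signal k p) \<noteq> 0" "\<lfloor>8 ^ n * snd p\<rfloor> = i" using assms by (auto simp: cell_def)
  show sp: "fst p \<in> space M" using p by (simp add: space_marked)
  have ge: "1 / 2 ^ n \<le> \<bar>signal k p\<bar>" by (rule quant_nonzero[OF p(2)])
  then have "signal k p \<noteq> 0" by (auto simp: divide_simps)
  note signal_nonzero[OF this]
  then show "0 \<le> snd p" "snd p < 2" "U k (fst p) \<in> level_set n"
    using ge measurable_space[OF U_measurable sp] by (auto simp: level_set_def)
qed (use assms in \<open>auto simp: cell_def\<close>)

text \<open>
  All translates of a cell have the same measure, and for \<open>k = 0\<close> the cell lies in the
  product of \<open>level_set n\<close> with an interval of length \<open>1 / 8\<^sup>n\<close>.
\<close>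

lemma emeasure_cell: "emeasure marked (cell (k, n, m, i)) \<le> ennreal (sq_norm / 2 ^ n)"
proof -
  let ?J = "{real_of_int i / 8 ^ n..<(real_of_int i + 1) / 8 ^ n}"
  have "emeasure marked (cell (k, n, m, i)) = emeasure (distr marked marked (marked_flow k)) (cell (0, n, m, i))"
    using cell_shift[of 0 k "(n, m, i)"] by (simp add: emeasure_distr)
  also have "\<dots> = emeasure marked (cell (0, n, m, i))" by (simp only: marked_flow_preserves)
  also have "\<dots> \<le> emeasure marked (level_set n \<times> ?J)"
  proof (rule emeasure_mono)
    show "cell (0, n, m, i) \<subseteq> level_set n \<times> ?J"
    proof
      fix p assume p: "p \<in> cell (0, n, m, i)"
      have "real_of_int i \<le> 8 ^ n * snd p" "8 ^ n * snd p < real_of_int i + 1"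
        using cell_memD(5)[OF p] by linarith+
      then have "snd p \<in> ?J" by (simp add: field_simps)
      moreover have "fst p \<in> level_set n" using cell_memD(2)[OF p] by (simp add: U_0)
      ultimately show "p \<in> level_set n \<times> ?J" by (simp add: mem_Times_iff)
    qed
    show "level_set n \<times> ?J \<in> sets marked" unfolding marked_def by (rule pair_measureI) auto
  qed
  also have "\<dots> = emeasure M (level_set n) * emeasure lborel ?J"
    unfolding marked_def by (rule lborel.emeasure_pair_measure_Times) auto
  also have "emeasure lborel ?J = ennreal (1 / 8 ^ n)"
    by (subst emeasure_lborel_Ico) (auto simp: divide_right_mono diff_divide_distrib[symmetric])
  also have "emeasure M (level_set n) * ennreal (1 / 8 ^ n) \<le> ennreal (4 ^ n * sq_norm) * ennreal (1 / 8 ^ n)"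
    by (intro mult_right_mono emeasure_level_set) auto
  also have "\<dots> = ennreal (4 ^ n * sq_norm * (1 / 8 ^ n))"
    by (rule ennreal_mult[symmetric]) (use sq_norm_nonneg in auto)
  also have "4 ^ n * sq_norm * (1 / 8 ^ n) = sq_norm / 2 ^ n"
  proof -
    have "(8::real) ^ n = 4 ^ n * 2 ^ n" by (simp flip: power_mult_distrib)
    then show ?thesis by simp
  qed
  finally show ?thesis .
qed

lemma cell_fmeasurable: "cell i \<in> fmeasurable marked"
proof -
  obtain k n m j where i: "i = (k, n, m, j)" by (cases i)
  show ?thesis using emeasure_cell[of k n m j]
    unfolding i by (intro fmeasurableI) (auto intro: le_less_trans)
qed

lemma measure_cell: "measure marked (cell (k, n, m, i)) \<le> sq_norm / 2 ^ n"
  unfolding measure_def using emeasure_cell sq_norm_nonneg by (intro enn2real_leI) auto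

lemma measure_shift_cell:
  assumes "finite I"
  shows "measure marked (\<Union>i\<in>I. cell (fst i + k, snd i)) = measure marked (\<Union>i\<in>I. cell i)"
proof -
  have "(\<Union>i\<in>I. cell (fst i + k, snd i)) = marked_flow k -` (\<Union>i\<in>I. cell i) \<inter> space marked"
    by (auto simp: cell_shift)
  then have "measure marked (\<Union>i\<in>I. cell (fst i + k, snd i)) = measure (distr marked marked (marked_flow k)) (\<Union>i\<in>I. cell i)"
    using assms by (simp add: measure_distr)
  then show ?thesis by (simp only: marked_flow_preserves)
qed

lemma integrable_f_products:
  "integrable M (\<lambda>x. Re (f (U k x)) * Re (f x))" "integrable M (\<lambda>x. Im (f (U k x)) * Im (f x))"
  "integrable M (\<lambda>x. f (U k x) * cnj (f x))"
  "(LINT x|M. Re (f (U k x)) * Re (f x)) + (LINT x|M. Im (f (U k x)) * Im (f x)) = Re (LINT x|M. f (U k x) * cnj (f x))"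
proof -
  have dom: "integrable M (\<lambda>x. (norm (f (U k x)))\<^sup>2 + (norm (f x))\<^sup>2)"
    by (intro Bochner_Integration.integrable_add f_integrable
        integrable_comp_measure_preserving[OF U_measurable U_preserves f_integrable])
  have le: "norm z * norm w \<le> (norm z)\<^sup>2 + (norm w)\<^sup>2" for z w :: complex
    using sum_squares_bound[of "norm z" "norm w"] mult_nonneg_nonneg[OF norm_ge_zero[of z] norm_ge_zero[of w]]
    by linarith
  have [measurable]: "(\<lambda>x. cnj (f x)) \<in> borel_measurable M"
    by (rule borel_measurable_continuous_on[OF _ f_measurable]) (intro continuous_intros)
  show 3: "integrable M (\<lambda>x. f (U k x) * cnj (f x))"
    by (rule Bochner_Integration.integrable_bound[OF dom]) (use le in \<open>auto simp: norm_mult\<close>)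
  show 1: "integrable M (\<lambda>x. Re (f (U k x)) * Re (f x))"
    by (rule Bochner_Integration.integrable_bound[OF dom])
       (auto simp: abs_mult intro!: order_trans[OF mult_mono[OF abs_Re_le_cmod abs_Re_le_cmod] le])
  show 2: "integrable M (\<lambda>x. Im (f (U k x)) * Im (f x))"
    by (rule Bochner_Integration.integrable_bound[OF dom])
       (auto simp: abs_mult intro!: order_trans[OF mult_mono[OF abs_Im_le_cmod abs_Im_le_cmod] le])
  have "Re (LINT x|M. f (U k x) * cnj (f x)) = (LINT x|M. Re (f (U k x) * cnj (f x)))"
    by (rule integral_Re[OF 3, symmetric])
  also have "\<dots> = (LINT x|M. Re (f (U k x)) * Re (f x) + Im (f (U k x)) * Im (f x))" by simp
  finally show "(LINT x|M. Re (f (U k x)) * Re (f x)) + (LINT x|M. Im (f (U k x)) * Im (f x)) = Re (LINT x|M. f (U k x) * cnj (f x))"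
    using 1 2 by simp
qed

lemma signal_signal_integral:
  "integrable marked (\<lambda>p. signal k p * signal 0 p)" "(LINT p|marked. signal k p * signal 0 p) = Re (LINT x|M. f (U k x) * cnj (f x))"
proof -
  have eq: "(\<lambda>p. signal k p * signal 0 p) = (\<lambda>p. (Re (f (U k (fst p))) * Re (f (fst p))) * indicator {0..<1} (snd p)
      + (Im (f (U k (fst p))) * Im (f (fst p))) * indicator {1..<2} (snd p))"
    by (auto simp: signal_def U_0 indicator_def)
  have J: "emeasure lborel {0..<1::real} < \<infinity>" "emeasure lborel {1..<2::real} < \<infinity>" by auto
  note re = integral_times_mark[OF integrable_f_products(1)[of k] _ J(1)]
    and im = integral_times_mark[OF integrable_f_products(2)[of k] _ J(2)]
  show "integrable marked (\<lambda>p. signal k p * signal 0 p)"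
    unfolding eq marked_def by (intro Bochner_Integration.integrable_add re(1) im(1)) auto
  have "(LINT p|marked. signal k p * signal 0 p) = (LINT x|M. Re (f (U k x)) * Re (f x)) + (LINT x|M. Im (f (U k x)) * Im (f x))"
    unfolding eq marked_def
    by (subst Bochner_Integration.integral_add) (use re im in \<open>auto\<close>)
  then show "(LINT p|marked. signal k p * signal 0 p) = Re (LINT x|M. f (U k x) * cnj (f x))"
    by (simp only: integrable_f_products(4))
qed

lemma square_integrable_signal: "square_integrable marked (signal k)"
proof -
  have 0: "integrable marked (\<lambda>p. (signal 0 p)\<^sup>2)" using signal_signal_integral(1)[of 0] by (simp add: power2_eq_square)
  have "integrable marked (\<lambda>p. (signal 0 (marked_flow k p))\<^sup>2)"
    by (rule integrable_comp_measure_preserving[OF marked_flow_measurable marked_flow_preserves 0])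
  then have "integrable marked (\<lambda>p. (signal k p)\<^sup>2)"
    by (rule Bochner_Integration.integrable_cong[THEN iffD1, rotated 2]) (simp_all add: F_V)
  then show ?thesis by (simp add: square_integrable_def)
qed

lemma step_quant:
  assumes p: "p \<in> space marked"
  shows "(\<Sum>i\<in>Pair k ` labels n. cell_value (snd i) * indicator (cell i) p)
    = (if \<bar>quant n (signal k p)\<bar> \<le> 4 ^ n then real_of_int (quant n (signal k p)) / 2 ^ n else 0)"
proof -
  let ?q = "quant n (signal k p)" and ?i = "\<lfloor>8 ^ n * snd p\<rfloor>"
  have "(\<Sum>i\<in>Pair k ` labels n. cell_value (snd i) * indicator (cell i) p) = (\<Sum>b\<in>labels n. cell_value b * indicator (cell (k, b)) p)"
    by (subst sum.reindex) (auto simp: inj_on_def)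
  also have "\<dots> = (\<Sum>b\<in>labels n. if b = (n, ?q, ?i) then real_of_int ?q / 2 ^ n else 0)"
    by (intro sum.cong refl) (use p in \<open>auto simp: labels_def cell_def cell_value_def indicator_def\<close>)
  also have "\<dots> = (if (n, ?q, ?i) \<in> labels n then real_of_int ?q / 2 ^ n else 0)"
    by (subst sum.delta) (auto simp: labels_def)
  also have "\<dots> = (if \<bar>?q\<bar> \<le> 4 ^ n then real_of_int ?q / 2 ^ n else 0)"
  proof (cases "?q = 0")
    case False
    then have "p \<in> cell (k, n, ?q, ?i)" using p by (simp add: cell_def)
    note cell_memD(3,4)[OF this]
    then have "0 \<le> ?i" "?i < 2 * 8 ^ n" by (auto simp: floor_less_iff)
    then have "(n, ?q, ?i) \<in> labels n \<longleftrightarrow> \<bar>?q\<bar> \<le> 4 ^ n" using False by (auto simp: labels_def abs_le_iff)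
    then show ?thesis by (simp only:)
  qed (simp add: labels_def)
  finally show ?thesis .
qed

lemma poisson_integral_exists:
  obtains Q where "poisson_integral Q marked cell signal labels cell_value (\<lambda>n. sq_norm / 2 ^ n)"
proof -
  interpret pair_sigma_finite M lborel
    by (intro pair_sigma_finite.intro sigma_finite_measure_axioms lborel.sigma_finite_measure_axioms)
  have sf: "sigma_finite_measure marked" unfolding marked_def by unfold_locales
  have cell_fin: "emeasure marked (cell i) < \<infinity>" for i using cell_fmeasurable[of i] by (simp add: fmeasurable_def)
  obtain Q :: "(int \<times> (nat \<times> int \<times> int) \<Rightarrow> bool) measure" where Q: "prob_space Q" "sets Q = sets binary_space"
    "\<And>I. finite I \<Longrightarrow> measure Q {z. \<forall>i\<in>I. z i} = exp (- measure marked (\<Union>i\<in>I. cell i))"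
    using poisson_void_probabilities[of marked cell, OF sf cell_sets cell_fin] by blast
  interpret Q: prob_space Q by fact
  interpret PS: poisson_shift Q marked cell
    by unfold_locales (use Q cell_fmeasurable measure_shift_cell in auto)
  have step: "PS.step (\<lambda>i. cell_value (snd i)) (Pair k ` labels n) p
    = (if \<bar>quant n (signal k p)\<bar> \<le> 4 ^ n then real_of_int (quant n (signal k p)) / 2 ^ n else 0)" if "p \<in> space marked" for p k n
    unfolding PS.step_def by (rule step_quant[OF that])
  have "poisson_integral Q marked cell signal labels cell_value (\<lambda>n. sq_norm / 2 ^ n)"
  proof
    show "square_integrable marked (signal k)" for k by (rule square_integrable_signal)
    show "finite (labels n)" for n by (simp add: labels_def)
    show "disjoint_family_on cell (Pair k ` labels n)" for k n
      by (auto simp: disjoint_family_on_def labels_def cell_def)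
    show "measure marked (cell (0, b)) \<le> sq_norm / 2 ^ n" if "b \<in> labels n" for b n
      using that measure_cell by (auto simp: labels_def)
    show "0 \<le> sq_norm / 2 ^ n" for n using sq_norm_nonneg by simp
    have "(\<lambda>n. sq_norm * (1/2) ^ n) \<longlonglongrightarrow> sq_norm * 0" by (intro tendsto_intros LIMSEQ_power_zero) simp
    then show "(\<lambda>n. sq_norm / 2 ^ n) \<longlonglongrightarrow> 0" by (simp add: power_divide)
    show "\<bar>PS.step (\<lambda>i. cell_value (snd i)) (Pair k ` labels n) p\<bar> \<le> \<bar>signal k p\<bar>" if "p \<in> space marked" for k n p
      using quant_bound[of n "signal k p"] by (simp add: step[OF that] field_simps)
    show "(\<lambda>n. PS.step (\<lambda>i. cell_value (snd i)) (Pair k ` labels n) p) \<longlonglongrightarrow> signal k p" if "p \<in> space marked" for k p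
      unfolding step[OF that] by (rule quant_tendsto)
  qed
  then show ?thesis by (rule that)
qed

text \<open>
  A finite union of cells lies over a set \<open>B\<close> of finite measure, with marks between \<open>0\<close> and
  \<open>2\<close>; since marks are not moved, intersections of its translates have at most twice the
  measure of those of \<open>B\<close>.
\<close>

lemma vanishing_cell:
  assumes I: "finite I" and e: "0 < e"
  shows "\<exists>n w. convex_weights n w \<and> (\<Sum>j<n. \<Sum>k<n. w j * w k *
        measure marked ((\<Union>i\<in>I. cell (fst i + int j, snd i)) \<inter> (\<Union>i\<in>I. cell (fst i + int k, snd i)))) < e"
proof -
  define B where "B = (\<Union>i\<in>I. U (fst i) -` level_set (fst (snd i)) \<inter> space M)"
  have BG: "U k -` level_set n \<inter> space M \<in> fmeasurable M" for k n
  proof (rule fmeasurableI)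
    have "emeasure M (U k -` level_set n \<inter> space M) = emeasure (distr M M (U k)) (level_set n)" by (simp add: emeasure_distr)
    also have "\<dots> = emeasure M (level_set n)" by (simp only: U_preserves)
    finally show "emeasure M (U k -` level_set n \<inter> space M) < \<infinity>" using emeasure_level_set[of n] by (auto intro: le_less_trans)
  qed simp
  have "B \<in> fmeasurable M" unfolding B_def using I BG by (intro fmeasurable.finite_UN) auto
  then have B: "B \<in> sets M" "emeasure M B < \<infinity>" by (auto simp: fmeasurable_def)
  note [measurable] = B(1)
  obtain n w where w: "convex_weights n w" and small:
    "(\<Sum>j<n. \<Sum>k<n. w j * w k * measure M {x \<in> space M. U (int j) x \<in> B \<and> U (int k) x \<in> B}) < e / 2"
    using vanishing[OF B, of "e / 2"] e by auto
  let ?H = "\<lambda>j k. {x \<in> space M. U (int j) x \<in> B \<and> U (int k) x \<in> B}"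
  have le: "measure marked ((\<Union>i\<in>I. cell (fst i + int j, snd i)) \<inter> (\<Union>i\<in>I. cell (fst i + int k, snd i))) \<le> 2 * measure M (?H j k)" for j k
  proof -
    have H: "?H j k \<in> fmeasurable M"
    proof (rule fmeasurableI2)
      show "U (int j) -` B \<inter> space M \<in> fmeasurable M"
      proof (rule fmeasurableI)
        have "emeasure M (U (int j) -` B \<inter> space M) = emeasure (distr M M (U (int j))) B" by (simp add: emeasure_distr)
        then show "emeasure M (U (int j) -` B \<inter> space M) < \<infinity>" using B(2) by (simp only: U_preserves)
      qed simp
    qed auto
    have sub: "(\<Union>i\<in>I. cell (fst i + int j, snd i)) \<subseteq> {p. fst p \<in> space M \<and> U (int j) (fst p) \<in> B \<and> snd p \<in> {0..<2}}" for j
    proof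
      fix p assume "p \<in> (\<Union>i\<in>I. cell (fst i + int j, snd i))"
      then obtain l n m i where i: "(l, n, m, i) \<in> I" and p: "p \<in> cell (l + int j, n, m, i)" by auto
      note cell_memD[OF p]
      moreover have "U (l + int j) (fst p) = U l (U (int j) (fst p))" by (rule U_add) fact
      moreover have "U (int j) (fst p) \<in> space M" using measurable_space[OF U_measurable calculation(1)] .
      ultimately show "p \<in> {p. fst p \<in> space M \<and> U (int j) (fst p) \<in> B \<and> snd p \<in> {0..<2}}"
        using i unfolding B_def by auto force
    qed
    have em: "emeasure marked (?H j k \<times> {0..<2}) = ennreal (measure M (?H j k) * 2)"
    proof -
      have "emeasure marked (?H j k \<times> {0..<2}) = emeasure M (?H j k) * emeasure lborel {0..<2::real}"
        unfolding marked_def using H by (intro lborel.emeasure_pair_measure_Times) auto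
      also have "emeasure M (?H j k) = ennreal (measure M (?H j k))"
        using H by (intro emeasure_eq_measure2)
      finally show ?thesis by (simp add: ennreal_mult)
    qed
    have "measure marked ((\<Union>i\<in>I. cell (fst i + int j, snd i)) \<inter> (\<Union>i\<in>I. cell (fst i + int k, snd i)))
        \<le> measure marked (?H j k \<times> {0..<2})"
    proof (rule measure_mono_fmeasurable)
      show "(\<Union>i\<in>I. cell (fst i + int j, snd i)) \<inter> (\<Union>i\<in>I. cell (fst i + int k, snd i)) \<subseteq> ?H j k \<times> {0..<2}"
        using sub[of j] sub[of k] by (auto simp: mem_Times_iff)
      show "(\<Union>i\<in>I. cell (fst i + int j, snd i)) \<inter> (\<Union>i\<in>I. cell (fst i + int k, snd i)) \<in> sets marked"
        using I by auto
      show "?H j k \<times> {0..<2} \<in> fmeasurable marked"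
        using H em by (intro fmeasurableI) (auto simp: marked_def intro!: pair_measureI)
    qed
    also have "\<dots> = 2 * measure M (?H j k)" using em by (simp add: measure_def)
    finally show ?thesis .
  qed
  have "(\<Sum>j<n. \<Sum>k<n. w j * w k *
        measure marked ((\<Union>i\<in>I. cell (fst i + int j, snd i)) \<inter> (\<Union>i\<in>I. cell (fst i + int k, snd i))))
      \<le> (\<Sum>j<n. \<Sum>k<n. w j * w k * (2 * measure M (?H j k)))"
    using w by (intro sum_mono mult_left_mono le) (auto simp: convex_weights_def)
  also have "\<dots> = 2 * (\<Sum>j<n. \<Sum>k<n. w j * w k * measure M (?H j k))"
    by (simp add: sum_distrib_left algebra_simps)
  also have "\<dots> < e" using small by simp
  finally show ?thesis using w by blast
qed

end

section \<open>Systems of type II infinity\<close>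

theorem theorem4p13:
  fixes \<sigma> :: "real measure" and M :: "'a measure" and T :: "'a \<Rightarrow> 'a"
  assumes "circle_measure \<sigma>" and "symmetric_measure \<sigma>"
    and "emeasure \<sigma> (space \<sigma>) \<noteq> 0"
    and "FS_property \<sigma>"
    and "type_II_infinity M T"
  shows "\<not> (\<exists>f \<in> L2 M. spectral_measure M T f \<sigma>)"
proof
  assume "\<exists>f \<in> L2 M. spectral_measure M T f \<sigma>"
  then obtain f where f: "f \<in> L2 M" and spec: "\<And>k. fourier_coefficient \<sigma> k = (LINT x|M. f (int_iterate M T k x) * cnj (f x))"
    by (auto simp: spectral_measure_def)
  have iso: "measure_isomorphism T M M" and leb: "lebesgue_space M"
    and noinv: "\<not> (\<exists>P. prob_space P \<and> sets P = sets M \<and> absolutely_continuous M P \<and> distr P P T = P)"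
    using assms(5) by (auto simp: type_II_infinity_def dynamical_system_def)
  have T: "T \<in> measurable M M" "distr M M T = M" "bij_betw T (space M) (space M)"
    using iso by (auto simp: measure_isomorphism_def)
  interpret flow: L2_flow M "int_iterate M T" f
  proof (intro L2_flow.intro L2_flow_axioms.intro)
    show "sigma_finite_measure M" by (rule sigma_finite_lebesgue_space[OF leb])
    show "int_iterate M T k \<in> measurable M M" "distr M M (int_iterate M T k) = M" for k
      using int_iterate_preserving[OF iso] by auto
    show "int_iterate M T (j + k) x = int_iterate M T j (int_iterate M T k x)" if "x \<in> space M" for j k x
      by (rule int_iterate_add[OF T(3) that])
    show "\<exists>n w. convex_weights n w \<and> (\<Sum>j<n. \<Sum>k<n. w j * w k *
        measure M {x \<in> space M. int_iterate M T (int j) x \<in> B \<and> int_iterate M T (int k) x \<in> B}) < e"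
      if "B \<in> sets M" "emeasure M B < \<infinity>" "0 < e" for B e
      using averages_of_translates_vanish[OF T(1,2) noinv that] by (simp add: int_iterate_def) blast
  qed (simp_all add: f)
  obtain Q where Q: "poisson_integral Q flow.marked flow.cell flow.signal flow.labels flow.cell_value (\<lambda>n. flow.sq_norm / 2 ^ n)"
    by (rule flow.poisson_integral_exists)
  interpret PI: poisson_integral Q flow.marked flow.cell flow.signal flow.labels flow.cell_value "\<lambda>n. flow.sq_norm / 2 ^ n" by (rule Q)
  obtain X where X: "square_integrable Q X" and mean: "PI.expectation X = 0"
    and cov: "\<And>k. PI.expectation (\<lambda>z. X (shift k z) * X z) = (LINT x|flow.marked. flow.signal k x * flow.signal 0 x)"
    and char: "\<And>t. exp (- 2 * (LINT x|flow.marked. min (t\<^sup>2 * (flow.signal 0 x)\<^sup>2) 2)) \<le> cmod (integral\<^sup>L Q (\<lambda>z. cis (t * X z)))"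
    by (rule PI.stochastic_integral) blast
  have cov': "complex_of_real (PI.expectation (\<lambda>z. X (shift k z) * X z)) = fourier_coefficient \<sigma> k" for k
  proof -
    have "Re (fourier_coefficient \<sigma> k) = PI.expectation (\<lambda>z. X (shift k z) * X z)"
      unfolding cov flow.signal_signal_integral(2) spec ..
    moreover have "Im (fourier_coefficient \<sigma> k) = 0"
      using fourier_coefficient_real[OF assms(1,2), of k] by (simp add: complex_eq_iff)
    ultimately show ?thesis by (simp add: complex_eq_iff)
  qed
  let ?N = "real_model Q" and ?S = "on_reals (shift 1 :: (int \<times> nat \<times> int \<times> int \<Rightarrow> bool) \<Rightarrow> _)"
  have inverse: "shift 1 (shift (-1) z) = z" "shift (-1) (shift 1 z) = z" for z :: "int \<times> nat \<times> int \<times> int \<Rightarrow> bool"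
    by simp_all
  note model = PI.prob_space_axioms PI.sets_Q PI.shift_Q[of 1] PI.shift_Q[of "-1"] inverse PI.shift_preserves[of 1]
  have ergodic: "ergodic_probability_system ?N ?S"
    by (rule ergodic_real_model[OF model])
       (rule PI.ergodic_shift[OF flow.vanishing_cell])
  define g :: "real \<Rightarrow> real" where "g x = X (decode x)" for x
  have XM: "X \<in> borel_measurable binary_space"
    using square_integrable_measurable[OF X] by (simp cong: measurable_cong_sets add: PI.sets_Q)
  have g[measurable]: "g \<in> borel_measurable borel"
    unfolding g_def by (rule measurable_compose[OF measurable_decode XM])
  note integral_model = integral_real_model[OF model]
  have g_encode: "g (encode z) = X z" for z by (simp add: g_def)
  have m2: "(\<lambda>x. (g x)\<^sup>2) \<in> borel_measurable borel" by measurable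
  have g2: "integrable ?N (\<lambda>x. (g x)\<^sup>2)" "(LINT x|?N. (g x)\<^sup>2) = (LINT z|Q. (X z)\<^sup>2)"
    unfolding integral_model[OF m2] g_encode by (simp_all add: square_integrableD[OF X])
  have gN: "g \<in> borel_measurable ?N" by (rule measurable_real_model[OF model g])
  have g0: "(LINT x|?N. g x) = 0" unfolding integral_model(1)[OF g] g_encode by (rule mean)
  have L2g: "g \<in> L2_0 ?N" using gN g2 g0 by (simp add: L2_0_def)
  have "spectral_measure ?N ?S (\<lambda>y. complex_of_real (g y)) \<sigma>"
    unfolding spectral_measure_def
  proof (intro conjI allI assms(1))
    fix k
    note [measurable] = int_iterate_borel[OF model, of k]
    have it: "int_iterate ?N ?S k (encode z) = encode (shift k z)" for z :: "int \<times> nat \<times> int \<times> int \<Rightarrow> bool"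
      by (simp add: int_iterate_encode[OF model] funpow_shift)
    have "(LINT x|?N. complex_of_real (g (int_iterate ?N ?S k x)) * cnj (complex_of_real (g x)))
      = complex_of_real (LINT x|?N. g (int_iterate ?N ?S k x) * g x)"
      by (simp flip: of_real_mult)
    also have "(LINT x|?N. g (int_iterate ?N ?S k x) * g x) = PI.expectation (\<lambda>z. X (shift k z) * X z)"
    proof -
      have "(\<lambda>x. g (int_iterate ?N ?S k x) * g x) \<in> borel_measurable borel" by measurable
      from integral_model(1)[OF this] show ?thesis by (simp only: it g_encode)
    qed
    finally show "fourier_coefficient \<sigma> k = (LINT x|?N. complex_of_real (g (int_iterate ?N ?S k x)) * cnj (complex_of_real (g x)))"
      by (simp only: cov')
  qed
  then have "gaussian_rv ?N g"
    using assms(4) ergodic L2g unfolding FS_property_def by blast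
  then consider m where "AE x in ?N. g x = m" | m s where "0 < s" "distributed ?N lborel g (normal_density m s)"
    by (auto simp: gaussian_rv_def)
  then show False
  proof cases
    case 1
    interpret N: prob_space ?N by (rule prob_space_real_model[OF model])
    \<comment> \<open>A constant of mean zero has variance zero, but the variance is the total mass of
      \<open>\<sigma>\<close>.\<close>
    have "(LINT x|?N. g x) = (LINT x|?N. m)"
      by (rule integral_cong_AE) (use 1 gN in auto)
    then have "m = 0" using g0 by (simp add: N.prob_space)
    then have "(LINT x|?N. (g x)\<^sup>2) = (LINT x|?N. 0)"
      by (intro integral_cong_AE) (use 1 gN in auto)
    then have "PI.expectation (\<lambda>z. X (shift 0 z) * X z) = 0"
      using g2(2) by (simp add: power2_eq_square)
    then have "fourier_coefficient \<sigma> 0 = 0" using cov'[of 0] by simp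
    then have "measure \<sigma> (space \<sigma>) = 0" by (simp add: fourier_coefficient_def)
    moreover have "finite_measure \<sigma>" using assms(1) by (simp add: circle_measure_def)
    ultimately show False using assms(3) by (simp add: finite_measure.emeasure_eq_measure)
  next
    case 2
    have "exp (- 2 * (LINT x|flow.marked. min (t\<^sup>2 * (flow.signal 0 x)\<^sup>2) 2)) \<le> cmod (LINT y|?N. cis (t * g y))" for t
    proof -
      have "(LINT y|?N. cis (t * g y)) = integral\<^sup>L Q (\<lambda>z. cis (t * X z))"
      proof -
        have "(\<lambda>y. cis (t * g y)) \<in> borel_measurable borel" unfolding cis_conv_exp by measurable
        from integral_model(1)[OF this] show ?thesis by (simp only: g_encode)
      qed
      then show ?thesis using char[of t] by simp
    qed
    then show False
      using normal_not_bounded_below[OF prob_space_real_model[OF model] 2 flow.square_integrable_signal[of 0]] by blast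
  qed
qed

end
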